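(* Let Assumption E hold. Let $w_1:[0,T]\times\overline{\mathcal O}\to\mathbb R$ be an upper semicontinuous viscosity subsolution on $[0,T)\times\overline{\mathcal O}$ and $w_2:[0,T]\times\overline{\mathcal O}\to\mathbb R$ a lower semicontinuous viscosity supersolution on $[0,T)\times\mathcal O$ of $$\rho\varphi-\partial_t\varphi+\mathcal H(x,D\varphi,D^2\varphi)=0.$$ If $w_1,w_2$ have polynomial growth on $[0,T]\times\overline{\mathcal O}$ and $w_2$ is of class $\mathcal R(\mathcal O)$, then $w_2\ge w_1$ on $\{T\}\times\overline{\mathcal O}$ implies $w_2\ge w_1$ on $[0,T]\times\overline{\mathcal O}$.
   Context: $\mathcal O\subseteq\mathbb R^d$ is open, $\rho>0$ a constant, $\mathbb M^d$ the $d\times d$ (symmetric) matrices, and $\mathcal H:\mathbb R^d\times\mathbb R^d\times\mathbb M^d\to\mathbb R$ is continuous and nonincreasing in its third argument. Viscosity sub/supersolutions are in the Crandall–Ishii–Lions sense, tested with $C^{1,2}$ functions at local maxima (resp. minima) relative to the indicated set. Assumption E: there is $\alpha>0$ such that $$\liminf_{\eta\downarrow0}\big(\mathcal H(y,q,Y^\eta)-\mathcal H(x,p,X^\eta)\big)\le\alpha\Big(|x-y|\big(1+|q|+n^2|x-y|\big)+(1+|x|)|p-q|+(1+|x|^2)|Q|\Big)$$ for all $x,y\in\overline{\mathcal O}$ with $|x-y|\le1$, all $p,q\in\mathbb R^d$, $Q\in\mathbb M^{2d}$, $n\ge1$ and families $(X^\eta,Y^\eta)_{\eta>0}\subset\mathbb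 M^d\times\mathbb M^d$ satisfying $\begin{pmatrix}X^\eta&0\\0&-Y^\eta\end{pmatrix}\le A_n+\eta A_n^2$ for all $\eta>0$, where $A_n:=n^2\begin{pmatrix}I_d&-I_d\\-I_d&I_d\end{pmatrix}+Q$. Class $\mathcal R(\mathcal O)$: $w:[0,T]\times\overline{\mathcal O}\to\mathbb R$ is of class $\mathcal R(\mathcal O)$ if for every $(t,x)\in[0,T)\times\partial\mathcal O$: (i) there exist an open neighborhood $B$ of $x$ and $\ell:\mathbb R_+\to\mathbb R^d$ with $\liminf_{\varepsilon\to0}\varepsilon^{-1}|\ell(\varepsilon)|<\infty$ and such that for every $\psi:\mathbb R_+\to\mathbb R^d$ with $\psi(\varepsilon)=o(\varepsilon)$ there is $r>0$ with $y+\ell(\varepsilon)+\psi(\varepsilon)\in\mathcal O$ for all $y\in\overline{\mathcal O}\cap B$, $\varepsilon\in(0,r)$; (ii) there is $\lambda:\mathbb R_+\to\mathbb R_+$ with $\lambda(\varepsilon)\to0$ and $w(t+\lambda(\varepsilon),x+\ell(\varepsilon))\to w(t,x)$ as $\varepsilon\to0$. *)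

theory Defs
  imports "HOL-Analysis.Analysis"
begin

type_synonym 'n mat = "real^'n^'n"

definition sym_mat :: "real^'n^'n \<Rightarrow> bool" where
  "sym_mat A \<longleftrightarrow> transpose A = A"

definition mat_le :: "real^'n^'n \<Rightarrow> real^'n^'n \<Rightarrow> bool" where
  "mat_le A B \<longleftrightarrow> (\<forall>v. v \<bullet> (A *v v) \<le> v \<bullet> (B *v v))"

definition blk_diag :: "real^('n::finite)^'n \<Rightarrow> real^'n^'n \<Rightarrow> real^('n::finite+'n)^('n+'n)" where
  "blk_diag X Y = (\<chi> i j. (case (i, j) of
       (Inl a, Inl b) \<Rightarrow> X $ a $ b
     | (Inr a, Inr b) \<Rightarrow> - (Y $ a $ b)
     | _ \<Rightarrow> 0))"

definition J_mat :: "real^('n::finite+'n)^('n+'n)" where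
  "J_mat = (\<chi> i j. (case (i, j) of
       (Inl a, Inl b) \<Rightarrow> (if a = b then 1 else 0)
     | (Inr a, Inr b) \<Rightarrow> (if a = b then 1 else 0)
     | (Inl a, Inr b) \<Rightarrow> (if a = b then -1 else 0)
     | (Inr a, Inl b) \<Rightarrow> (if a = b then -1 else 0)))"

definition A_mat :: "nat \<Rightarrow> real^('n::finite+'n)^('n+'n) \<Rightarrow> real^('n::finite+'n)^('n+'n)" where
  "A_mat n Q = (real n ^ 2) *\<^sub>R J_mat + Q"

definition assumption_E ::
  "(real^'n) set \<Rightarrow> (real^'n \<Rightarrow> real^'n \<Rightarrow> real^'n^'n \<Rightarrow> real) \<Rightarrow> bool" where
  "assumption_E U H \<longleftrightarrow> (\<exists>\<alpha>>0.
     \<forall>x\<in>closure U. \<forall>y\<in>closure U. norm (x - y) \<le> 1 \<longrightarrow>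
     (\<forall>p q Q (n::nat) Xf Yf. sym_mat Q \<longrightarrow> n \<ge> 1 \<longrightarrow>
        (\<forall>\<eta>>0. sym_mat (Xf \<eta>) \<and> sym_mat (Yf \<eta>) \<and>
           mat_le (blk_diag (Xf \<eta>) (Yf \<eta>))
                  (A_mat n Q + \<eta> *\<^sub>R (A_mat n Q ** A_mat n Q))) \<longrightarrow>
        Liminf (at_right 0) (\<lambda>\<eta>. ereal (H y q (Yf \<eta>) - H x p (Xf \<eta>)))
          \<le> ereal (\<alpha> * (norm (x - y) * (1 + norm q + real n ^ 2 * norm (x - y))
                        + (1 + norm x) * norm (p - q) + (1 + norm x ^ 2) * norm Q))))"

definition C12 :: "(real \<Rightarrow> real^'n \<Rightarrow> real) \<Rightarrow> (real \<Rightarrow> real^'n \<Rightarrow> real) \<Rightarrow>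
    (real \<Rightarrow> real^'n \<Rightarrow> real^'n) \<Rightarrow> (real \<Rightarrow> real^'n \<Rightarrow> real^'n^'n) \<Rightarrow> bool" where
  "C12 \<phi> \<phi>t D\<phi> D2\<phi> \<longleftrightarrow>
     (\<forall>t x. ((\<lambda>s. \<phi> s x) has_real_derivative \<phi>t t x) (at t)) \<and>
     (\<forall>t x. (\<phi> t has_derivative (\<lambda>h. D\<phi> t x \<bullet> h)) (at x)) \<and>
     (\<forall>t x. (D\<phi> t has_derivative (\<lambda>h. D2\<phi> t x *v h)) (at x)) \<and>
     continuous_on UNIV (\<lambda>(t, x). \<phi>t t x) \<and>
     continuous_on UNIV (\<lambda>(t, x). D\<phi> t x) \<and>
     continuous_on UNIV (\<lambda>(t, x). D2\<phi> t x)"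

definition loc_max_rel :: "(real \<Rightarrow> real^'n \<Rightarrow> real) \<Rightarrow> (real \<times> (real^'n)) set \<Rightarrow> real \<Rightarrow> real^'n \<Rightarrow> bool" where
  "loc_max_rel f S t x \<longleftrightarrow> (\<exists>e>0. \<forall>(s, y)\<in>S. dist (s, y) (t, x) < e \<longrightarrow> f s y \<le> f t x)"

definition loc_min_rel :: "(real \<Rightarrow> real^'n \<Rightarrow> real) \<Rightarrow> (real \<times> (real^'n)) set \<Rightarrow> real \<Rightarrow> real^'n \<Rightarrow> bool" where
  "loc_min_rel f S t x \<longleftrightarrow> (\<exists>e>0. \<forall>(s, y)\<in>S. dist (s, y) (t, x) < e \<longrightarrow> f t x \<le> f s y)"

definition visc_sub :: "real \<Rightarrow> (real^'n \<Rightarrow> real^'n \<Rightarrow> real^'n^'n \<Rightarrow> real) \<Rightarrow>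
    (real \<Rightarrow> real^'n \<Rightarrow> real) \<Rightarrow> (real \<times> (real^'n)) set \<Rightarrow> bool" where
  "visc_sub \<rho> H w S \<longleftrightarrow> (\<forall>t x \<phi> \<phi>t D\<phi> D2\<phi>. (t, x) \<in> S \<longrightarrow> C12 \<phi> \<phi>t D\<phi> D2\<phi> \<longrightarrow>
      loc_max_rel (\<lambda>s y. w s y - \<phi> s y) S t x \<longrightarrow>
      \<rho> * w t x - \<phi>t t x + H x (D\<phi> t x) (D2\<phi> t x) \<le> 0)"

definition visc_super :: "real \<Rightarrow> (real^'n \<Rightarrow> real^'n \<Rightarrow> real^'n^'n \<Rightarrow> real) \<Rightarrow>
    (real \<Rightarrow> real^'n \<Rightarrow> real) \<Rightarrow> (real \<times> (real^'n)) set \<Rightarrow> bool" where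
  "visc_super \<rho> H w S \<longleftrightarrow> (\<forall>t x \<phi> \<phi>t D\<phi> D2\<phi>. (t, x) \<in> S \<longrightarrow> C12 \<phi> \<phi>t D\<phi> D2\<phi> \<longrightarrow>
      loc_min_rel (\<lambda>s y. w s y - \<phi> s y) S t x \<longrightarrow>
      \<rho> * w t x - \<phi>t t x + H x (D\<phi> t x) (D2\<phi> t x) \<ge> 0)"

definition usc_on :: "('a::topological_space) set \<Rightarrow> ('a \<Rightarrow> real) \<Rightarrow> bool" where
  "usc_on S f \<longleftrightarrow> (\<forall>z\<in>S. \<forall>c. f z < c \<longrightarrow> eventually (\<lambda>z'. f z' < c) (at z within S))"

definition lsc_on :: "('a::topological_space) set \<Rightarrow> ('a \<Rightarrow> real) \<Rightarrow> bool" where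
  "lsc_on S f \<longleftrightarrow> (\<forall>z\<in>S. \<forall>c. c < f z \<longrightarrow> eventually (\<lambda>z'. c < f z') (at z within S))"

definition poly_growth :: "real \<Rightarrow> (real^'n) set \<Rightarrow> (real \<Rightarrow> real^'n \<Rightarrow> real) \<Rightarrow> bool" where
  "poly_growth T U w \<longleftrightarrow> (\<exists>C (k::nat). \<forall>t\<in>{0..T}. \<forall>x\<in>closure U. \<bar>w t x\<bar> \<le> C * (1 + norm x ^ k))"

definition class_R :: "real \<Rightarrow> (real^'n) set \<Rightarrow> (real \<Rightarrow> real^'n \<Rightarrow> real) \<Rightarrow> bool" where
  "class_R T U w \<longleftrightarrow> (\<forall>t\<in>{0..<T}. \<forall>x\<in>frontier U.
     \<exists>B l. open B \<and> x \<in> B \<and>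
       Liminf (at_right 0) (\<lambda>\<epsilon>. ereal (norm (l \<epsilon>) / \<epsilon>)) < \<infinity> \<and>
       (\<forall>\<psi>. ((\<lambda>\<epsilon>. norm (\<psi> \<epsilon>) / \<epsilon>) \<longlongrightarrow> 0) (at_right 0) \<longrightarrow>
          (\<exists>r>0. \<forall>y\<in>closure U \<inter> B. \<forall>\<epsilon>\<in>{0<..<r}. y + l \<epsilon> + \<psi> \<epsilon> \<in> U)) \<and>
       (\<exists>lam::real\<Rightarrow>real. (\<forall>\<epsilon>>0. lam \<epsilon> \<ge> 0) \<and> (lam \<longlongrightarrow> 0) (at_right 0) \<and>
          ((\<lambda>\<epsilon>. w (t + lam \<epsilon>) (x + l \<epsilon>)) \<longlongrightarrow> w t x) (at_right 0)))"

end

theory Submission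
  imports Defs
begin

text \<open>
  Suppose \<open>w1 - w2\<close> is positive somewhere. After subtracting a small multiple of
  \<open>exp (\<kappa> (T - t)) (1 + |x|\<^sup>2) ^ m\<close>, it has a positive maximum at some \<open>(t0, x0)\<close> with \<open>t0 < T\<close>.
  Double the variables with the coupling term
  \<open>(n\<^sup>2 / 2) (|x - y + l|\<^sup>2 + (t - s + \<lambda>)\<^sup>2)\<close>, where \<open>(\<lambda>, l)\<close> comes from class R at \<open>(t0, x0)\<close>:
  the shift by \<open>l\<close> pushes the maximiser \<open>y\<close> into the open set, where the supersolution property holds.
  Ishii's theorem on sums gives the matrices for the structural assumption, and its right-hand
  side is smaller than \<open>\<rho>\<close> times the maximum, because \<open>\<kappa>\<close> absorbs the penalty and \<open>n |l|\<close> can be kept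
  small by taking \<open>n\<close> to be a small multiple of the inverse of the parameter of class R.

  The theorem on sums needs a point of second-order differentiability of a semiconvex function near
  a strict maximum. With \<open>P\<close> the resolvent of the subdifferential of a convex function (a nonexpansive map),
  Rademacher's theorem makes \<open>P\<close> differentiable almost everywhere; the points \<open>x + p\<close> at which
  the function is touched from above, after a small linear perturbation, form a non-negligible set,
  and there the derivative of \<open>P\<close> is invertible and yields a second-order expansion.
\<close>

section \<open>Rademacher's theorem\<close>

text \<open>The subsolution inequality holds up to the boundary, the supersolution inequality only
  inside: this asymmetry shapes the coupling. At a maximiser \<open>x - y + l\<close> is
  \<open>o(1/n)\<close>, while class R tolerates perturbations \<open>o(\<epsilon>)\<close> of the
  shift \<open>l(\<epsilon>)\<close>; with \<open>n\<close> comparable to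
  \<open>1/\<epsilon>\<close> the two match. The price is that the term
  \<open>n\<^sup>2 |x - y|\<^sup>2\<close> of the structural assumption no longer tends to 0, since
  \<open>n |l|\<close> is merely bounded; the finite liminf of
  \<open>|l(\<epsilon>)| / \<epsilon>\<close> allows the bound to be any
  \<open>\<theta> > 0\<close>. Class R gives convergence of \<open>w2\<close> along points moved in
  time as well, so time is doubled too, and the theorem on sums is applied to functions of
  \<open>(t, x)\<close>, with only the spatial blocks of the Hessians kept. Near the maximiser the
  penalty is replaced by a quadratic majorant, so that the whole test function is quadratic. Its
  space derivatives, weighted by \<open>1 + |x|\<close> and \<open>1 + |x|\<^sup>2\<close>, cost a
  constant multiple of the penalty itself, and this determines \<open>\<kappa>\<close>.\<close>

lemma vitali_measure_comparison:
  fixes A :: "'a::euclidean_space set"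
  assumes s1 [measurable_cong]: "sets \<mu>1 = sets borel" and s2 [measurable_cong]: "sets \<mu>2 = sets borel"
    and ac1: "\<And>X. X \<in> sets borel \<Longrightarrow> bounded X \<Longrightarrow> emeasure \<mu>1 X \<le> ennreal c * emeasure lborel X"
    and ac2: "\<And>X. X \<in> sets borel \<Longrightarrow> bounded X \<Longrightarrow> emeasure \<mu>2 X \<le> ennreal c * emeasure lborel X"
    and A: "A \<in> sets borel" "bounded A"
    and fine: "\<And>x d. x \<in> A \<Longrightarrow> 0 < d \<Longrightarrow>
      \<exists>a r. 0 < r \<and> r < d \<and> x \<in> cball a r \<and> emeasure \<mu>1 (cball a r) \<le> emeasure \<mu>2 (cball a r)"
  shows "emeasure \<mu>1 A \<le> emeasure \<mu>2 A"
proof (rule ennreal_le_epsilon)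
  fix e :: real assume e: "0 < e"
  obtain R where R: "A \<subseteq> ball 0 R"
    using A(2) bounded_subset_ballD by blast
  have Al: "A \<in> sets lebesgue" using A(1) by auto
  define e' where "e' = e / (\<bar>c\<bar> + 1)"
  have "e' > 0" using e by (simp add: e'_def)
  obtain T where T: "open T" "A \<subseteq> T" "emeasure lebesgue (T - A) < ennreal e'"
    by (rule sets_lebesgue_outer_open[OF Al \<open>e' > 0\<close>])
  \<comment> \<open>The domination of the measures is available on bounded sets only, so the outer
    open set is cut down to a ball.\<close>
  define V where "V = T \<inter> ball 0 R"
  have V: "open V" "A \<subseteq> V" "bounded V" using T R bounded_ball by (auto simp: V_def bounded_Int)
  have VA: "emeasure lborel (V - A) \<le> ennreal e'"
  proof -
    have "emeasure lborel (V - A) = emeasure lebesgue (V - A)"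
      using V A by simp
    also have "\<dots> \<le> emeasure lebesgue (T - A)"
      by (rule emeasure_mono) (use T A in \<open>auto simp: V_def\<close>)
    finally show ?thesis using T(3) by simp
  qed
  define K where "K = {(a, r). 0 < r \<and> cball a r \<subseteq> V \<and> emeasure \<mu>1 (cball a r) \<le> emeasure \<mu>2 (cball a r)}"
  have fineK: "\<exists>i. i \<in> K \<and> x \<in> cball (fst i) (snd i) \<and> snd i < d" if x: "x \<in> A" and d: "0 < d" for x d
  proof -
    obtain s where s: "s > 0" "ball x s \<subseteq> V" using V x openE by blast
    obtain a r where ar: "0 < r" "r < min d (s/2)" "x \<in> cball a r"
      "emeasure \<mu>1 (cball a r) \<le> emeasure \<mu>2 (cball a r)"
      using fine[OF x, of "min d (s/2)"] d s by auto
    have "cball a r \<subseteq> ball x s"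
    proof
      fix y assume "y \<in> cball a r"
      then have "dist x y \<le> dist a x + dist a y" by (metis dist_commute dist_triangle)
      then show "y \<in> ball x s" using ar \<open>y \<in> cball a r\<close> by (auto simp: min_less_iff_conj)
    qed
    then have "(a, r) \<in> K" using ar s by (auto simp: K_def)
    then show ?thesis using ar by (intro exI[of _ "(a,r)"]) auto
  qed
  \<comment> \<open>Vitali selects disjoint balls that cover \<open>A\<close> up to a Lebesgue null
    set, which \<open>\<mu>1\<close> does not see by \<open>ac1\<close>. The balls stay inside
    \<open>V\<close>, so by \<open>ac2\<close> their total \<open>\<mu>2\<close>-measure exceeds
    that of \<open>A\<close> by at most \<open>e\<close>.\<close>
  obtain C where C: "countable C" "C \<subseteq> K"
    "pairwise (\<lambda>i j. disjnt (cball (fst i) (snd i)) (cball (fst j) (snd j))) C"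
    "negligible (A - (\<Union>i\<in>C. cball (fst i) (snd i)))"
  proof (rule Vitali_covering_theorem_cballs[of K snd A fst])
    show "0 < snd i" if "i \<in> K" for i using that by (auto simp: K_def)
  qed (use fineK in blast)+
  define W where "W = (\<Union>i\<in>C. cball (fst i) (snd i))"
  have Wb: "W \<in> sets borel" unfolding W_def using C(1) by (intro sets.countable_UN') auto
  have "cball (fst i) (snd i) \<subseteq> V" if "i \<in> K" for i using that by (auto simp: K_def)
  then have WV: "W \<subseteq> V" using C(2) unfolding W_def by blast
  have dis: "disjoint_family_on (\<lambda>i. cball (fst i) (snd i)) C"
    using C(3) by (auto simp: disjoint_family_on_def pairwise_def disjnt_def)
  have nul: "emeasure \<mu>1 (A - W) = 0"
  proof -
    have "A - W \<in> sets borel" using A Wb by auto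
    moreover have "emeasure lborel (A - W) = 0"
      using C(4) calculation unfolding W_def by (subst (asm) negligible_iff_emeasure0) auto
    moreover have "bounded (A - W)" using A(2) by (rule bounded_subset) auto
    ultimately show ?thesis using ac1[of "A - W"] by simp
  qed
  have "emeasure \<mu>1 A \<le> emeasure \<mu>1 (W \<union> (A - W))"
    by (rule emeasure_mono) (use A Wb in \<open>auto simp: s1\<close>)
  also have "\<dots> \<le> emeasure \<mu>1 W + emeasure \<mu>1 (A - W)"
    by (rule emeasure_subadditive) (use A Wb in \<open>auto simp: s1\<close>)
  also have "\<dots> = emeasure \<mu>1 W" using nul by simp
  also have "\<dots> = (\<integral>\<^sup>+i. emeasure \<mu>1 (cball (fst i) (snd i)) \<partial>count_space C)"
    unfolding W_def by (rule emeasure_UN_countable) (use C dis in \<open>auto simp: s1\<close>)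
  also have "\<dots> \<le> (\<integral>\<^sup>+i. emeasure \<mu>2 (cball (fst i) (snd i)) \<partial>count_space C)"
    by (rule nn_integral_mono) (use C(2) in \<open>auto simp: K_def\<close>)
  also have "\<dots> = emeasure \<mu>2 W"
    unfolding W_def by (rule emeasure_UN_countable[symmetric]) (use C dis in \<open>auto simp: s2\<close>)
  also have "\<dots> \<le> emeasure \<mu>2 (A \<union> (V - A))"
    by (rule emeasure_mono) (use WV A V in \<open>auto simp: s2\<close>)
  also have "\<dots> \<le> emeasure \<mu>2 A + emeasure \<mu>2 (V - A)"
    by (rule emeasure_subadditive) (use A V in \<open>auto simp: s2\<close>)
  also have "emeasure \<mu>2 (V - A) \<le> ennreal c * emeasure lborel (V - A)"
    by (rule ac2) (use A V bounded_diff in auto)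
  also have "\<dots> \<le> ennreal c * ennreal e'"
    using VA by (rule mult_left_mono) auto
  also have "\<dots> \<le> ennreal e"
  proof -
    have "c * e' \<le> \<bar>c\<bar> * e'" using \<open>e' > 0\<close> by (intro mult_right_mono) auto
    also have "\<dots> \<le> e" using e by (simp add: e'_def field_simps)
    finally show ?thesis using \<open>e' > 0\<close>
      by (cases "c \<ge> 0") (auto simp: ennreal_mult[symmetric] ennreal_neg intro!: ennreal_leI)
  qed
  finally show "emeasure \<mu>1 A \<le> emeasure \<mu>2 A + ennreal e"
    by (simp add: add_left_mono)
qed

text \<open>An interval \<open>{u..v}\<close> has measure \<open>g v - g u \<le> c (v - u)\<close>;
  nonoverlapping intervals that cover \<open>X\<close> with small excess carry this over to Borel
  sets. It supplies the domination that \<open>vitali_measure_comparison\<close> asks for.\<close>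

lemma interval_measure_le_lborel:
  fixes g :: "real \<Rightarrow> real"
  assumes mono: "\<And>x y. x \<le> y \<Longrightarrow> g x \<le> g y"
    and lip: "\<And>x y. x \<le> y \<Longrightarrow> g y - g x \<le> c * (y - x)"
    and X: "X \<in> sets borel" "bounded X"
  shows "emeasure (interval_measure g) X \<le> ennreal c * emeasure lborel X"
proof -
  have c: "c \<ge> 0" using mono[of 0 1] lip[of 0 1] by simp
  have cont: "continuous_on UNIV g"
  proof (rule lipschitz_on_continuous_on)
    show "c-lipschitz_on UNIV g"
    proof (rule lipschitz_onI)
      fix x y :: real
      show "dist (g x) (g y) \<le> c * dist x y"
        using mono[of x y] mono[of y x] lip[of x y] lip[of y x] by (cases "x \<le> y") (auto simp: dist_real_def)
    qed (rule c)
  qed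
  obtain a where a: "X \<subseteq> cbox (-a) a" using bounded_subset_cbox_symmetric[OF X(2)] by blast
  have Xl: "X \<in> lmeasurable" using X by (intro bounded_set_imp_lmeasurable) auto
  have mm: "emeasure lborel X = ennreal (measure lebesgue X)" if "X \<in> sets borel" "X \<in> lmeasurable" for X :: "real set"
  proof -
    have "emeasure lborel X = emeasure lebesgue X" using that by simp
    then show ?thesis using that by (simp add: emeasure_eq_measure2 fmeasurableD2)
  qed
  show ?thesis
  proof (rule ennreal_le_epsilon)
    fix e :: real assume e: "0 < e"
    define e' where "e' = e / (c + 1)"
    have e': "e' > 0" "c * e' \<le> e" using e c by (auto simp: e'_def field_simps)
    obtain D where D: "countable D" "\<And>K. K \<in> D \<Longrightarrow> K \<subseteq> cbox (-a) a \<and> K \<noteq> {} \<and> (\<exists>c d. K = cbox c d)"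
      "pairwise (\<lambda>A B. interior A \<inter> interior B = {}) D"
      "X \<subseteq> \<Union>D" "\<Union>D \<in> lmeasurable" "measure lebesgue (\<Union>D) \<le> measure lebesgue X + e'"
      by (rule measurable_outer_intervals_bounded[OF Xl a \<open>e' > 0\<close>]) metis
    have Db: "K \<in> sets borel" if "K \<in> D" for K using D(2)[OF that] by auto
    have K1: "emeasure (interval_measure g) K \<le> ennreal c * emeasure lborel (interior K)" if KD: "K \<in> D" for K
    proof -
      obtain u v where uv: "K = {u..v}" "u \<le> v" using D(2)[OF KD] by (auto simp: cbox_interval)
      have "emeasure (interval_measure g) K = ennreal (g v - g u)"
        using emeasure_interval_measure_Icc[OF uv(2) mono cont] uv by simp
      also have "\<dots> \<le> ennreal (c * (v - u))" using lip[OF uv(2)] by (rule ennreal_leI)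
      also have "\<dots> = ennreal c * emeasure lborel (interior K)"
        using uv c by (simp add: ennreal_mult)
      finally show ?thesis .
    qed
    \<comment> \<open>The covering intervals may share end points. These carry no mass as
      \<open>g\<close> is continuous, so the disjoint interiors can be used instead.\<close>
    have nul: "K - interior K \<in> null_sets (interval_measure g)" if KD: "K \<in> D" for K
    proof -
      obtain u v where uv: "K = {u..v}" "u \<le> v" using D(2)[OF KD] by (auto simp: cbox_interval)
      have 0: "{x} \<in> null_sets (interval_measure g)" for x
        using emeasure_interval_measure_Icc[of x x, OF _ mono cont] by (auto simp: null_sets_def)
      have "{u} \<union> {v} \<in> null_sets (interval_measure g)" using 0 by (rule null_sets.Un) (rule 0)
      then show ?thesis by (rule null_sets_subset) (use uv in auto)
    qed
    have nul': "(\<Union>K\<in>D. K - interior K) \<in> null_sets (interval_measure g)"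
      using D(1) nul by (rule null_sets_UN')
    have Ib: "(\<Union>K\<in>D. interior K) \<in> sets borel" by (intro borel_open) auto
    have "emeasure (interval_measure g) X \<le> emeasure (interval_measure g) ((\<Union>K\<in>D. interior K) \<union> (\<Union>K\<in>D. K - interior K))"
    proof (rule emeasure_mono)
      show "X \<subseteq> (\<Union>K\<in>D. interior K) \<union> (\<Union>K\<in>D. K - interior K)"
        using D(4) by blast
    qed (use Ib nul' in \<open>auto dest: null_setsD2\<close>)
    also have "\<dots> = emeasure (interval_measure g) (\<Union>K\<in>D. interior K)"
      by (rule emeasure_Un_null_set) (use Ib nul' in auto)
    also have "\<dots> = (\<integral>\<^sup>+K. emeasure (interval_measure g) (interior K) \<partial>count_space D)"
      by (rule emeasure_UN_countable) (use D in \<open>auto simp: disjoint_family_on_def pairwise_def\<close>)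
    also have "\<dots> \<le> (\<integral>\<^sup>+K. emeasure (interval_measure g) K \<partial>count_space D)"
      by (rule nn_integral_mono) (use Db interior_subset in \<open>auto intro!: emeasure_mono\<close>)
    also have "\<dots> \<le> (\<integral>\<^sup>+K. ennreal c * emeasure lborel (interior K) \<partial>count_space D)"
      by (rule nn_integral_mono) (use K1 in auto)
    also have "\<dots> = ennreal c * (\<integral>\<^sup>+K. emeasure lborel (interior K) \<partial>count_space D)"
      by (rule nn_integral_cmult) auto
    also have "(\<integral>\<^sup>+K. emeasure lborel (interior K) \<partial>count_space D) = emeasure lborel (\<Union>K\<in>D. interior K)"
      by (rule emeasure_UN_countable[symmetric]) (use D in \<open>auto simp: disjoint_family_on_def pairwise_def\<close>)
    also have "\<dots> \<le> emeasure lborel (\<Union>D)"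
    proof (rule emeasure_mono)
      show "(\<Union>K\<in>D. interior K) \<subseteq> \<Union>D" using interior_subset by fast
      show "\<Union>D \<in> sets lborel" using D(1) Db by (auto intro!: sets.countable_Union)
    qed
    also have "\<dots> = ennreal (measure lebesgue (\<Union>D))"
      by (rule mm[OF _ D(5)]) (use D(1) Db in \<open>auto intro!: sets.countable_Union\<close>)
    also have "\<dots> \<le> ennreal (measure lebesgue X + e')" using D(6) by (rule ennreal_leI)
    also have "\<dots> = emeasure lborel X + ennreal e'"
      using mm[OF X(1) Xl] e' by (simp add: ennreal_plus)
    also have "ennreal c * (emeasure lborel X + ennreal e') = ennreal c * emeasure lborel X + ennreal (c * e')"
      using c e' by (simp add: distrib_left ennreal_mult)
    also have "\<dots> \<le> ennreal c * emeasure lborel X + ennreal e"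
      by (intro add_left_mono ennreal_leI e'(2))
    finally show "emeasure (interval_measure g) X \<le> ennreal c * emeasure lborel X + ennreal e"
      by (simp add: mult_left_mono)
  qed
qed


lemma negligible_countable_UN:
  assumes "countable I" "\<And>i. i \<in> I \<Longrightarrow> negligible (S i)"
  shows "negligible (\<Union>i\<in>I. S i)"
  by (rule negligible_countable_Union) (use assms in auto)

text \<open>Lebesgue's argument with measures: where the lower derivative is below \<open>p\<close>
  and the upper one above \<open>q > p\<close>, the Stieltjes measure of the set is at most
  \<open>p\<close> times and at least \<open>q\<close> times its Lebesgue measure, which forces the
  latter to be 0. Countably many rational pairs exhaust the points of non-differentiability.\<close>

lemma lipschitz_derivative_ae_real:
  fixes f :: "real \<Rightarrow> real"
  assumes lip: "\<And>x y. \<bar>f x - f y\<bar> \<le> L * \<bar>x - y\<bar>"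
  shows "negligible {x. \<not> (\<exists>D. (f has_real_derivative D) (at x))}"
proof -
  have L: "L \<ge> 0" using lip[of 0 1] by (simp add: abs_if split: if_splits)
  \<comment> \<open>The added slope \<open>L + 1\<close> gives an increasing function with all
    difference quotients between 1 and \<open>2 * L + 1\<close>, which therefore defines a
    measure.\<close>
  define g where "g = (\<lambda>x. f x + (L + 1) * x)"
  have slope: "y - x \<le> g y - g x" "g y - g x \<le> (2 * L + 1) * (y - x)" if "x \<le> y" for x y
    using lip[of y x] that by (auto simp: g_def algebra_simps abs_if split: if_splits)
  have mono: "g x \<le> g y" if "x \<le> y" for x y using slope[OF that] that by simp
  have cf: "continuous_on UNIV f"
    by (rule lipschitz_on_continuous_on[of L]) (use lip L in \<open>auto simp: lipschitz_on_def dist_real_def\<close>)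
  have cg: "continuous_on UNIV g"
    unfolding g_def by (intro continuous_intros cf)
  have cgx: "continuous_on UNIV (\<lambda>x. g (x + h))" for h
    by (rule continuous_on_compose2[OF cg]) (auto intro!: continuous_intros)
  define Q where "Q = (\<lambda>x h. (g (x + h) - g x) / h)"
  have cQ: "continuous_on UNIV (\<lambda>x. Q x h)" for h
    unfolding Q_def divide_inverse by (intro continuous_intros cg cgx)
  \<comment> \<open>At such points there are arbitrarily small increments \<open>h\<close> with
    quotient below \<open>p\<close>, and others with quotient above \<open>q\<close>. For fixed
    \<open>h\<close> both conditions are open in \<open>x\<close>, hence the set is Borel.\<close>
  define A where "A = (\<lambda>p q M. ball 0 (real M) \<inter> (\<Inter>j::nat. (\<Union>h\<in>{h. h \<noteq> 0 \<and> \<bar>h\<bar> < inverse (real (Suc j))}. {x. Q x h < p}) \<inter>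
     (\<Union>h\<in>{h. h \<noteq> 0 \<and> \<bar>h\<bar> < inverse (real (Suc j))}. {x. q < Q x h})))"
  have op: "open (\<Union>h\<in>H. {x. Q x h < p})" "open (\<Union>h\<in>H. {x. q < Q x h})" for H p q
    by (intro open_UN ballI open_Collect_less cQ continuous_intros)+
  have Ab: "A p q M \<in> sets borel" for p q M
    unfolding A_def
  proof (rule sets.Int)
    show "(\<Inter>j::nat. (\<Union>h\<in>{h. h \<noteq> 0 \<and> \<bar>h\<bar> < inverse (real (Suc j))}. {x. Q x h < p}) \<inter>
     (\<Union>h\<in>{h. h \<noteq> 0 \<and> \<bar>h\<bar> < inverse (real (Suc j))}. {x. q < Q x h})) \<in> sets borel"
      by (rule sets.countable_INT'') (simp, simp, intro borel_open open_Int op)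
  qed simp
  have Abd: "bounded (A p q M)" for p q M by (auto simp: A_def)
  let ?\<mu> = "interval_measure g"
  \<comment> \<open>The interval with end points \<open>x\<close> and \<open>x + h\<close> is a ball
    having \<open>x\<close> on its boundary; for this reason the comparison lemma admits balls that
    are not centred at the point.\<close>
  have ivl: "\<exists>a r. 0 < r \<and> r < d \<and> x \<in> cball a r \<and>
      emeasure ?\<mu> (cball a r) = ennreal (Q x h * \<bar>h\<bar>) \<and> emeasure lborel (cball a r) = ennreal \<bar>h\<bar>"
    if h: "h \<noteq> 0" "\<bar>h\<bar> < d" for x h d
  proof (intro exI conjI)
    show "0 < \<bar>h\<bar>/2" "\<bar>h\<bar>/2 < d" "x \<in> cball (x + h/2) (\<bar>h\<bar>/2)" using h by (auto simp: dist_real_def)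
    have c: "cball (x + h/2) (\<bar>h\<bar>/2) = {min x (x+h)..max x (x+h)}"
      by (auto simp: dist_real_def abs_if min_def max_def split: if_splits)
    show "emeasure lborel (cball (x + h/2) (\<bar>h\<bar>/2)) = ennreal \<bar>h\<bar>"
      unfolding c by (simp add: min_def max_def abs_if)
    have "emeasure ?\<mu> {min x (x+h)..max x (x+h)} = ennreal (g (max x (x+h)) - g (min x (x+h)))"
      by (rule emeasure_interval_measure_Icc[OF _ mono cg]) auto
    also have "g (max x (x+h)) - g (min x (x+h)) = Q x h * \<bar>h\<bar>"
      using h by (auto simp: Q_def min_def max_def abs_if field_simps)
    finally show "emeasure ?\<mu> (cball (x + h/2) (\<bar>h\<bar>/2)) = ennreal (Q x h * \<bar>h\<bar>)" unfolding c .
  qed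
  have Qpos: "Q x h \<ge> 1" if "h \<noteq> 0" for x h
    using slope(1)[of x "x+h"] slope(1)[of "x+h" x] that
    by (cases "h > 0") (auto simp: Q_def le_divide_eq)
  have small: "\<exists>j. inverse (real (Suc j)) < d" if "d > 0" for d using reals_Archimedean[OF that] by blast
  have null: "negligible (A p q M)" if pq: "p < q" for p q M
  proof (cases "A p q M = {}")
    case False
    then obtain x0 where "x0 \<in> A p q M" by blast
    then obtain h0 where "h0 \<noteq> 0" "Q x0 h0 < p" unfolding A_def by blast
    then have p: "p > 1" using Qpos[of h0 x0] by linarith
    define C where "C = max (2 * L + 1) q"
    have ac: "emeasure ?\<mu> X \<le> ennreal C * emeasure lborel X" if "X \<in> sets borel" "bounded X" for X
    proof -
      have "emeasure ?\<mu> X \<le> ennreal (2 * L + 1) * emeasure lborel X"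
        by (rule interval_measure_le_lborel[OF mono slope(2) that])
      also have "\<dots> \<le> ennreal C * emeasure lborel X"
        by (intro mult_right_mono ennreal_leI) (auto simp: C_def)
      finally show ?thesis .
    qed
    have acs: "emeasure (scale_measure (ennreal r) lborel) X \<le> ennreal C * emeasure lborel X" if "r \<le> q" for X r
      using that by (auto intro!: mult_right_mono ennreal_leI simp: C_def)
    have 1: "emeasure ?\<mu> (A p q M) \<le> emeasure (scale_measure (ennreal p) lborel) (A p q M)"
    proof (rule vitali_measure_comparison[OF _ _ ac acs Ab Abd])
      fix x d :: real assume x: "x \<in> A p q M" and d: "0 < d"
      obtain j where j: "inverse (real (Suc j)) < d" using small[OF d] by blast
      obtain h where h: "h \<noteq> 0" "\<bar>h\<bar> < inverse (real (Suc j))" "Q x h < p" using x unfolding A_def by blast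
      obtain a r where ar: "0 < r" "r < d" "x \<in> cball a r"
        "emeasure ?\<mu> (cball a r) = ennreal (Q x h * \<bar>h\<bar>)" "emeasure lborel (cball a r) = ennreal \<bar>h\<bar>"
        using ivl[of h d x] h j by auto
      have "emeasure ?\<mu> (cball a r) \<le> emeasure (scale_measure (ennreal p) lborel) (cball a r)"
        using ar h p by (simp add: ennreal_mult[symmetric] ennreal_leI mult_right_mono)
      with ar show "\<exists>a r. 0 < r \<and> r < d \<and> x \<in> cball a r \<and> emeasure ?\<mu> (cball a r) \<le> emeasure (scale_measure (ennreal p) lborel) (cball a r)"
        by blast
    qed (use pq in auto)
    have 2: "emeasure (scale_measure (ennreal q) lborel) (A p q M) \<le> emeasure ?\<mu> (A p q M)"
    proof (rule vitali_measure_comparison[OF _ _ acs ac Ab Abd])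
      fix x d :: real assume x: "x \<in> A p q M" and d: "0 < d"
      obtain j where j: "inverse (real (Suc j)) < d" using small[OF d] by blast
      obtain h where h: "h \<noteq> 0" "\<bar>h\<bar> < inverse (real (Suc j))" "q < Q x h" using x unfolding A_def by blast
      obtain a r where ar: "0 < r" "r < d" "x \<in> cball a r"
        "emeasure ?\<mu> (cball a r) = ennreal (Q x h * \<bar>h\<bar>)" "emeasure lborel (cball a r) = ennreal \<bar>h\<bar>"
        using ivl[of h d x] h j by auto
      have "emeasure (scale_measure (ennreal q) lborel) (cball a r) \<le> emeasure ?\<mu> (cball a r)"
        using ar h p pq by (simp add: ennreal_mult[symmetric] ennreal_leI mult_right_mono)
      with ar show "\<exists>a r. 0 < r \<and> r < d \<and> x \<in> cball a r \<and> emeasure (scale_measure (ennreal q) lborel) (cball a r) \<le> emeasure ?\<mu> (cball a r)"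
        by blast
    qed (use pq in auto)
    have fin: "emeasure lborel (A p q M) < \<infinity>" using Abd by (rule emeasure_bounded_finite)
    then obtain m where m: "m \<ge> 0" "emeasure lborel (A p q M) = ennreal m"
      by (cases "emeasure lborel (A p q M)") auto
    have "ennreal (q * m) \<le> ennreal (p * m)" using 1 2 m p pq by (simp add: ennreal_mult)
    then have "q * m \<le> p * m" using m p by (simp add: ennreal_le_iff)
    then have "m = 0" using pq m by (smt (verit) mult_strict_right_mono)
    then show ?thesis using m Ab by (subst negligible_iff_emeasure0) auto
  qed auto
  have "negligible (\<Union>p\<in>\<rat>. \<Union>q\<in>\<rat>. \<Union>M. if p < q then A p q M else {})"
    by (intro negligible_countable_UN countable_rat) (auto intro: null)
  moreover have "{x. \<not> (\<exists>D. (f has_real_derivative D) (at x))} \<subseteq> (\<Union>p\<in>\<rat>. \<Union>q\<in>\<rat>. \<Union>M. if p < q then A p q M else {})"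
  proof
    fix x assume "x \<in> {x. \<not> (\<exists>D. (f has_real_derivative D) (at x))}"
    then have nd: "\<not> (\<exists>D. (f has_real_derivative D) (at x))" by simp
    let ?F = "at (0::real)"
    define l where "l = Liminf ?F (\<lambda>h. ereal (Q x h))"
    define u where "u = Limsup ?F (\<lambda>h. ereal (Q x h))"
    have lu: "l \<le> u" unfolding l_def u_def by (rule Liminf_le_Limsup) simp
    have "l \<noteq> u"
    proof
      assume eq: "l = u"
      have lim: "((\<lambda>h. ereal (Q x h)) \<longlongrightarrow> l) ?F"
        by (rule Liminf_eq_Limsup) (auto simp: l_def eq[unfolded l_def u_def, symmetric])
      have ev: "eventually (\<lambda>h. ereal 1 \<le> ereal (Q x h)) ?F" "eventually (\<lambda>h. ereal (Q x h) \<le> ereal (2 * L + 1)) ?F"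
      proof -
        show "eventually (\<lambda>h. ereal 1 \<le> ereal (Q x h)) ?F"
          using Qpos by (auto simp: eventually_at_filter)
        have "Q x h \<le> 2 * L + 1" if "h \<noteq> 0" for h
          using slope(2)[of x "x+h"] slope(2)[of "x+h" x] that
          by (cases "h > 0") (auto simp: Q_def divide_le_eq)
        then show "eventually (\<lambda>h. ereal (Q x h) \<le> ereal (2 * L + 1)) ?F"
          by (auto simp: eventually_at_filter)
      qed
      have "1 \<le> l" using tendsto_lowerbound[OF lim ev(1)] by (simp add: one_ereal_def)
      moreover have "l \<le> ereal (2 * L + 1)" using tendsto_upperbound[OF lim ev(2)] by simp
      ultimately obtain D where "l = ereal D" by (cases l) auto
      then have "(Q x \<longlongrightarrow> D) ?F" using lim by simp
      then have "(g has_real_derivative D) (at x)" unfolding DERIV_def Q_def by simp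
      then have "((\<lambda>y. g y - (L + 1) * y) has_real_derivative (D - (L + 1))) (at x)"
        by (auto intro!: derivative_eq_intros)
      then have "(f has_real_derivative (D - (L + 1))) (at x)" by (simp add: g_def)
      with nd show False by blast
    qed
    with lu have "l < u" by simp
    then obtain q where q: "l < ereal q" "ereal q < u" "q \<in> \<rat>"
      using ereal_dense3 by (metis Rats_of_rat)
    then obtain p where p: "l < ereal p" "ereal p < ereal q" "p \<in> \<rat>"
      using ereal_dense3 by (metis Rats_of_rat)
    obtain M :: nat where M: "\<bar>x\<bar> < real M" using reals_Archimedean2 by blast
    have "x \<in> A p q M"
      unfolding A_def
    proof (intro IntI INT_I)
      show "x \<in> ball 0 (real M)" using M by (simp add: dist_real_def)
      fix j :: nat
      have j: "0 < inverse (real (Suc j))" by simp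
      show "x \<in> (\<Union>h\<in>{h. h \<noteq> 0 \<and> \<bar>h\<bar> < inverse (real (Suc j))}. {x. Q x h < p})"
      proof (rule ccontr)
        assume "\<not> ?thesis"
        then have "eventually (\<lambda>h. ereal p \<le> ereal (Q x h)) ?F"
          unfolding eventually_at using j by (intro exI[of _ "inverse (real (Suc j))"]) (auto simp: not_less)
        then have "ereal p \<le> l" unfolding l_def by (rule Liminf_bounded)
        with p show False by simp
      qed
      show "x \<in> (\<Union>h\<in>{h. h \<noteq> 0 \<and> \<bar>h\<bar> < inverse (real (Suc j))}. {x. q < Q x h})"
      proof (rule ccontr)
        assume "\<not> ?thesis"
        then have "eventually (\<lambda>h. ereal (Q x h) \<le> ereal q) ?F"
          unfolding eventually_at using j by (intro exI[of _ "inverse (real (Suc j))"]) (auto simp: not_less)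
        then have "u \<le> ereal q" unfolding u_def by (rule Limsup_bounded)
        with q show False by simp
      qed
    qed
    with p q show "x \<in> (\<Union>p\<in>\<rat>. \<Union>q\<in>\<rat>. \<Union>M. if p < q then A p q M else {})"
      by (intro UN_I[of p] UN_I[of q] UN_I[of M]) auto
  qed
  ultimately show ?thesis by (rule negligible_subset)
qed

text \<open>Averaging the translates of \<open>B\<close> along \<open>v\<close> replaces slicing of the space by lines.\<close>

lemma negligible_if_line_sections_negligible:
  fixes v :: "'a::euclidean_space"
  assumes B: "B \<in> sets borel" and sec: "\<And>x. negligible {s. x + s *\<^sub>R v \<in> B}"
  shows "negligible B"
proof -
  note [measurable] = B
  have m [measurable]: "(\<lambda>(x, s). indicator {0..1} s * indicator B (x + s *\<^sub>R v) :: ennreal)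
     \<in> borel_measurable (lborel \<Otimes>\<^sub>M lborel)"
    by measurable
  have tr: "(\<integral>\<^sup>+x. indicator B (x + s *\<^sub>R v) \<partial>lborel) = emeasure lborel B" for s
  proof -
    have "(\<integral>\<^sup>+x. indicator B (s *\<^sub>R v + x) \<partial>lborel) = (\<integral>\<^sup>+x. indicator B x \<partial>distr lborel borel ((+) (s *\<^sub>R v)))"
      by (rule nn_integral_distr[symmetric]) auto
    also have "\<dots> = emeasure lborel B" by (simp add: lborel_distr_plus)
    finally show ?thesis by (simp add: add.commute)
  qed
  have "emeasure lborel B = (\<integral>\<^sup>+s. indicator {0..1::real} s * emeasure lborel B \<partial>lborel)"
    by (simp add: nn_integral_multc)
  also have "\<dots> = (\<integral>\<^sup>+s. \<integral>\<^sup>+x. indicator {0..1} s * indicator B (x + s *\<^sub>R v) \<partial>lborel \<partial>lborel)"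
    by (simp add: nn_integral_cmult tr)
  also have "\<dots> = (\<integral>\<^sup>+x. \<integral>\<^sup>+s. indicator {0..1} s * indicator B (x + s *\<^sub>R v) \<partial>lborel \<partial>lborel)"
    using lborel_pair.Fubini'[OF m] by simp
  also have "\<dots> = (\<integral>\<^sup>+(x::'a). 0 \<partial>lborel)"
  proof (rule nn_integral_cong)
    fix x :: 'a
    have mb: "{s. x + s *\<^sub>R v \<in> B} \<in> sets borel" by measurable
    have "emeasure lborel {s. x + s *\<^sub>R v \<in> B} = 0"
      using sec[of x] mb by (subst (asm) negligible_iff_emeasure0) auto
    moreover have "(\<integral>\<^sup>+s. indicator {0..1} s * indicator B (x + s *\<^sub>R v) \<partial>lborel)
        \<le> (\<integral>\<^sup>+s. indicator {s. x + s *\<^sub>R v \<in> B} s \<partial>lborel)"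
      by (rule nn_integral_mono) (auto simp: indicator_def)
    ultimately show "(\<integral>\<^sup>+s. indicator {0..1} s * indicator B (x + s *\<^sub>R v) \<partial>lborel) = 0"
      using mb by simp
  qed
  finally show ?thesis using B by (subst negligible_iff_emeasure0) auto
qed

section \<open>Points of density, directional difference quotients, and the Lipschitz case in
  several variables\<close>

definition thick_at :: "'a::euclidean_space set \<Rightarrow> 'a \<Rightarrow> bool" where
  "thick_at E x \<longleftrightarrow> (\<forall>e>0. \<exists>d>0. \<forall>y. norm (y - x) < d \<longrightarrow> (\<exists>z\<in>E. norm (z - y) \<le> e * norm (y - x)))"

text \<open>A weak form of the density theorem. If \<open>x\<close> is not thick, there are
  arbitrarily small balls around \<open>x\<close> a fixed fraction of whose volume misses
  \<open>E\<close>. Comparison of Lebesgue measure with a large multiple of its restriction to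
  \<open>- E\<close>, which vanishes on subsets of \<open>E\<close>, shows that such points form a
  null set.\<close>

lemma negligible_not_thick_at:
  fixes E :: "'a::euclidean_space set"
  assumes E: "closed E"
  shows "negligible {x \<in> E. \<not> thick_at E x}"
proof -
  define A where "A = (\<lambda>(k::nat) (M::nat). E \<inter> ball 0 (real M) \<inter>
     (\<Inter>j::nat. \<Union>y. {x. norm (y - x) < inverse (real (Suc j))} \<inter> {x. inverse (real (Suc k)) * norm (y - x) < infdist y E}))"
  have Ab: "A k M \<in> sets borel" for k M
    unfolding A_def
  proof (intro sets.Int)
    show "(\<Inter>j::nat. \<Union>y. {x. norm (y - x) < inverse (real (Suc j))} \<inter> {x. inverse (real (Suc k)) * norm (y - x) < infdist y E}) \<in> sets borel"
      by (rule sets.countable_INT'')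
         (simp, simp, intro borel_open open_UN ballI open_Int open_Collect_less continuous_intros)
  qed (use E in auto)
  have Abd: "bounded (A k M)" for k M by (auto simp: A_def bounded_Int)
  have null: "negligible (A k M)" for k M
  proof -
    \<comment> \<open>The ratio of the volumes of the ball of radius \<open>2 |y - x|\<close> about
      \<open>x\<close> and of the hole of radius \<open>|y - x| / (k + 1)\<close> about
      \<open>y\<close>.\<close>
    define c where "c = (2 * real (Suc k)) ^ DIM('a)"
    have c: "c \<ge> 1" unfolding c_def by (rule one_le_power) simp
    let ?\<mu> = "density lborel (\<lambda>x. ennreal c * indicator (- E) x)"
    have [measurable]: "- E \<in> sets borel" "E \<in> sets borel" using E by auto
    have md: "(\<lambda>x. ennreal c * indicator (- E) x) \<in> borel_measurable lborel" by measurable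
    have em: "emeasure ?\<mu> X = ennreal c * emeasure lborel (X - E)" if "X \<in> sets borel" for X
    proof -
      have "emeasure ?\<mu> X = (\<integral>\<^sup>+x. ennreal c * indicator (X - E) x \<partial>lborel)"
        using that by (subst emeasure_density[OF md]) (auto intro!: nn_integral_cong simp: indicator_def)
      then show ?thesis using that E by (simp add: nn_integral_cmult)
    qed
    have "emeasure lborel (A k M) \<le> emeasure ?\<mu> (A k M)"
    proof (rule vitali_measure_comparison[OF _ _ _ _ Ab Abd, of _ _ c])
      show "emeasure lborel X \<le> ennreal c * emeasure lborel X" for X :: "'a set"
        using mult_right_mono[of 1 "ennreal c" "emeasure lborel X"] c by simp
      show "emeasure ?\<mu> X \<le> ennreal c * emeasure lborel X" if "X \<in> sets borel" for X
        using that E by (auto simp: em intro!: mult_left_mono emeasure_mono)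
      fix x and d :: real assume x: "x \<in> A k M" and d: "0 < d"
      obtain j where j: "inverse (real (Suc j)) < d / 2" using reals_Archimedean[of "d/2"] d by auto
      obtain y where y: "norm (y - x) < inverse (real (Suc j))" "inverse (real (Suc k)) * norm (y - x) < infdist y E"
        using x unfolding A_def by blast
      have xE: "x \<in> E" using x by (simp add: A_def)
      have "y \<noteq> x" using y(2) xE by (auto simp: in_closed_iff_infdist_zero)
      define r where "r = 2 * norm (y - x)"
      define s where "s = inverse (real (Suc k)) * norm (y - x)"
      have r: "0 < r" "r < d" "0 < s" "r = 2 * real (Suc k) * s" using \<open>y \<noteq> x\<close> y j by (auto simp: r_def s_def simp del: of_nat_Suc)
      have s1: "s \<le> norm (y - x)"
        using mult_right_mono[of "inverse (real (Suc k))" 1 "norm (y - x)"] by (simp add: s_def field_simps)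
      have sub: "cball y s \<subseteq> cball x r - E"
      proof
        fix z assume z: "z \<in> cball y s"
        have "dist x z \<le> dist x y + dist y z" by (rule dist_triangle)
        then have "z \<in> cball x r" using z s1 by (auto simp: r_def dist_norm norm_minus_commute)
        moreover have "z \<notin> E"
        proof
          assume "z \<in> E"
          then have "infdist y E \<le> dist y z" by (rule infdist_le)
          then show False using z y by (simp add: s_def)
        qed
        ultimately show "z \<in> cball x r - E" by simp
      qed
      have "emeasure lborel (cball x r) = ennreal c * emeasure lborel (cball y s)"
        using r(1,3) c by (simp add: emeasure_cball ennreal_mult[symmetric] r(4) c_def power_mult_distrib mult_ac)
      also have "\<dots> \<le> ennreal c * emeasure lborel (cball x r - E)"
        using sub E by (intro mult_left_mono emeasure_mono) auto
      finally have "emeasure lborel (cball x r) \<le> emeasure ?\<mu> (cball x r)" by (simp add: em)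
      with r show "\<exists>a r. 0 < r \<and> r < d \<and> x \<in> cball a r \<and> emeasure lborel (cball a r) \<le> emeasure ?\<mu> (cball a r)"
        by (intro exI[of _ x] exI[of _ r]) auto
    qed auto
    also have "\<dots> = 0" using Ab by (subst em) (auto simp: A_def Diff_eq)
    finally show ?thesis using Ab by (subst negligible_iff_emeasure0) auto
  qed
  have "negligible (\<Union>k. \<Union>M. A k M)"
    by (intro negligible_countable_UN) (auto intro: null)
  moreover have "{x \<in> E. \<not> thick_at E x} \<subseteq> (\<Union>k. \<Union>M. A k M)"
  proof
    fix x assume "x \<in> {x \<in> E. \<not> thick_at E x}"
    then obtain e where xE: "x \<in> E" and e: "e > 0"
      and bad: "\<And>d. d > 0 \<Longrightarrow> \<exists>y. norm (y - x) < d \<and> (\<forall>z\<in>E. norm (z - y) > e * norm (y - x))"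
      unfolding thick_at_def by (auto simp: not_le)
    obtain k where k: "inverse (real (Suc k)) < e" using reals_Archimedean[OF e] by blast
    obtain M :: nat where M: "norm x < real M" using reals_Archimedean2 by blast
    have "x \<in> A k M" unfolding A_def
    proof (intro IntI INT_I)
      fix j :: nat
      obtain y where y: "norm (y - x) < inverse (real (Suc j))" "\<forall>z\<in>E. norm (z - y) > e * norm (y - x)"
        using bad[of "inverse (real (Suc j))"] by auto
      have "norm (y - x) > 0" using y(2) xE e by (cases "y = x") auto
      then have "inverse (real (Suc k)) * norm (y - x) < e * norm (y - x)" using k by simp
      also have "\<dots> \<le> infdist y E"
      proof -
        have ne: "E \<noteq> {}" using xE by blast
        show ?thesis unfolding infdist_notempty[OF ne]
          by (rule cINF_greatest[OF ne]) (use y(2) in \<open>simp add: dist_norm norm_minus_commute less_imp_le\<close>)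
      qed
      finally show "x \<in> (\<Union>y. {x. norm (y - x) < inverse (real (Suc j))} \<inter> {x. inverse (real (Suc k)) * norm (y - x) < infdist y E})"
        using y by blast
    qed (use xE M in auto)
    then show "x \<in> (\<Union>k. \<Union>M. A k M)" by blast
  qed
  ultimately show ?thesis by (rule negligible_subset)
qed


text \<open>The directional derivative along \<open>v\<close> is \<open>c\<close> up to
  \<open>1 / (m + 1)\<close>, uniformly for increments below \<open>1 / (j + 1)\<close>. Fixing the
  scale makes the set closed, so \<open>negligible_not_thick_at\<close> applies to it; with rational
  \<open>c\<close> there are countably many such sets for each \<open>v\<close>.\<close>

definition difquot_set :: "('a::euclidean_space \<Rightarrow> real) \<Rightarrow> 'a \<Rightarrow> real \<Rightarrow> nat \<Rightarrow> nat \<Rightarrow> 'a set" where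
  "difquot_set f v c m j = {x. \<forall>t. \<bar>t\<bar> < inverse (real (Suc j)) \<longrightarrow>
     \<bar>f (x + t *\<^sub>R v) - f x - t * c\<bar> \<le> inverse (real (Suc m)) * \<bar>t\<bar>}"

lemma closed_difquot_set:
  assumes cf: "continuous_on UNIV f"
  shows "closed (difquot_set f v c m j)"
proof -
  have "difquot_set f v c m j = (\<Inter>t\<in>{t. \<bar>t\<bar> < inverse (real (Suc j))}.
     {x. \<bar>f (x + t *\<^sub>R v) - f x - t * c\<bar> \<le> inverse (real (Suc m)) * \<bar>t\<bar>})"
    by (auto simp: difquot_set_def)
  also have "closed \<dots>"
    by (intro closed_INT ballI closed_Collect_le continuous_intros continuous_on_compose2[OF cf]) auto
  finally show ?thesis .
qed

lemma difquot_setI: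
  assumes D: "((\<lambda>t. f (x + t *\<^sub>R v)) has_real_derivative D) (at 0)"
  shows "\<exists>c\<in>\<rat>. \<exists>j. x \<in> difquot_set f v c m j"
proof -
  define e where "e = inverse (real (Suc m)) / 2"
  have e: "e > 0" by (simp add: e_def)
  obtain c where c: "c \<in> \<rat>" "D - e < c" "c < D"
    using Rats_dense_in_real[of "D - e" D] e by auto
  obtain d where d: "d > 0" "\<And>t. norm t < d \<Longrightarrow> norm (f (x + t *\<^sub>R v) - f x - D * t) \<le> e * norm t"
    using D e unfolding has_field_derivative_def has_derivative_at_alt
    by (auto simp: mult.commute)
  obtain j where j: "inverse (real (Suc j)) < d" using reals_Archimedean[OF d(1)] by blast
  have "x \<in> difquot_set f v c m j"
    unfolding difquot_set_def
  proof (intro CollectI allI impI)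
    fix t :: real assume t: "\<bar>t\<bar> < inverse (real (Suc j))"
    have "\<bar>f (x + t *\<^sub>R v) - f x - t * c\<bar> \<le> \<bar>f (x + t *\<^sub>R v) - f x - D * t\<bar> + \<bar>t * (D - c)\<bar>"
      by (auto simp: algebra_simps)
    also have "\<bar>t * (D - c)\<bar> \<le> e * \<bar>t\<bar>" using c by (simp add: abs_mult) (metis abs_ge_zero diff_le_eq add.commute less_imp_le mult.commute mult_left_mono less_diff_eq)
    also have "\<bar>f (x + t *\<^sub>R v) - f x - D * t\<bar> \<le> e * \<bar>t\<bar>" using d(2)[of t] t j by simp
    finally show "\<bar>f (x + t *\<^sub>R v) - f x - t * c\<bar> \<le> inverse (real (Suc m)) * \<bar>t\<bar>"
      by (simp add: e_def algebra_simps)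
  qed
  with c show ?thesis by blast
qed

text \<open>Two slopes admissible at the same point differ by at most the sum of their tolerances,
  as one common increment \<open>t\<close> shows. Slopes with tolerances tending to 0 are thus
  Cauchy, and \<open>D\<close> is their limit.\<close>

lemma difquot_set_limit:
  assumes "\<And>m. \<exists>c\<in>\<rat>. \<exists>j. x \<in> difquot_set f v c m j"
  shows "\<exists>D. \<forall>c m j. x \<in> difquot_set f v c m j \<longrightarrow> \<bar>c - D\<bar> \<le> inverse (real (Suc m))"
proof -
  have two: "\<bar>c - c'\<bar> \<le> inverse (real (Suc m)) + inverse (real (Suc m'))"
    if "x \<in> difquot_set f v c m j" "x \<in> difquot_set f v c' m' j'" for c c' m m' j j'
  proof -
    define t where "t = min (inverse (real (Suc j))) (inverse (real (Suc j'))) / 2"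
    have t: "t > 0" "\<bar>t\<bar> < inverse (real (Suc j))" "\<bar>t\<bar> < inverse (real (Suc j'))"
    proof -
      have "inverse (real (Suc j)) > 0" "inverse (real (Suc j')) > 0" by simp_all
      then show "t > 0" "\<bar>t\<bar> < inverse (real (Suc j))" "\<bar>t\<bar> < inverse (real (Suc j'))"
        unfolding t_def by linarith+
    qed
    have "\<bar>f (x + t *\<^sub>R v) - f x - t * c\<bar> \<le> inverse (real (Suc m)) * \<bar>t\<bar>"
      "\<bar>f (x + t *\<^sub>R v) - f x - t * c'\<bar> \<le> inverse (real (Suc m')) * \<bar>t\<bar>"
      using that t(2,3) unfolding difquot_set_def by blast+
    then have "\<bar>t * c - t * c'\<bar> \<le> inverse (real (Suc m)) * \<bar>t\<bar> + inverse (real (Suc m')) * \<bar>t\<bar>" by linarith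
    then have "\<bar>t\<bar> * \<bar>c - c'\<bar> \<le> \<bar>t\<bar> * (inverse (real (Suc m)) + inverse (real (Suc m')))"
      by (simp only: abs_mult[symmetric] right_diff_distrib distrib_left mult.commute)
    then show ?thesis using t(1) by simp
  qed
  obtain c j where cj: "\<And>m. x \<in> difquot_set f v (c m) m (j m)" using assms by metis
  have "Cauchy c"
  proof (rule metric_CauchyI)
    fix e :: real assume "e > 0"
    then obtain M where M: "inverse (real (Suc M)) < e / 2" using reals_Archimedean[of "e/2"] by auto
    show "\<exists>M. \<forall>m\<ge>M. \<forall>n\<ge>M. dist (c m) (c n) < e"
    proof (intro exI allI impI)
      fix m n assume "M \<le> m" "M \<le> n"
      then have "inverse (real (Suc m)) \<le> inverse (real (Suc M))" "inverse (real (Suc n)) \<le> inverse (real (Suc M))"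
        by (auto intro!: le_imp_inverse_le)
      then show "dist (c m) (c n) < e" using two[OF cj[of m] cj[of n]] M unfolding dist_real_def by linarith
    qed
  qed
  then obtain D where D: "c \<longlonglongrightarrow> D" using Cauchy_convergent_iff convergent_def by blast
  show ?thesis
  proof (intro exI allI impI)
    fix a m i assume a: "x \<in> difquot_set f v a m i"
    have 1: "(\<lambda>n. \<bar>a - c n\<bar>) \<longlonglongrightarrow> \<bar>a - D\<bar>" by (intro tendsto_intros D)
    have 2: "(\<lambda>n. inverse (real (Suc m)) + inverse (real (Suc n))) \<longlonglongrightarrow> inverse (real (Suc m)) + 0"
      by (intro tendsto_intros LIMSEQ_inverse_real_of_nat)
    have "\<bar>a - D\<bar> \<le> inverse (real (Suc m)) + 0"
      by (rule LIMSEQ_le[OF 1 2]) (use two[OF a cj] in blast)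
    then show "\<bar>a - D\<bar> \<le> inverse (real (Suc m))" by simp
  qed
qed

text \<open>Only coordinate directions are used: the way from \<open>x\<close> to \<open>y\<close>
  is made one coordinate at a time. Nothing is known about difference quotients at the intermediate
  points \<open>z\<close>, but as \<open>x\<close> is a thick point of the relevant
  \<open>difquot_set\<close>, a point \<open>w\<close> of that set lies close to \<open>z\<close>
  compared with \<open>|y - x|\<close>, and the Lipschitz bound transfers the quotient of
  \<open>w\<close> to \<open>z\<close>.\<close>

theorem Rademacher_real:
  fixes f :: "'a::euclidean_space \<Rightarrow> real"
  assumes lip: "L-lipschitz_on UNIV f"
  shows "negligible {x. \<not> f differentiable (at x)}"
proof -
  have L: "L \<ge> 0" using lip by (rule lipschitz_on_nonneg)
  have lip': "\<bar>f x - f y\<bar> \<le> L * norm (x - y)" for x y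
    using lip by (auto simp: lipschitz_on_def dist_norm)
  have cf: "continuous_on UNIV f" using lip by (rule lipschitz_on_continuous_on)
  let ?E = "difquot_set f"
  define B where "B = (\<lambda>b. UNIV - (\<Inter>m. \<Union>c\<in>\<rat>. \<Union>j. ?E b c m j))"
  have nB: "negligible (B b)" for b
  proof (rule negligible_if_line_sections_negligible[where v = b])
    have E: "?E b c m j \<in> sets borel" for c m j by (intro borel_closed closed_difquot_set cf)
    have "(\<Inter>m. \<Union>c\<in>\<rat>. \<Union>j. ?E b c m j) \<in> sets borel"
      by (intro sets.countable_INT'' sets.countable_UN'' countable_rat E) auto
    then show "B b \<in> sets borel" unfolding B_def by (intro sets.Diff) auto
    fix x
    have "negligible {s. \<not> (\<exists>D. ((\<lambda>s. f (x + s *\<^sub>R b)) has_real_derivative D) (at s))}"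
    proof (rule lipschitz_derivative_ae_real)
      fix s t :: real
      show "\<bar>f (x + s *\<^sub>R b) - f (x + t *\<^sub>R b)\<bar> \<le> L * norm b * \<bar>s - t\<bar>"
        using lip'[of "x + s *\<^sub>R b" "x + t *\<^sub>R b"]
        by (simp add: scaleR_diff_left[symmetric] mult_ac)
    qed
    moreover have "{s. x + s *\<^sub>R b \<in> B b} \<subseteq> {s. \<not> (\<exists>D. ((\<lambda>s. f (x + s *\<^sub>R b)) has_real_derivative D) (at s))}"
    proof clarify
      fix s D assume s: "x + s *\<^sub>R b \<in> B b" and D: "((\<lambda>s. f (x + s *\<^sub>R b)) has_real_derivative D) (at s)"
      have "((\<lambda>t. f (x + (t + s) *\<^sub>R b)) has_real_derivative D) (at 0)"
        using DERIV_shift[of "\<lambda>s. f (x + s *\<^sub>R b)" D 0 s] D by simp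
      then have "((\<lambda>t. f ((x + s *\<^sub>R b) + t *\<^sub>R b)) has_real_derivative D) (at 0)"
        by (simp add: algebra_simps)
      from difquot_setI[OF this] s show False by (auto simp: B_def)
    qed
    ultimately show "negligible {s. x + s *\<^sub>R b \<in> B b}" by (rule negligible_subset)
  qed
  \<comment> \<open>The exceptional set: some coordinate derivative is missing, or the point belongs
    to one of the countably many difference quotient sets without being thick in it.\<close>
  define N where "N = (\<Union>b\<in>Basis. B b) \<union> (\<Union>b\<in>Basis. \<Union>c\<in>\<rat>. \<Union>m. \<Union>j. {x \<in> ?E b c m j. \<not> thick_at (?E b c m j) x})"
  have "countable (Basis :: 'a set)" by (simp add: countable_finite)
  then have "negligible N" unfolding N_def
    by (intro negligible_Un negligible_countable_UN countable_rat nB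
        negligible_not_thick_at closed_difquot_set cf) auto
  moreover have "{x. \<not> f differentiable (at x)} \<subseteq> N"
  proof (rule subsetI, rule ccontr)
    fix x assume "x \<in> {x. \<not> f differentiable (at x)}" and xN: "x \<notin> N"
    then have nd: "\<not> f differentiable (at x)" by simp
    have ex: "\<exists>c\<in>\<rat>. \<exists>j. x \<in> ?E b c m j" if "b \<in> Basis" for b m using xN that by (auto simp: N_def B_def)
    have th: "thick_at (?E b c m j) x" if "b \<in> Basis" "c \<in> \<rat>" "x \<in> ?E b c m j" for b c m j
    proof (rule ccontr)
      assume "\<not> ?thesis"
      then have "x \<in> (\<Union>j. {x \<in> ?E b c m j. \<not> thick_at (?E b c m j) x})" using that by blast
      then have "x \<in> (\<Union>m. \<Union>j. {x \<in> ?E b c m j. \<not> thick_at (?E b c m j) x})" by (rule UN_I[OF UNIV_I])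
      then have "x \<in> (\<Union>c\<in>\<rat>. \<Union>m. \<Union>j. {x \<in> ?E b c m j. \<not> thick_at (?E b c m j) x})" by (rule UN_I[OF that(2)])
      then have "x \<in> N" unfolding N_def by (rule UnI2[OF UN_I[OF that(1)]])
      with xN show False by simp
    qed
    have "\<forall>b\<in>Basis. \<exists>D. \<forall>c m j. x \<in> ?E b c m j \<longrightarrow> \<bar>c - D\<bar> \<le> inverse (real (Suc m))"
      by (intro ballI difquot_set_limit ex)
    from bchoice[OF this] obtain D where
      D': "\<forall>b\<in>Basis. \<forall>c m j. x \<in> ?E b c m j \<longrightarrow> \<bar>c - D b\<bar> \<le> inverse (real (Suc m))" ..
    have D: "\<bar>c - D b\<bar> \<le> inverse (real (Suc m))" if "b \<in> Basis" "x \<in> ?E b c m j" for b c m j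
      using D' that by blast
    define n where "n = real (DIM('a))"
    have n: "n > 0" by (simp add: n_def)
    have "(f has_derivative (\<lambda>h. \<Sum>b\<in>Basis. (h \<bullet> b) * D b)) (at x)"
      unfolding has_derivative_at_alt
    proof (intro conjI allI impI)
      show "bounded_linear (\<lambda>h. \<Sum>b\<in>Basis. (h \<bullet> b) * D b)"
        by (intro bounded_linear_sum bounded_linear_mult_left[THEN bounded_linear_compose, OF bounded_linear_inner_left])
      fix e :: real assume e: "e > 0"
      \<comment> \<open>Each coordinate produces four errors of size \<open>e1 |h|\<close>: two from
        passing between \<open>z\<close> and \<open>w\<close>, one from the quotient at
        \<open>w\<close>, one from replacing \<open>c b\<close> by \<open>D b\<close>. Over
        \<open>n\<close> coordinates they add up to \<open>e |h|\<close>. In \<open>e2\<close> the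
        extra factor \<open>n (L + 1)\<close> accounts for \<open>|z - x| \<le> n |h|\<close> and
        for the Lipschitz constant.\<close>
      define e1 where "e1 = e / (4 * n)"
      define e2 where "e2 = e / (4 * n * n * (L + 1))"
      have e1: "e1 > 0" using e n by (simp add: e1_def)
      have e2: "e2 > 0" using e n L by (simp add: e2_def)
      obtain m where m: "inverse (real (Suc m)) < e1" using reals_Archimedean[OF e1] by blast
      have "\<exists>c j d. d > 0 \<and> x \<in> ?E b c m j \<and> (\<forall>y. norm (y - x) < d \<longrightarrow> (\<exists>z\<in>?E b c m j. norm (z - y) \<le> e2 * norm (y - x)))"
        if b: "b \<in> Basis" for b
      proof -
        obtain c j where cj: "c \<in> \<rat>" "x \<in> ?E b c m j" using ex[OF b, of m] by blast
        obtain d where "d > 0" "\<forall>y. norm (y - x) < d \<longrightarrow> (\<exists>z\<in>?E b c m j. norm (z - y) \<le> e2 * norm (y - x))"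
          using th[OF b cj] e2 unfolding thick_at_def by blast
        with cj show ?thesis by blast
      qed
      then have "\<forall>b\<in>Basis. \<exists>p. snd (snd p) > 0 \<and> x \<in> ?E b (fst p) m (fst (snd p)) \<and>
          (\<forall>y. norm (y - x) < snd (snd p) \<longrightarrow> (\<exists>z\<in>?E b (fst p) m (fst (snd p)). norm (z - y) \<le> e2 * norm (y - x)))"
        by simp
      from bchoice[OF this] obtain p where p: "\<forall>b\<in>Basis. snd (snd (p b)) > 0 \<and> x \<in> ?E b (fst (p b)) m (fst (snd (p b))) \<and>
          (\<forall>y. norm (y - x) < snd (snd (p b)) \<longrightarrow> (\<exists>z\<in>?E b (fst (p b)) m (fst (snd (p b))). norm (z - y) \<le> e2 * norm (y - x)))" ..
      define c where "c = (\<lambda>b. fst (p b))"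
      define j where "j = (\<lambda>b. fst (snd (p b)))"
      define d where "d = (\<lambda>b. snd (snd (p b)))"
      have d: "d b > 0" "x \<in> ?E b (c b) m (j b)"
        "\<And>y. norm (y - x) < d b \<Longrightarrow> \<exists>z\<in>?E b (c b) m (j b). norm (z - y) \<le> e2 * norm (y - x)" if "b \<in> Basis" for b
        using p[rule_format, OF that] unfolding c_def j_def d_def by blast+
      define d0 where "d0 = Min ((\<lambda>b. min (d b / n) (inverse (real (Suc (j b))))) ` (Basis :: 'a set))"
      have d0: "d0 > 0" unfolding d0_def
        by (subst Min_gr_iff) (use d n in auto)
      have d0b: "d0 \<le> d b / n" "d0 \<le> inverse (real (Suc (j b)))" if "b \<in> Basis" for b
      proof -
        have "d0 \<le> min (d b / n) (inverse (real (Suc (j b))))"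
          unfolding d0_def by (rule Min_le) (use that in auto)
        then show "d0 \<le> d b / n" "d0 \<le> inverse (real (Suc (j b)))" by auto
      qed
      show "\<exists>d>0. \<forall>y. norm (y - x) < d \<longrightarrow>
          norm (f y - f x - (\<Sum>b\<in>Basis. ((y - x) \<bullet> b) * D b)) \<le> e * norm (y - x)"
      proof (intro exI[of _ d0] conjI allI impI d0)
        fix y assume y: "norm (y - x) < d0"
        define h where "h = y - x"
        have hb: "\<bar>h \<bullet> b\<bar> \<le> norm h" if "b \<in> Basis" for b using that by (rule Basis_le_norm)
        have main: "\<bar>f (x + (\<Sum>b\<in>S. (h \<bullet> b) *\<^sub>R b)) - f x - (\<Sum>b\<in>S. (h \<bullet> b) * D b)\<bar> \<le> real (card S) * (e / n * norm h)"
          if "S \<subseteq> Basis" for S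
        proof -
          have "finite S" using that finite_Basis by (rule finite_subset)
          then show ?thesis using that
          proof (induction S rule: finite_induct)
            case (insert b S)
            then have b: "b \<in> Basis" and SB: "S \<subseteq> Basis" by auto
            define z where "z = x + (\<Sum>b\<in>S. (h \<bullet> b) *\<^sub>R b)"
            define t where "t = h \<bullet> b"
            have "norm (\<Sum>b\<in>S. (h \<bullet> b) *\<^sub>R b) \<le> (\<Sum>b\<in>S. norm h)"
              by (rule order_trans[OF norm_sum], rule sum_mono) (use SB hb in auto)
            also have "\<dots> \<le> n * norm h"
              using card_mono[OF finite_Basis SB] by (auto simp: n_def intro!: mult_right_mono)
            finally have zx: "norm (z - x) \<le> n * norm h" by (simp add: z_def)
            also have "\<dots> < n * d0" using y n by (simp add: h_def)
            also have "\<dots> \<le> d b" using d0b(1)[OF b] n by (simp add: field_simps)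
            finally obtain w where w: "w \<in> ?E b (c b) m (j b)" "norm (w - z) \<le> e2 * norm (z - x)"
              using d(3)[OF b, of z] by blast
            have tj: "\<bar>t\<bar> < inverse (real (Suc (j b)))" using hb[OF b] y d0b(2)[OF b] by (simp add: t_def h_def)
            have 1: "\<bar>f (w + t *\<^sub>R b) - f w - t * c b\<bar> \<le> inverse (real (Suc m)) * \<bar>t\<bar>"
              using w(1) tj by (auto simp: difquot_set_def)
            have th: "\<bar>t\<bar> \<le> norm h" using hb[OF b] by (simp add: t_def)
            have 2: "inverse (real (Suc m)) * \<bar>t\<bar> \<le> e1 * norm h"
              using m th e1 by (intro mult_mono) auto
            have Lw: "L * norm (w - z) \<le> e1 * norm h"
            proof -
              have "L * norm (w - z) \<le> (L + 1) * (e2 * (n * norm h))"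
                using w(2) zx L e2 by (intro mult_mono) (auto intro: order_trans[OF _ mult_left_mono])
              also have "\<dots> = e1 * norm h"
              proof -
                have "K * (e / (4 * n * n * K) * (n * norm h)) = e / (4 * n) * norm h" if "K > 0" for K
                  using that n by (simp add: field_simps)
                from this[of "L + 1"] show ?thesis using L by (simp add: e1_def e2_def)
              qed
              finally show ?thesis .
            qed
            have 3: "\<bar>f (z + t *\<^sub>R b) - f (w + t *\<^sub>R b)\<bar> \<le> e1 * norm h"
              using lip'[of "z + t *\<^sub>R b" "w + t *\<^sub>R b"] Lw by (simp add: norm_minus_commute)
            have 4: "\<bar>f z - f w\<bar> \<le> e1 * norm h"
              using lip'[of z w] Lw by (simp add: norm_minus_commute)
            have 5: "\<bar>t * c b - t * D b\<bar> \<le> e1 * norm h"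
            proof -
              have "\<bar>t * c b - t * D b\<bar> = \<bar>t\<bar> * \<bar>c b - D b\<bar>" by (simp add: abs_mult[symmetric] right_diff_distrib)
              also have "\<dots> \<le> norm h * e1" using th D[OF b d(2)[OF b]] m e1 by (intro mult_mono) auto
              finally show ?thesis by (simp add: mult.commute)
            qed
            have 6: "4 * (e1 * norm h) = e / n * norm h" using n by (simp add: e1_def field_simps)
            have IH: "\<bar>f z - f x - (\<Sum>b\<in>S. (h \<bullet> b) * D b)\<bar> \<le> real (card S) * (e / n * norm h)"
              using insert.IH[OF SB] by (simp add: z_def)
            have zz: "x + (\<Sum>b\<in>insert b S. (h \<bullet> b) *\<^sub>R b) = z + t *\<^sub>R b"
              using insert.hyps by (simp add: z_def t_def)
            have "(\<Sum>b\<in>insert b S. (h \<bullet> b) * D b) = t * D b + (\<Sum>b\<in>S. (h \<bullet> b) * D b)"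
              using insert.hyps by (simp add: t_def)
            moreover have "real (card (insert b S)) * (e / n * norm h) = real (card S) * (e / n * norm h) + 4 * (e1 * norm h)"
              unfolding 6 using insert.hyps by (simp add: ring_distribs add_divide_distrib)
            ultimately show ?case unfolding zz using 1 2 3 4 5 IH by linarith
          qed simp
        qed
        have "x + (\<Sum>b\<in>Basis. (h \<bullet> b) *\<^sub>R b) = y" by (simp add: euclidean_representation h_def)
        moreover have "real (card (Basis::'a set)) * (e / n * norm h) = e * norm h" using n by (simp add: n_def)
        ultimately show "norm (f y - f x - (\<Sum>b\<in>Basis. ((y - x) \<bullet> b) * D b)) \<le> e * norm (y - x)"
          using main[OF subset_refl] by (simp add: h_def)
      qed
    qed
    then show False using nd by (auto simp: differentiable_def)
  qed
  ultimately show ?thesis by (rule negligible_subset)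
qed

theorem Rademacher:
  fixes f :: "'a::euclidean_space \<Rightarrow> 'b::euclidean_space"
  assumes lip: "L-lipschitz_on UNIV f"
  shows "negligible {x. \<not> f differentiable (at x)}"
proof -
  have "negligible (\<Union>b\<in>Basis. {x. \<not> (\<lambda>x. f x \<bullet> b) differentiable (at x)})"
  proof (intro negligible_countable_UN countable_finite finite_Basis Rademacher_real)
    fix b :: 'b assume b: "b \<in> Basis"
    show "L-lipschitz_on UNIV (\<lambda>x. f x \<bullet> b)"
    proof (rule lipschitz_onI)
      fix x y
      have "\<bar>(f x - f y) \<bullet> b\<bar> \<le> norm (f x - f y)" using b by (rule Basis_le_norm)
      also have "\<dots> \<le> L * dist x y" using lip by (auto simp: lipschitz_on_def dist_norm)
      finally show "dist (f x \<bullet> b) (f y \<bullet> b) \<le> L * dist x y" by (simp add: dist_real_def inner_diff_left)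
    qed (rule lipschitz_on_nonneg[OF lip])
  qed
  then show ?thesis
    by (rule negligible_subset) (auto simp: differentiable_componentwise_within[of f])
qed

section \<open>Second-order expansions of convex functions\<close>

definition subgrad :: "('a::real_inner \<Rightarrow> real) \<Rightarrow> 'a \<Rightarrow> 'a \<Rightarrow> bool" where
  "subgrad h x p \<longleftrightarrow> (\<forall>w. h x + p \<bullet> (w - x) \<le> h w)"

lemma subgrad_monotone:
  assumes "subgrad h x p" "subgrad h x' p'"
  shows "0 \<le> (p - p') \<bullet> (x - x')"
  using assms[unfolded subgrad_def, THEN spec, of x'] assms[unfolded subgrad_def, THEN spec, of x]
  by (simp add: inner_diff_left inner_diff_right)

lemma convex_on_if_subgrad:
  fixes h :: "'a::real_inner \<Rightarrow> real"
  assumes "\<And>x. \<exists>p. subgrad h x p"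
  shows "convex_on UNIV h"
proof (rule convex_onI)
  fix t :: real and x y :: 'a assume t: "0 < t" "t < 1"
  define z where "z = (1 - t) *\<^sub>R x + t *\<^sub>R y"
  obtain p where p: "subgrad h z p" using assms by blast
  have xz: "x - z = t *\<^sub>R (x - y)" and yz: "y - z = - (1 - t) *\<^sub>R (x - y)"
    by (simp_all add: z_def algebra_simps)
  have "h z + t * (p \<bullet> (x - y)) \<le> h x" "h z - (1 - t) * (p \<bullet> (x - y)) \<le> h y"
    using p[unfolded subgrad_def, THEN spec, of x] p[unfolded subgrad_def, THEN spec, of y]
    by (simp_all add: xz yz algebra_simps)
  then have "(1 - t) * (h z + t * (p \<bullet> (x - y))) + t * (h z - (1 - t) * (p \<bullet> (x - y))) \<le> (1 - t) * h x + t * h y"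
    using t by (intro add_mono mult_left_mono) auto
  then show "h ((1 - t) *\<^sub>R x + t *\<^sub>R y) \<le> (1 - t) * h x + t * h y"
    unfolding z_def[symmetric] by (simp add: algebra_simps)
qed auto

lemma le_if_le_add_small_mult:
  fixes a b c :: real
  assumes "\<And>t. 0 < t \<Longrightarrow> t \<le> 1 \<Longrightarrow> a \<le> b + t * c"
  shows "a \<le> b"
proof (rule field_le_epsilon)
  fix e :: real assume e: "e > 0"
  define t where "t = min 1 (e / (\<bar>c\<bar> + 1))"
  have t: "0 < t" "t \<le> 1" using e by (auto simp: t_def)
  have "t * c \<le> t * (\<bar>c\<bar> + 1)" using t by (intro mult_left_mono) auto
  also have "\<dots> \<le> e / (\<bar>c\<bar> + 1) * (\<bar>c\<bar> + 1)" by (intro mult_right_mono) (auto simp: t_def)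
  also have "\<dots> = e" by simp
  finally show "a \<le> b + e" using assms[OF t] by linarith
qed

text \<open>\<open>x\<close> is a minimiser of \<open>h\<close> plus half the squared distance to
  \<open>y\<close>. By the supporting plane at 0 this sum is at least its value at 0 outside a ball,
  so the minimum is attained; comparing \<open>x\<close> with points of the segment towards
  \<open>w\<close> gives the subgradient inequality.\<close>

lemma resolvent_exists:
  fixes h :: "'a::euclidean_space \<Rightarrow> real"
  assumes sg: "\<And>x. \<exists>p. subgrad h x p"
  shows "\<exists>x. subgrad h x (y - x)"
proof -
  have cvx: "convex_on UNIV h" using sg by (rule convex_on_if_subgrad)
  have ch: "continuous_on UNIV h" by (rule convex_on_continuous[OF open_UNIV cvx])
  define m where "m = (\<lambda>x. h x + (norm (x - y))\<^sup>2 / 2)"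
  have cm: "continuous_on UNIV m" unfolding m_def by (intro continuous_intros ch) auto
  obtain p where p: "subgrad h 0 p" using sg by blast
  define R where "R = 2 * norm (p - y)"
  have "R \<ge> 0" by (simp add: R_def)
  obtain x where x: "x \<in> cball 0 R" "\<And>w. w \<in> cball 0 R \<Longrightarrow> m x \<le> m w"
    using continuous_attains_inf[of "cball 0 R" m] continuous_on_subset[OF cm] \<open>R \<ge> 0\<close> by (metis compact_cball centre_in_cball empty_iff subset_UNIV)
  have mx: "m x \<le> m w" for w
  proof (cases "w \<in> cball 0 R")
    case False
    then have w: "norm w > R" by simp
    have "- (norm (p - y) * norm w) \<le> (p - y) \<bullet> w" using Cauchy_Schwarz_ineq2[of "p - y" w] by linarith
    moreover have "norm (p - y) * norm w \<le> (norm w)\<^sup>2 / 2"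
      using mult_right_mono[of "2 * norm (p - y)" "norm w" "norm w"] w by (simp add: R_def power2_eq_square)
    ultimately have "0 \<le> (p - y) \<bullet> w + (norm w)\<^sup>2 / 2" by linarith
    moreover have "h 0 + p \<bullet> w \<le> h w" using p[unfolded subgrad_def, THEN spec, of w] by simp
    moreover have "(norm (w - y))\<^sup>2 = (norm w)\<^sup>2 - 2 * (y \<bullet> w) + (norm y)\<^sup>2"
      by (simp add: power2_norm_eq_inner inner_diff_left inner_diff_right inner_commute)
    ultimately have "m 0 \<le> m w" by (simp add: m_def inner_diff_left field_simps)
    moreover have "m x \<le> m 0" using x(2)[of 0] \<open>R \<ge> 0\<close> by simp
    ultimately show ?thesis by simp
  qed (use x in auto)
  have "subgrad h x (y - x)"
    unfolding subgrad_def
  proof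
    fix w
    show "h x + (y - x) \<bullet> (w - x) \<le> h w"
    proof (rule le_if_le_add_small_mult)
      fix t :: real assume t: "0 < t" "t \<le> 1"
      have "m x \<le> m ((1 - t) *\<^sub>R x + t *\<^sub>R w)" by (rule mx)
      also have "\<dots> \<le> (1 - t) * h x + t * h w + (norm ((1 - t) *\<^sub>R x + t *\<^sub>R w - y))\<^sup>2 / 2"
        unfolding m_def using convex_onD[OF cvx, of t x w] t by simp
      also have "(1 - t) *\<^sub>R x + t *\<^sub>R w - y = (x - y) + t *\<^sub>R (w - x)" by (simp add: algebra_simps)
      also have "(norm ((x - y) + t *\<^sub>R (w - x)))\<^sup>2 = (norm (x - y))\<^sup>2 + 2 * t * ((x - y) \<bullet> (w - x)) + t\<^sup>2 * (norm (w - x))\<^sup>2"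
        by (simp only: power2_norm_eq_inner inner_add_left inner_add_right inner_scaleR_left inner_scaleR_right inner_commute[of "w - x" "x - y"])
           (simp add: power2_eq_square algebra_simps)
      finally have *: "m x \<le> (1 - t) * h x + t * h w + ((norm (x - y))\<^sup>2 + 2 * t * ((x - y) \<bullet> (w - x)) + t\<^sup>2 * (norm (w - x))\<^sup>2) / 2" .
      have yx: "(y - x) \<bullet> (w - x) = - ((x - y) \<bullet> (w - x))" by (simp add: inner_diff_left)
      have "t * (h x + (y - x) \<bullet> (w - x)) \<le> t * (h w + t * ((norm (w - x))\<^sup>2 / 2))"
        using * unfolding yx m_def by (simp add: power2_eq_square field_simps)
      then show "h x + (y - x) \<bullet> (w - x) \<le> h w + t * ((norm (w - x))\<^sup>2 / 2)" using t by simp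
    qed
  qed
  then show ?thesis by blast
qed

text \<open>Minty's map, the inverse of the identity plus the subdifferential. By
  \<open>subgrad_nonexpansive\<close> the chosen point is unique.\<close>

definition resolvent :: "('a::euclidean_space \<Rightarrow> real) \<Rightarrow> 'a \<Rightarrow> 'a" where
  "resolvent h y = (SOME x. subgrad h x (y - x))"

lemma subgrad_nonexpansive:
  assumes "subgrad h x (y - x)" "subgrad h x' (y' - x')"
  shows "norm (x - x') \<le> norm (y - y')"
proof -
  have "(norm (x - x'))\<^sup>2 \<le> (y - y') \<bullet> (x - x')"
    using subgrad_monotone[OF assms] by (simp add: power2_norm_eq_inner inner_diff_left inner_diff_right inner_commute)
  also have "\<dots> \<le> norm (y - y') * norm (x - x')" by (rule norm_cauchy_schwarz)
  finally show ?thesis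
    by (cases "x = x'") (auto simp: power2_eq_square)
qed

context
  fixes h :: "'a::euclidean_space \<Rightarrow> real"
  assumes sg: "\<And>x. \<exists>p. subgrad h x p"
begin

lemma subgrad_resolvent: "subgrad h (resolvent h y) (y - resolvent h y)"
  unfolding resolvent_def by (rule someI_ex[OF resolvent_exists[OF sg]])

lemma resolvent_add_subgrad:
  assumes "subgrad h x p" shows "resolvent h (x + p) = x"
proof -
  have "subgrad h x ((x + p) - x)" using assms by simp
  from subgrad_nonexpansive[OF subgrad_resolvent[of "x + p"] this] show ?thesis by simp
qed

lemma lipschitz_resolvent: "1-lipschitz_on UNIV (resolvent h)"
  by (rule lipschitz_onI) (auto simp: dist_norm intro: subgrad_nonexpansive subgrad_resolvent)

end

text \<open>A mean value inequality for a function whose increments are controlled but which need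
  not have a derivative: over \<open>N + 1\<close> equal steps the quadratic contributions add up to
  \<open>C / (N + 1)\<close>, which vanishes in the limit.\<close>

lemma abs_diff_le_if_local_slope:
  fixes g :: "real \<Rightarrow> real"
  assumes C: "C \<ge> 0"
    and loc: "\<And>s t. 0 \<le> s \<Longrightarrow> s < t \<Longrightarrow> t \<le> 1 \<Longrightarrow> \<bar>g t - g s\<bar> \<le> (t - s) * (C * (t - s) + e)"
  shows "\<bar>g 1 - g 0\<bar> \<le> e"
proof -
  have bound: "\<bar>g 1 - g 0\<bar> \<le> e + C * inverse (real (Suc N))" for N
  proof -
    define d where "d = inverse (real (Suc N))"
    have d: "d > 0" "real (Suc N) * d = 1" by (simp_all add: d_def)
    have "\<bar>g (real i * d) - g 0\<bar> \<le> real i * (d * (C * d + e))" if "i \<le> Suc N" for i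
      using that
    proof (induction i)
      case (Suc i)
      have a: "real (Suc i) * d = real i * d + d" by (simp add: algebra_simps)
      have "real (Suc i) * d \<le> real (Suc N) * d" using Suc.prems d(1) by (intro mult_right_mono) auto
      then have "real (Suc i) * d \<le> 1" using d(2) by simp
      then have "\<bar>g (real (Suc i) * d) - g (real i * d)\<bar> \<le> d * (C * d + e)"
        using loc[of "real i * d" "real (Suc i) * d"] d(1) unfolding a by simp
      moreover have "\<bar>g (real i * d) - g 0\<bar> \<le> real i * (d * (C * d + e))" using Suc by simp
      moreover have "real (Suc i) * (d * (C * d + e)) = real i * (d * (C * d + e)) + d * (C * d + e)"
        by (simp only: of_nat_Suc ring_distribs)
      ultimately show ?case by linarith
    qed simp
    from this[of "Suc N"] have "\<bar>g (real (Suc N) * d) - g 0\<bar> \<le> real (Suc N) * (d * (C * d + e))" by blast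
    also have "\<dots> = (real (Suc N) * d) * (C * d + e)" by (simp only: mult.assoc)
    finally show ?thesis unfolding d(2) by (simp add: d_def)
  qed
  have "(\<lambda>N. e + C * inverse (real (Suc N))) \<longlonglongrightarrow> e + C * 0"
    by (intro tendsto_intros LIMSEQ_inverse_real_of_nat)
  then have "\<bar>g 1 - g 0\<bar> \<le> e + C * 0"
    by (rule LIMSEQ_le_const) (use bound in auto)
  then show ?thesis by simp
qed

text \<open>Only the quadratic form of \<open>L\<close> is determined by the expansion;
  \<open>L\<close> itself may fail to be symmetric, and \<open>hess\<close> symmetrises it
  later.\<close>

definition expansion2 :: "('a::real_inner \<Rightarrow> real) \<Rightarrow> 'a \<Rightarrow> 'a \<Rightarrow> ('a \<Rightarrow> 'a) \<Rightarrow> bool" where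
  "expansion2 f z p L \<longleftrightarrow> linear L \<and> (\<forall>e>0. \<exists>d>0. \<forall>k. norm k < d \<longrightarrow>
     \<bar>f (z + k) - f z - p \<bullet> k - (k \<bullet> L k) / 2\<bar> \<le> e * (norm k)\<^sup>2)"

text \<open>Contact with a paraboloid from above makes the inverse of the resolvent Lipschitz at the
  contact point, so a derivative of the resolvent there is automatically invertible.\<close>

lemma subgrad_dist_le_at_contact:
  fixes h :: "'a::euclidean_space \<Rightarrow> real"
  assumes \<Lambda>: "\<Lambda> > 0" and p: "subgrad h z p" and q: "subgrad h x q"
    and up: "\<And>w. h w \<le> h z + p \<bullet> (w - z) + \<Lambda> / 2 * (norm (w - z))\<^sup>2"
  shows "norm (q - p) \<le> 2 * \<Lambda> * norm (x - z)"
proof -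
  \<comment> \<open>The subgradient inequality at \<open>x\<close> is tested at
    \<open>w = x + c (q - p)\<close>. For this \<open>c\<close> the term
    \<open>\<Lambda> c\<^sup>2 |q - p|\<^sup>2\<close> arising on the right is half of
    \<open>c |q - p|\<^sup>2\<close> on the left and can be absorbed.\<close>
  define c where "c = 1 / (2 * \<Lambda>)"
  define w where "w = x + c *\<^sub>R (q - p)"
  have c: "c > 0" using \<Lambda> by (simp add: c_def)
  have "h x + q \<bullet> (w - x) \<le> h w" "h z + p \<bullet> (x - z) \<le> h x" using p q by (auto simp: subgrad_def)
  with up[of w] have "(q - p) \<bullet> (w - x) \<le> \<Lambda> / 2 * (norm (w - z))\<^sup>2"
    by (simp add: inner_diff_left inner_diff_right)
  then have 1: "c * (norm (q - p))\<^sup>2 \<le> \<Lambda> / 2 * (norm (w - z))\<^sup>2"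
    by (simp add: w_def power2_norm_eq_inner)
  have "norm (w - z) \<le> norm (x - z) + c * norm (q - p)"
  proof -
    have "w - z = (x - z) + c *\<^sub>R (q - p)" by (simp add: w_def)
    then have "norm (w - z) \<le> norm (x - z) + norm (c *\<^sub>R (q - p))" by (metis norm_triangle_ineq)
    then show ?thesis using c by simp
  qed
  then have "(norm (w - z))\<^sup>2 \<le> (norm (x - z) + c * norm (q - p))\<^sup>2" by (rule power_mono) simp
  also have "\<dots> \<le> 2 * ((norm (x - z))\<^sup>2 + (c * norm (q - p))\<^sup>2)"
    using sum_squares_bound[of "norm (x - z)" "c * norm (q - p)"] by (simp add: power2_sum)
  finally have "\<Lambda> / 2 * (norm (w - z))\<^sup>2 \<le> \<Lambda> / 2 * (2 * ((norm (x - z))\<^sup>2 + (c * norm (q - p))\<^sup>2))"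
    using \<Lambda> by (intro mult_left_mono) auto
  also have "\<dots> = \<Lambda> * (norm (x - z))\<^sup>2 + c / 2 * (norm (q - p))\<^sup>2"
    using \<Lambda> by (simp add: c_def power2_eq_square field_simps)
  finally have "c / 2 * (norm (q - p))\<^sup>2 \<le> \<Lambda> * (norm (x - z))\<^sup>2" using 1 by linarith
  then have "(norm (q - p))\<^sup>2 \<le> (2 * \<Lambda> * norm (x - z))\<^sup>2"
    using \<Lambda> by (simp add: c_def power2_eq_square field_simps)
  then show ?thesis by (rule power2_le_imp_le) (use \<Lambda> in simp)
qed

text \<open>On the graph of the subdifferential the resolvent sends \<open>x + q\<close> to
  \<open>x\<close>. Its derivative \<open>D\<close> at \<open>z + p\<close> thus maps
  \<open>(x - z) + (q - p)\<close> to \<open>x - z\<close> up to \<open>o(|x - z|)\<close>.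
  Inverting \<open>D\<close> gives a first-order expansion of the subgradients,
  \<open>q - p = (D' - I) (x - z) + o(|x - z|)\<close>, which is then integrated along segments
  starting at \<open>z\<close>.\<close>

lemma expansion2_if_differentiable_resolvent:
  fixes h :: "'a::euclidean_space \<Rightarrow> real"
  assumes sg: "\<And>x. \<exists>p. subgrad h x p" and \<Lambda>: "\<Lambda> > 0" and p: "subgrad h z p"
    and up: "\<And>w. h w \<le> h z + p \<bullet> (w - z) + \<Lambda> / 2 * (norm (w - z))\<^sup>2"
    and df: "resolvent h differentiable (at (z + p))"
  shows "\<exists>L. expansion2 h z p L"
proof -
  let ?P = "resolvent h"
  note [simp] = resolvent_add_subgrad[OF sg]
  obtain D where D: "(?P has_derivative D) (at (z + p))" using df by (auto simp: differentiable_def)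
  have lD: "linear D" using D by (rule has_derivative_linear)
  have lip: "norm (q - p) \<le> 2 * \<Lambda> * norm (x - z)" if "subgrad h x q" for x q
    by (rule subgrad_dist_le_at_contact[OF \<Lambda> p that up])
  define C where "C = 1 + 2 * \<Lambda>"
  have C: "C > 0" using \<Lambda> by (simp add: C_def)
  have lipy: "norm ((x + q) - (z + p)) \<le> C * norm (x - z)" if "subgrad h x q" for x q
  proof -
    have "norm ((x + q) - (z + p)) \<le> norm (x - z) + norm (q - p)"
      using norm_triangle_ineq[of "x - z" "q - p"] by (simp add: algebra_simps)
    then show ?thesis using lip[OF that] by (simp add: C_def algebra_simps)
  qed
  have DP: "\<exists>d>0. \<forall>x q. subgrad h x q \<and> norm (x - z) < d \<longrightarrow> norm ((x - z) - D ((x - z) + (q - p))) \<le> e * norm (x - z)"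
    if e: "e > 0" for e
  proof -
    obtain d where d: "d > 0" "\<And>y. norm (y - (z + p)) < d \<Longrightarrow>
        norm (?P y - ?P (z + p) - D (y - (z + p))) \<le> e / C * norm (y - (z + p))"
      using D e C unfolding has_derivative_at_alt by (metis divide_pos_pos)
    show ?thesis
    proof (intro exI[of _ "d / C"] conjI allI impI)
      show "d / C > 0" using d C by simp
      fix x q assume "subgrad h x q \<and> norm (x - z) < d / C"
      then have q: "subgrad h x q" and n: "norm (x - z) < d / C" by auto
      have n2: "norm ((x + q) - (z + p)) < d" using lipy[OF q] n C by (simp add: field_simps)
      have eq: "(x + q) - (z + p) = (x - z) + (q - p)" by simp
      have "norm ((x - z) - D ((x - z) + (q - p))) \<le> e / C * norm ((x + q) - (z + p))"
        using d(2)[OF n2] q p unfolding eq by simp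
      also have "\<dots> \<le> e / C * (C * norm (x - z))" using lipy[OF q] e C by (intro mult_left_mono) auto
      finally show "norm ((x - z) - D ((x - z) + (q - p))) \<le> e * norm (x - z)" using C by simp
    qed
  qed
  \<comment> \<open>For every \<open>k\<close>, suitable rescaled increments \<open>u / t\<close>
    have images under \<open>D\<close> arbitrarily close to \<open>k\<close>; the range of
    \<open>D\<close> is a subspace, hence closed, and so contains \<open>k\<close>.\<close>
  have "surj D"
  proof -
    have sub: "subspace (range D)" using lD by (simp add: linear_subspace_image subspace_UNIV)
    have "k \<in> range D" if "k \<noteq> 0" for k
    proof -
      have "k \<in> closure (range D)"
        unfolding closure_approachable
      proof (intro allI impI)
        fix e :: real assume e: "e > 0"
        define e' where "e' = e / 2 / norm k"
        have e': "e' > 0" using e that by (simp add: e'_def)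
        obtain d where d: "d > 0" "\<And>x q. subgrad h x q \<Longrightarrow> norm (x - z) < d \<Longrightarrow>
            norm ((x - z) - D ((x - z) + (q - p))) \<le> e' * norm (x - z)" using DP[OF e'] by metis
        define t where "t = d / 2 / norm k"
        have t: "t > 0" using d that by (simp add: t_def)
        have tk: "norm ((z + t *\<^sub>R k) - z) < d" using d that by (simp add: t_def)
        obtain q where q: "subgrad h (z + t *\<^sub>R k) q" using sg by blast
        define u where "u = t *\<^sub>R k + (q - p)"
        have "norm (t *\<^sub>R k - D u) \<le> e' * (t * norm k)" using d(2)[OF q tk] t by (simp add: u_def)
        moreover have "t *\<^sub>R k - D u = t *\<^sub>R (k - D (u /\<^sub>R t))"
          using t lD by (simp add: linear_scale algebra_simps)
        ultimately have "norm (t *\<^sub>R (k - D (u /\<^sub>R t))) \<le> e' * (t * norm k)" by (simp only:)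
        then have "t * norm (k - D (u /\<^sub>R t)) \<le> t * (e' * norm k)"
          by (simp only: norm_scaleR abs_of_pos[OF t] mult.left_commute[of e'])
        then have "norm (k - D (u /\<^sub>R t)) \<le> e / 2" using t that by (simp add: e'_def)
        then show "\<exists>y\<in>range D. dist y k < e" using e
          by (intro bexI[of _ "D (u /\<^sub>R t)"]) (auto simp: dist_norm norm_minus_commute)
      qed
      then show ?thesis using closure_closed[OF closed_subspace[OF sub]] by simp
    qed
    moreover have "0 \<in> range D" using sub by (rule subspace_0)
    ultimately show ?thesis by (metis UNIV_eq_I)
  qed
  then obtain D' where D': "linear D'" "\<And>x. D' (D x) = x" "\<And>x. D (D' x) = x"
    using linear_surjective_isomorphism[OF lD] by auto
  define L where "L = (\<lambda>k. D' k - k)"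
  have lL: "linear L" unfolding L_def by (intro linear_compose_sub D' linear_ident)
  have bL: "bounded_linear L" and bD': "bounded_linear D'" using lL D' by (simp_all add: linear_conv_bounded_linear)
  obtain b where b: "b > 0" "\<And>x. norm (D' x) \<le> norm x * b" using bounded_linear.pos_bounded[OF bD'] by blast
  have DL: "\<exists>d>0. \<forall>x q. subgrad h x q \<and> norm (x - z) < d \<longrightarrow> norm (q - p - L (x - z)) \<le> e * norm (x - z)"
    if e: "e > 0" for e
  proof -
    obtain d where d: "d > 0" "\<And>x q. subgrad h x q \<Longrightarrow> norm (x - z) < d \<Longrightarrow>
        norm ((x - z) - D ((x - z) + (q - p))) \<le> e / b * norm (x - z)" using DP[of "e / b"] e b by (metis divide_pos_pos)
    have "norm (q - p - L (x - z)) \<le> e * norm (x - z)" if q: "subgrad h x q" "norm (x - z) < d" for x q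
    proof -
      have "D' ((x - z) - D ((x - z) + (q - p))) = L (x - z) - (q - p)"
        by (simp only: linear_diff[OF D'(1), of "x - z"] D'(2) L_def) simp
      then have "norm (q - p - L (x - z)) = norm (D' ((x - z) - D ((x - z) + (q - p))))"
        by (simp add: norm_minus_commute)
      also have "\<dots> \<le> (e / b * norm (x - z)) * b"
        using b d(2)[OF q] by (intro order_trans[OF b(2)] mult_right_mono) auto
      finally show ?thesis using b by simp
    qed
    with d(1) show ?thesis by blast
  qed
  have "expansion2 h z p L"
    unfolding expansion2_def
  proof (intro conjI lL allI impI)
    fix e :: real assume e: "e > 0"
    obtain d where d: "d > 0" "\<And>x q. subgrad h x q \<Longrightarrow> norm (x - z) < d \<Longrightarrow> norm (q - p - L (x - z)) \<le> e * norm (x - z)"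
      using DL[OF e] by metis
    show "\<exists>d>0. \<forall>k. norm k < d \<longrightarrow> \<bar>h (z + k) - h z - p \<bullet> k - (k \<bullet> L k) / 2\<bar> \<le> e * (norm k)\<^sup>2"
    proof (intro exI[of _ d] conjI allI impI d(1))
      fix k :: 'a assume k: "norm k < d"
      \<comment> \<open>The remainder of the expansion along the ray. Subgradients at the two ends
        of a subinterval bound its increments from both sides.\<close>
      define g where "g = (\<lambda>t. h (z + t *\<^sub>R k) - h z - t * (p \<bullet> k) - t\<^sup>2 * (k \<bullet> L k) / 2)"
      have qk: "\<bar>q \<bullet> k - p \<bullet> k - t * (k \<bullet> L k)\<bar> \<le> e * (norm k)\<^sup>2"
        if t: "0 \<le> t" "t \<le> 1" and q: "subgrad h (z + t *\<^sub>R k) q" for t q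
      proof -
        have tk: "norm ((z + t *\<^sub>R k) - z) \<le> norm k" using t by (simp add: mult_left_le_one_le)
        have "norm (q - p - L ((z + t *\<^sub>R k) - z)) \<le> e * norm ((z + t *\<^sub>R k) - z)"
          by (rule d(2)[OF q]) (use tk k in linarith)
        also have "\<dots> \<le> e * norm k" using tk e by (intro mult_left_mono) auto
        finally have n: "norm (q - p - t *\<^sub>R L k) \<le> e * norm k" using lL by (simp add: linear_scale)
        have "\<bar>(q - p - t *\<^sub>R L k) \<bullet> k\<bar> \<le> norm (q - p - t *\<^sub>R L k) * norm k" by (rule Cauchy_Schwarz_ineq2)
        also have "\<dots> \<le> e * norm k * norm k" using n by (intro mult_right_mono) auto
        finally show ?thesis by (simp add: inner_diff_left inner_commute power2_eq_square algebra_simps)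
      qed
      have "\<bar>g 1 - g 0\<bar> \<le> e * (norm k)\<^sup>2"
      proof (rule abs_diff_le_if_local_slope[where C = "\<bar>k \<bullet> L k\<bar> / 2"])
        fix s t :: real assume st: "0 \<le> s" "s < t" "t \<le> 1"
        obtain qs where qs: "subgrad h (z + s *\<^sub>R k) qs" using sg by blast
        obtain qt where qt: "subgrad h (z + t *\<^sub>R k) qt" using sg by blast
        have "h (z + s *\<^sub>R k) + qs \<bullet> ((z + t *\<^sub>R k) - (z + s *\<^sub>R k)) \<le> h (z + t *\<^sub>R k)"
          using qs unfolding subgrad_def by blast
        moreover have "h (z + t *\<^sub>R k) + qt \<bullet> ((z + s *\<^sub>R k) - (z + t *\<^sub>R k)) \<le> h (z + s *\<^sub>R k)"
          using qt unfolding subgrad_def by blast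
        moreover have "(z + t *\<^sub>R k) - (z + s *\<^sub>R k) = (t - s) *\<^sub>R k" "(z + s *\<^sub>R k) - (z + t *\<^sub>R k) = (s - t) *\<^sub>R k"
          by (simp_all add: algebra_simps)
        ultimately have hs: "(t - s) * (qs \<bullet> k) \<le> h (z + t *\<^sub>R k) - h (z + s *\<^sub>R k)"
          and ht: "h (z + t *\<^sub>R k) - h (z + s *\<^sub>R k) \<le> (t - s) * (qt \<bullet> k)"
          by (simp_all add: algebra_simps)
        define l where "l = k \<bullet> L k"
        have gd: "g t - g s = h (z + t *\<^sub>R k) - h (z + s *\<^sub>R k) - (t - s) * (p \<bullet> k + (t + s) / 2 * l)"
          unfolding g_def l_def[symmetric] by (simp add: power2_eq_square field_simps)
        have al: "\<bar>l\<bar> * (t - s) / 2 \<ge> l * (t - s) / 2" "\<bar>l\<bar> * (t - s) / 2 \<ge> - l * (t - s) / 2"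
          using st mult_right_mono[of l "\<bar>l\<bar>" "t - s"] mult_right_mono[of "- l" "\<bar>l\<bar>" "t - s"] by simp_all
        have "qt \<bullet> k \<le> p \<bullet> k + t * l + e * (norm k)\<^sup>2" using qk[OF _ _ qt] st by (simp add: l_def)
        then have "(t - s) * (qt \<bullet> k) \<le> (t - s) * (p \<bullet> k + t * l + e * (norm k)\<^sup>2)" using st by (intro mult_left_mono) auto
        then have "g t - g s \<le> (t - s) * ((p \<bullet> k + t * l + e * (norm k)\<^sup>2) - (p \<bullet> k + (t + s) / 2 * l))"
          using ht unfolding gd right_diff_distrib by linarith
        also have "(p \<bullet> k + t * l + e * (norm k)\<^sup>2) - (p \<bullet> k + (t + s) / 2 * l) = l * (t - s) / 2 + e * (norm k)\<^sup>2"
          by (simp add: field_simps)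
        also have "(t - s) * \<dots> \<le> (t - s) * (\<bar>l\<bar> / 2 * (t - s) + e * (norm k)\<^sup>2)"
          using al st by (intro mult_left_mono) auto
        finally have u: "g t - g s \<le> (t - s) * (\<bar>l\<bar> / 2 * (t - s) + e * (norm k)\<^sup>2)" .
        have "p \<bullet> k + s * l - e * (norm k)\<^sup>2 \<le> qs \<bullet> k" using qk[OF _ _ qs] st by (simp add: l_def)
        then have "(t - s) * (p \<bullet> k + s * l - e * (norm k)\<^sup>2) \<le> (t - s) * (qs \<bullet> k)" using st by (intro mult_left_mono) auto
        then have v1: "(t - s) * ((p \<bullet> k + s * l - e * (norm k)\<^sup>2) - (p \<bullet> k + (t + s) / 2 * l)) \<le> g t - g s"
          using hs unfolding gd right_diff_distrib by linarith
        have xy: "(p \<bullet> k + s * l - e * (norm k)\<^sup>2) - (p \<bullet> k + (t + s) / 2 * l) = - (l * (t - s) / 2 + e * (norm k)\<^sup>2)"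
          by (simp add: field_simps)
        have v3: "(t - s) * - (\<bar>l\<bar> / 2 * (t - s) + e * (norm k)\<^sup>2) \<le> (t - s) * - (l * (t - s) / 2 + e * (norm k)\<^sup>2)"
          using al st by (intro mult_left_mono) auto
        have v: "- ((t - s) * (\<bar>l\<bar> / 2 * (t - s) + e * (norm k)\<^sup>2)) \<le> g t - g s"
          using order_trans[OF v3 v1[unfolded xy]] by (simp only: mult_minus_right)
        show "\<bar>g t - g s\<bar> \<le> (t - s) * (\<bar>k \<bullet> L k\<bar> / 2 * (t - s) + e * (norm k)\<^sup>2)"
          using u v unfolding l_def by linarith
      qed simp
      then show "\<bar>h (z + k) - h z - p \<bullet> k - (k \<bullet> L k) / 2\<bar> \<le> e * (norm k)\<^sup>2" by (simp add: g_def)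
    qed
  qed
  then show ?thesis by blast
qed


lemma eq_zero_if_inner_le_square:
  fixes w :: "'a::real_inner"
  assumes d: "d > 0" and le: "\<And>k. norm k < d \<Longrightarrow> w \<bullet> k \<le> C * (norm k)\<^sup>2"
  shows "w = 0"
proof -
  define n where "n = norm w + 1"
  define s where "s = d / 2 / n"
  have nw: "n > 0" unfolding n_def by (smt (verit) norm_ge_zero)
  have s: "s > 0" using d nw by (simp add: s_def)
  have "s * norm w \<le> s * n" using s by (intro mult_left_mono) (auto simp: n_def)
  also have "\<dots> < d" using d nw by (simp add: s_def)
  finally have sw: "s * norm w < d" .
  have "w \<bullet> w \<le> 0 + t * (C * s * (norm w)\<^sup>2)" if t: "0 < t" "t \<le> 1" for t
  proof -
    have "norm ((t * s) *\<^sub>R w) = t * (s * norm w)" using t s by simp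
    also have "\<dots> \<le> s * norm w" using t s by (simp add: mult_left_le_one_le)
    finally have "w \<bullet> ((t * s) *\<^sub>R w) \<le> C * (norm ((t * s) *\<^sub>R w))\<^sup>2" using sw by (intro le) simp
    then have "(t * s) * (w \<bullet> w) \<le> (t * s) * (t * (C * s * (norm w)\<^sup>2))"
      by (simp add: power_mult_distrib power2_eq_square mult_ac)
    moreover have "t * s > 0" using t s by simp
    ultimately have "w \<bullet> w \<le> t * (C * s * (norm w)\<^sup>2)" by (rule mult_left_le_imp_le)
    then show ?thesis by simp
  qed
  then have "w \<bullet> w \<le> 0" by (rule le_if_le_add_small_mult)
  then show ?thesis by (metis inner_ge_zero inner_eq_zero_iff order_antisym)
qed

lemma norm_diff_square: "(norm (a - b))\<^sup>2 = (norm a)\<^sup>2 - 2 * (a \<bullet> b) + (norm (b::'a::real_inner))\<^sup>2"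
  by (simp add: power2_norm_eq_inner inner_diff_left inner_diff_right inner_commute)

definition symop :: "('a::real_inner \<Rightarrow> 'a) \<Rightarrow> bool" where
  "symop B \<longleftrightarrow> linear B \<and> (\<forall>x y. x \<bullet> B y = y \<bullet> B x)"

lemma symop_linear: "symop B \<Longrightarrow> linear B" by (simp add: symop_def)

lemma symop_expand:
  assumes "symop B"
  shows "(x + k) \<bullet> B (x + k) = x \<bullet> B x + 2 * (B x \<bullet> k) + k \<bullet> B k"
proof -
  have "x \<bullet> B k = k \<bullet> B x" using assms by (auto simp: symop_def)
  moreover have "B (x + k) = B x + B k" using assms by (auto simp: symop_def linear_add)
  ultimately show ?thesis by (simp add: inner_add_left inner_add_right inner_commute)
qed

lemma linear_form_bound:
  fixes B :: "'a::euclidean_space \<Rightarrow> 'a"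
  assumes "linear B"
  shows "\<exists>M>0. \<forall>k. norm (B k) \<le> M * norm k \<and> \<bar>k \<bullet> B k\<bar> \<le> M * (norm k)\<^sup>2"
proof -
  obtain M where M: "M > 0" "\<And>x. norm (B x) \<le> norm x * M"
    using assms bounded_linear.pos_bounded linear_conv_bounded_linear by blast
  have "\<bar>k \<bullet> B k\<bar> \<le> M * (norm k)\<^sup>2" for k
  proof -
    have "\<bar>k \<bullet> B k\<bar> \<le> norm k * norm (B k)" by (rule Cauchy_Schwarz_ineq2)
    also have "\<dots> \<le> norm k * (norm k * M)" using M by (intro mult_left_mono) auto
    finally show ?thesis by (simp add: power2_eq_square mult_ac)
  qed
  with M show ?thesis by (auto simp: mult.commute)
qed

text \<open>Both sides are homogeneous of degree two, so an inequality up to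
  \<open>e |k|\<^sup>2\<close> near 0 holds for all \<open>k\<close>; then \<open>e\<close> tends to
  0.\<close>

lemma quadratic_le_if_small:
  fixes B :: "'a::real_inner \<Rightarrow> 'a"
  assumes L: "linear L" and B: "linear B"
    and le: "\<And>e. e > 0 \<Longrightarrow> \<exists>d>0. \<forall>k. norm k < d \<longrightarrow> k \<bullet> L k \<le> k \<bullet> B k + e * (norm k)\<^sup>2"
  shows "k \<bullet> L k \<le> k \<bullet> B k"
proof (rule field_le_epsilon)
  fix e :: real assume e: "e > 0"
  define e' where "e' = e / ((norm k)\<^sup>2 + 1)"
  have pos: "(norm k)\<^sup>2 + 1 > 0" by (smt (verit) zero_le_power2)
  have e': "e' > 0" "e' * (norm k)\<^sup>2 \<le> e" using e pos by (simp_all add: e'_def field_simps)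
  obtain d where d: "d > 0" "\<And>k. norm k < d \<Longrightarrow> k \<bullet> L k \<le> k \<bullet> B k + e' * (norm k)\<^sup>2" using le[OF e'(1)] by metis
  define n where "n = norm k + 1"
  define t where "t = d / 2 / n"
  have nk: "n > 0" unfolding n_def by (smt (verit) norm_ge_zero)
  have t: "t > 0" using d nk by (simp add: t_def)
  have "t * norm k \<le> t * n" using t by (intro mult_left_mono) (auto simp: n_def)
  also have "\<dots> = d / 2" using nk by (simp add: t_def)
  finally have "norm (t *\<^sub>R k) < d" using d t by simp
  from d(2)[OF this] have "t\<^sup>2 * (k \<bullet> L k) \<le> t\<^sup>2 * (k \<bullet> B k + e' * (norm k)\<^sup>2)"
    using t L B by (simp add: linear_scale power2_eq_square algebra_simps)
  then have "k \<bullet> L k \<le> k \<bullet> B k + e' * (norm k)\<^sup>2" using t by simp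
  with e' show "k \<bullet> L k \<le> k \<bullet> B k + e" by linarith
qed

text \<open>Jensen's lemma and Aleksandrov's theorem in one step: the slopes \<open>p\<close> of the affine functions
  touching \<open>f\<close> from above fill a ball and depend on the points \<open>z + p + \<Lambda> z\<close>, \<open>z\<close> the contact point,
  through a Lipschitz map. So these points are not negligible, and at one of them the
  resolvent is differentiable.\<close>

lemma semiconvex_max_expansion:
  fixes g :: "'a::euclidean_space \<Rightarrow> real"
  assumes semi: "\<And>x. \<exists>p. \<forall>w. g x + p \<bullet> (w - x) - \<mu> / 2 * (norm (w - x))\<^sup>2 \<le> g w"
    and \<mu>: "\<mu> \<ge> 0" and B: "symop B"
    and le: "\<And>z. g z \<le> (z \<bullet> B z) / 2" and g0: "0 \<le> g 0"
    and \<delta>: "\<delta> > 0" and r: "r > 0"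
  obtains z p L where "norm z < r" "norm p < r" "expansion2 g z p L"
    "\<And>k. k \<bullet> L k \<le> k \<bullet> B k + \<delta> * (norm k)\<^sup>2"
proof -
  have lB: "linear B" using B by (rule symop_linear)
  obtain M where M: "M > 0" "\<And>k. norm (B k) \<le> M * norm k" "\<And>k. \<bar>k \<bullet> B k\<bar> \<le> M * (norm k)\<^sup>2"
    using linear_form_bound[OF lB] by metis
  \<comment> \<open>\<open>\<Lambda>\<close> is large enough for the form of \<open>A\<close> to
    dominate \<open>\<mu> |k|\<^sup>2\<close>, so that \<open>h\<close> is convex. Removing
    \<open>\<Lambda> / 2 |z|\<^sup>2\<close> from \<open>h\<close> leaves
    \<open>f = g - (z \<bullet> B z) / 2 - \<delta> / 2 |z|\<^sup>2\<close>, of which 0 is a strict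
    maximum thanks to \<open>\<delta>\<close>.\<close>
  define \<Lambda> where "\<Lambda> = \<mu> + \<delta> + M"
  have \<Lambda>: "\<Lambda> > 0" using \<mu> \<delta> M by (simp add: \<Lambda>_def)
  define A where "A = (\<lambda>z. (\<Lambda> - \<delta>) *\<^sub>R z - B z)"
  have A: "symop A"
    using B unfolding symop_def A_def
    by (auto intro!: linear_compose_sub linear_compose_scale_right linear_ident simp: inner_diff_right inner_commute)
  have Ak: "\<mu> * (norm k)\<^sup>2 \<le> k \<bullet> A k" for k
    using M(3)[of k] by (simp add: A_def \<Lambda>_def inner_diff_right power2_norm_eq_inner algebra_simps)
  define h where "h = (\<lambda>z. g z + (z \<bullet> A z) / 2)"
  have sg: "\<exists>p. subgrad h x p" for x
  proof -
    obtain p where p: "\<And>w. g x + p \<bullet> (w - x) - \<mu> / 2 * (norm (w - x))\<^sup>2 \<le> g w" using semi by blast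
    have "subgrad h x (p + A x)"
      unfolding subgrad_def
    proof
      fix w
      have "w \<bullet> A w = x \<bullet> A x + 2 * (A x \<bullet> (w - x)) + (w - x) \<bullet> A (w - x)"
        using symop_expand[OF A, of x "w - x"] by simp
      then show "h x + (p + A x) \<bullet> (w - x) \<le> h w"
        using p[of w] Ak[of "w - x"] by (simp add: h_def inner_add_left field_simps)
    qed
    then show ?thesis by blast
  qed
  have ch: "continuous_on UNIV h"
    by (rule convex_on_continuous[OF open_UNIV convex_on_if_subgrad[OF sg]])
  define f where "f = (\<lambda>z. h z - \<Lambda> / 2 * (norm z)\<^sup>2)"
  have fg: "f z = g z - (z \<bullet> B z) / 2 - \<delta> / 2 * (norm z)\<^sup>2" for z
  proof -
    have "z \<bullet> A z = (\<Lambda> - \<delta>) * (norm z)\<^sup>2 - z \<bullet> B z" by (simp add: A_def inner_diff_right power2_norm_eq_inner)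
    then show ?thesis by (simp add: f_def h_def field_simps)
  qed
  have cf: "continuous_on UNIV f" unfolding f_def by (intro continuous_intros ch)
  have fneg: "f z \<le> - (\<delta> / 2 * (norm z)\<^sup>2)" for z using le[of z] by (simp add: fg)
  have f0: "f 0 \<ge> 0" using g0 by (simp add: fg)
  \<comment> \<open>Beyond the radius \<open>2 |p| / \<delta>\<close> the quadratic decay of
    \<open>f\<close> outweighs the slope \<open>p\<close>, so the contact point lies within
    it.\<close>
  have mx: "\<exists>z. norm z \<le> 2 * norm p / \<delta> \<and> (\<forall>w. f w \<le> f z + p \<bullet> (w - z))" for p
  proof -
    define R where "R = 2 * norm p / \<delta>"
    have R: "R \<ge> 0" using \<delta> by (simp add: R_def)
    have "continuous_on (cball 0 R) (\<lambda>z. f z - p \<bullet> z)"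
      by (intro continuous_intros continuous_on_subset[OF cf]) auto
    moreover have "cball (0::'a) R \<noteq> {}" using R by simp
    ultimately obtain z where z: "z \<in> cball 0 R" "\<forall>w\<in>cball 0 R. f w - p \<bullet> w \<le> f z - p \<bullet> z"
      using continuous_attains_sup[OF compact_cball] by blast
    have "f w - p \<bullet> w \<le> f z - p \<bullet> z" for w
    proof (cases "w \<in> cball 0 R")
      case False
      then have w: "2 * norm p < \<delta> * norm w" using \<delta> by (simp add: R_def field_simps)
      have "- (p \<bullet> w) \<le> norm p * norm w" using Cauchy_Schwarz_ineq2[of p w] by linarith
      also have "\<dots> \<le> \<delta> / 2 * (norm w)\<^sup>2"
        using mult_right_mono[of "2 * norm p" "\<delta> * norm w" "norm w"] w by (simp add: power2_eq_square)
      finally have "f w - p \<bullet> w \<le> f 0 - p \<bullet> 0" using fneg[of w] f0 by simp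
      also have "\<dots> \<le> f z - p \<bullet> z" using z(2)[rule_format, of 0] R by simp
      finally show ?thesis .
    qed (use z in auto)
    then show ?thesis using z(1) by (intro exI[of _ z]) (auto simp: R_def inner_diff_right algebra_simps)
  qed
  \<comment> \<open>With slopes below \<open>r' = r / d0\<close>, both bounds needed at the end stay
    below \<open>r\<close>: \<open>2 r' / \<delta>\<close> for \<open>|z|\<close> and
    \<open>r' + 2 r' (1 + M / \<delta>)\<close> for the slope \<open>q\<close> of
    \<open>g\<close>.\<close>
  define d0 where "d0 = 2 + 2 * (1 + M / \<delta>) + 2 / \<delta>"
  define r' where "r' = r / d0"
  have den: "d0 > 0" unfolding d0_def
    using divide_pos_pos[OF M(1) \<delta>] divide_pos_pos[of 2 \<delta>] \<delta> by (intro add_pos_pos) simp_all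
  have r': "r' > 0" using r den by (simp add: r'_def)
  have r'eq: "r' * 2 + r' * (2 * (1 + M / \<delta>)) + r' * (2 / \<delta>) = r"
  proof -
    have "r' * d0 = r" using den by (simp add: r'_def)
    then show ?thesis by (simp only: d0_def distrib_left)
  qed
  define K where "K = {y. \<exists>z p. norm p < r' \<and> norm z \<le> 2 * norm p / \<delta> \<and> (\<forall>w. f w \<le> f z + p \<bullet> (w - z)) \<and> y = z + (p + \<Lambda> *\<^sub>R z)}"
  have hup: "h w \<le> h z + (p + \<Lambda> *\<^sub>R z) \<bullet> (w - z) + \<Lambda> / 2 * (norm (w - z))\<^sup>2"
    if "\<And>w. f w \<le> f z + p \<bullet> (w - z)" for z p w
  proof -
    have "(norm w)\<^sup>2 = (norm z)\<^sup>2 + 2 * (z \<bullet> (w - z)) + (norm (w - z))\<^sup>2"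
      by (simp add: power2_norm_eq_inner inner_diff_left inner_diff_right inner_commute)
    then have "\<Lambda> / 2 * (norm w)\<^sup>2 = \<Lambda> / 2 * (norm z)\<^sup>2 + \<Lambda> * (z \<bullet> (w - z)) + \<Lambda> / 2 * (norm (w - z))\<^sup>2"
      by (simp only: ring_distribs)
    then show ?thesis using that[of w] by (simp add: f_def inner_add_left field_simps)
  qed
  have hsub: "subgrad h z (p + \<Lambda> *\<^sub>R z)" if m: "\<And>w. f w \<le> f z + p \<bullet> (w - z)" for z p
  proof -
    obtain q where q: "subgrad h z q" using sg by blast
    have "q - (p + \<Lambda> *\<^sub>R z) = 0"
    proof (rule eq_zero_if_inner_le_square[where d = 1])
      fix k :: 'a
      have "h z + q \<bullet> k \<le> h (z + k)" using q[unfolded subgrad_def, THEN spec, of "z + k"] by simp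
      moreover have "h (z + k) \<le> h z + (p + \<Lambda> *\<^sub>R z) \<bullet> k + \<Lambda> / 2 * (norm k)\<^sup>2" using hup[OF m, of "z + k"] by simp
      ultimately show "(q - (p + \<Lambda> *\<^sub>R z)) \<bullet> k \<le> \<Lambda> / 2 * (norm k)\<^sup>2" unfolding inner_diff_left by linarith
    qed simp
    then have "q = p + \<Lambda> *\<^sub>R z" by simp
    then show ?thesis using q by simp
  qed
  have resK: "resolvent h (z + (p + \<Lambda> *\<^sub>R z)) = z" if m: "\<And>w. f w \<le> f z + p \<bullet> (w - z)" for z p
    by (rule resolvent_add_subgrad[OF sg hsub[OF m]])
  have "\<not> negligible K"
  proof
    assume nK: "negligible K"
    \<comment> \<open>Recovers the slope: for \<open>y = z + p + \<Lambda> z\<close> with contact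
      point \<open>z\<close>, the resolvent returns \<open>z\<close>, hence \<open>F y = p\<close>.
      As \<open>F\<close> is Lipschitz, a negligible \<open>K\<close> would have a negligible
      image.\<close>
    define F where "F = (\<lambda>y. y - (1 + \<Lambda>) *\<^sub>R resolvent h y)"
    have "negligible (F ` K)"
    proof (rule negligible_locally_Lipschitz_image[OF _ nK])
      fix x
      have "norm (F y - F x) \<le> (2 + \<Lambda>) * norm (y - x)" for y
      proof -
        have "norm (resolvent h y - resolvent h x) \<le> norm (y - x)"
          using lipschitz_resolvent[OF sg] by (auto simp: lipschitz_on_def dist_norm)
        moreover have "F y - F x = (y - x) - (1 + \<Lambda>) *\<^sub>R (resolvent h y - resolvent h x)"
          by (simp add: F_def algebra_simps)
        then have "norm (F y - F x) \<le> norm (y - x) + (1 + \<Lambda>) * norm (resolvent h y - resolvent h x)"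
          using norm_triangle_ineq4[of "y - x" "(1 + \<Lambda>) *\<^sub>R (resolvent h y - resolvent h x)"] \<Lambda> by simp
        ultimately have "norm (F y - F x) \<le> norm (y - x) + (1 + \<Lambda>) * norm (y - x)"
          using mult_left_mono[of "norm (resolvent h y - resolvent h x)" "norm (y - x)" "1 + \<Lambda>"] \<Lambda> by linarith
        then show ?thesis by (simp add: algebra_simps)
      qed
      then show "\<exists>T B. open T \<and> x \<in> T \<and> (\<forall>y\<in>K \<inter> T. norm (F y - F x) \<le> B * norm (y - x))"
        by (intro exI[of _ UNIV] exI[of _ "2 + \<Lambda>"]) auto
    qed simp
    moreover have "ball 0 r' \<subseteq> F ` K"
    proof
      fix p assume p: "p \<in> ball (0::'a) r'"
      obtain z where z: "norm z \<le> 2 * norm p / \<delta>" "\<And>w. f w \<le> f z + p \<bullet> (w - z)" using mx by blast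
      have "z + (p + \<Lambda> *\<^sub>R z) \<in> K" using p z by (auto simp: K_def)
      moreover have "F (z + (p + \<Lambda> *\<^sub>R z)) = p" unfolding F_def resK[OF z(2)] by (simp add: algebra_simps)
      ultimately show "p \<in> F ` K" by force
    qed
    ultimately have "negligible (ball (0::'a) r')" by (rule negligible_subset)
    then show False using open_not_negligible[of "ball (0::'a) r'"] r' by auto
  qed
  then obtain y where y: "y \<in> K" "resolvent h differentiable (at y)"
    using negligible_subset[OF Rademacher[OF lipschitz_resolvent[OF sg]], of K] by blast
  obtain z p where zp: "norm p < r'" "norm z \<le> 2 * norm p / \<delta>" "\<And>w. f w \<le> f z + p \<bullet> (w - z)"
    and yz: "y = z + (p + \<Lambda> *\<^sub>R z)" using y(1) unfolding K_def by blast
  obtain L' where L': "expansion2 h z (p + \<Lambda> *\<^sub>R z) L'"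
    using expansion2_if_differentiable_resolvent[OF sg \<Lambda> hsub[OF zp(3)] hup[OF zp(3)]] y(2) unfolding yz by blast
  define L where "L = (\<lambda>k. L' k - A k)"
  \<comment> \<open>\<open>f\<close> has slope \<open>p\<close> at \<open>z\<close>; adding back the
    gradients of \<open>\<delta> / 2 |z|\<^sup>2\<close> and \<open>(z \<bullet> B z) / 2\<close>
    gives the slope of \<open>g\<close>.\<close>
  define q where "q = p + \<delta> *\<^sub>R z + B z"
  have lL: "linear L" using L' symop_linear[OF A] unfolding L_def expansion2_def by (intro linear_compose_sub) auto
  have qeq: "q = p + \<Lambda> *\<^sub>R z - A z" by (simp add: q_def A_def algebra_simps)
  have ge: "g (z + k) - g z - q \<bullet> k - (k \<bullet> L k) / 2 = h (z + k) - h z - (p + \<Lambda> *\<^sub>R z) \<bullet> k - (k \<bullet> L' k) / 2" for k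
  proof -
    have "(z + k) \<bullet> A (z + k) = z \<bullet> A z + 2 * (A z \<bullet> k) + k \<bullet> A k" by (rule symop_expand[OF A])
    then show ?thesis by (simp add: h_def qeq L_def inner_diff_left inner_diff_right field_simps)
  qed
  have ex: "expansion2 g z q L" using L' lL unfolding expansion2_def ge by blast
  show thesis
  proof (rule that)
    have zr: "norm z \<le> r' * (2 / \<delta>)"
      using zp(1,2) \<delta> by (simp add: field_simps)
    have rr: "0 < r' * 2" "0 < r' * (2 * (1 + M / \<delta>))" "0 < r' * (2 / \<delta>)"
      using r' divide_pos_pos[OF M(1) \<delta>] divide_pos_pos[of 2 \<delta>] \<delta> by (simp_all add: add_pos_pos)
    show "norm z < r" using zr rr r'eq by linarith
    have "norm q \<le> norm p + \<delta> * norm z + M * norm z"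
      unfolding q_def using norm_triangle_ineq[of "p + \<delta> *\<^sub>R z" "B z"] norm_triangle_ineq[of p "\<delta> *\<^sub>R z"] M(2)[of z] \<delta> by simp
    also have "\<dots> = norm p + (\<delta> + M) * norm z" by (simp add: ring_distribs)
    also have "\<dots> < r' + (\<delta> + M) * (r' * (2 / \<delta>))"
      using zp(1) zr \<delta> M by (intro add_less_le_mono mult_left_mono) auto
    also have "\<dots> = r' + r' * (2 * (1 + M / \<delta>))" using \<delta> by (simp add: field_simps)
    also have "\<dots> < r" using rr r'eq r' by linarith
    finally show "norm q < r" .
    show "expansion2 g z q L" by (rule ex)
    fix k
    define B' where "B' = (\<lambda>k. B k + \<delta> *\<^sub>R k)"
    have "k \<bullet> L k \<le> k \<bullet> B' k"
    proof (rule quadratic_le_if_small[OF lL])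
      show "linear B'" unfolding B'_def by (intro linear_compose_add lB linear_compose_scale_right linear_ident)
      fix e :: real assume e: "e > 0"
      obtain d where d: "d > 0" "\<And>k. norm k < d \<Longrightarrow> \<bar>g (z + k) - g z - q \<bullet> k - (k \<bullet> L k) / 2\<bar> \<le> e / 2 * (norm k)\<^sup>2"
        using ex e unfolding expansion2_def by (metis half_gt_zero)
      have "k \<bullet> L k \<le> k \<bullet> B' k + e * (norm k)\<^sup>2" if "norm k < d" for k
      proof -
        have "(z + k) \<bullet> B (z + k) = z \<bullet> B z + 2 * (B z \<bullet> k) + k \<bullet> B k" by (rule symop_expand[OF B])
        moreover have "(norm (z + k))\<^sup>2 = (norm z)\<^sup>2 + 2 * (z \<bullet> k) + (norm k)\<^sup>2"
          by (simp add: power2_norm_eq_inner inner_add_left inner_add_right inner_commute)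
        then have "\<delta> / 2 * (norm (z + k))\<^sup>2 = \<delta> / 2 * (norm z)\<^sup>2 + \<delta> * (z \<bullet> k) + \<delta> / 2 * (norm k)\<^sup>2"
          by (simp only: ring_distribs)
        moreover have "f (z + k) \<le> f z + p \<bullet> k" using zp(3)[of "z + k"] by simp
        ultimately have "g (z + k) - g z - q \<bullet> k \<le> (k \<bullet> B k) / 2 + \<delta> / 2 * (norm k)\<^sup>2"
          by (simp add: fg q_def inner_add_left field_simps)
        moreover have "(k \<bullet> L k) / 2 \<le> g (z + k) - g z - q \<bullet> k + e / 2 * (norm k)\<^sup>2" using d(2)[OF that] by linarith
        moreover have "k \<bullet> B' k = k \<bullet> B k + \<delta> * (norm k)\<^sup>2" by (simp add: B'_def inner_add_right power2_norm_eq_inner)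
        ultimately show ?thesis by simp
      qed
      with d(1) show "\<exists>d>0. \<forall>k. norm k < d \<longrightarrow> k \<bullet> L k \<le> k \<bullet> B' k + e * (norm k)\<^sup>2" by blast
    qed
    then show "k \<bullet> L k \<le> k \<bullet> B k + \<delta> * (norm k)\<^sup>2" by (simp add: B'_def inner_add_right power2_norm_eq_inner)
  qed
qed

section \<open>Sup-convolutions and the theorem on sums\<close>

text \<open>If every value \<open>f x\<close> were exceeded by some \<open>f (g x)\<close>, each
  \<open>x\<close> would have a neighbourhood on which \<open>f\<close> is below
  \<open>f (g x)\<close>. Finitely many of these cover \<open>K\<close>, and the largest of the
  finitely many values \<open>f (g c)\<close> would exceed itself.\<close>

lemma usc_attains_max:
  fixes f :: "'a::topological_space \<Rightarrow> real"
  assumes K: "compact K" "K \<noteq> {}" and f: "usc_on K f"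
  shows "\<exists>x\<in>K. \<forall>y\<in>K. f y \<le> f x"
proof (rule ccontr)
  assume "\<not> ?thesis"
  then have "\<forall>x\<in>K. \<exists>y. y \<in> K \<and> f x < f y" by (auto simp: not_le)
  from bchoice[OF this] obtain g where g: "\<forall>x\<in>K. g x \<in> K \<and> f x < f (g x)" by blast
  have "\<forall>x\<in>K. \<exists>T. open T \<and> x \<in> T \<and> (\<forall>z\<in>T \<inter> K. f z < f (g x))"
  proof
    fix x assume x: "x \<in> K"
    then have "eventually (\<lambda>z. f z < f (g x)) (at x within K)" using f g unfolding usc_on_def by blast
    then obtain T where T: "open T" "x \<in> T" "\<forall>z\<in>T. z \<noteq> x \<longrightarrow> z \<in> K \<longrightarrow> f z < f (g x)"
      unfolding eventually_at_topological by blast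
    have "f z < f (g x)" if "z \<in> T \<inter> K" for z using that T(3) g x by (cases "z = x") auto
    then show "\<exists>T. open T \<and> x \<in> T \<and> (\<forall>z\<in>T \<inter> K. f z < f (g x))" using T by blast
  qed
  from bchoice[OF this] obtain T where T: "\<forall>x\<in>K. open (T x) \<and> x \<in> T x \<and> (\<forall>z\<in>T x \<inter> K. f z < f (g x))" by blast
  obtain C where C: "C \<subseteq> K" "finite C" "K \<subseteq> (\<Union>c\<in>C. T c)"
    using compactE_image[OF K(1), of K T] T by blast
  have "C \<noteq> {}" using C K by auto
  have fin: "finite ((\<lambda>x. f (g x)) ` C)" "(\<lambda>x. f (g x)) ` C \<noteq> {}" using C \<open>C \<noteq> {}\<close> by auto
  obtain c where c: "c \<in> C" "Max ((\<lambda>x. f (g x)) ` C) = f (g c)" using Max_in[OF fin] by auto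
  have "g c \<in> K" using c C g by blast
  then obtain c' where c': "c' \<in> C" "g c \<in> T c'" using C by blast
  then have "f (g c) < f (g c')" using T C \<open>g c \<in> K\<close> by blast
  moreover have "f (g c') \<le> f (g c)" using c(2) Max_ge[OF fin(1)] c'(1) by auto
  ultimately show False by simp
qed

lemma usc_on_add:
  assumes f: "usc_on K f" and g: "usc_on K g"
  shows "usc_on K (\<lambda>x. f x + g x)"
  unfolding usc_on_def
proof (intro ballI allI impI)
  fix z a assume z: "z \<in> K" and a: "f z + g z < a"
  define e where "e = (a - (f z + g z)) / 2"
  have e: "e > 0" using a by (simp add: e_def)
  have "eventually (\<lambda>x. f x < f z + e) (at z within K)" using f z e unfolding usc_on_def by (metis less_add_same_cancel1)
  moreover have "eventually (\<lambda>x. g x < g z + e) (at z within K)" using g z e unfolding usc_on_def by (metis less_add_same_cancel1)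
  ultimately show "eventually (\<lambda>x. f x + g x < a) (at z within K)"
  proof eventually_elim
    case (elim x)
    then have "f x + g x < (f z + g z) + 2 * e" by simp
    also have "\<dots> = a" by (simp add: e_def field_simps)
    finally show ?case .
  qed
qed

lemma usc_on_add_continuous:
  fixes f c :: "'a::topological_space \<Rightarrow> real"
  assumes f: "usc_on K f" and c: "continuous_on K c"
  shows "usc_on K (\<lambda>x. f x + c x)"
proof (rule usc_on_add[OF f])
  show "usc_on K c" using c unfolding usc_on_def continuous_on_def by (blast dest: order_tendstoD(2))
qed

lemma usc_on_compose:
  fixes h :: "'b::topological_space \<Rightarrow> 'a::topological_space"
  assumes f: "usc_on K f" and h: "continuous_on L h" and hL: "h ` L \<subseteq> K"
  shows "usc_on L (\<lambda>x. f (h x))"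
  unfolding usc_on_def
proof (intro ballI allI impI)
  fix x c assume x: "x \<in> L" and c: "f (h x) < c"
  then have "eventually (\<lambda>z. f z < c) (at (h x) within K)" using f hL unfolding usc_on_def by blast
  then obtain B where B: "open B" "h x \<in> B" "\<forall>z\<in>B. z \<noteq> h x \<longrightarrow> z \<in> K \<longrightarrow> f z < c"
    unfolding eventually_at_topological by blast
  obtain A where A: "open A" "x \<in> A" "\<forall>y\<in>L. y \<in> A \<longrightarrow> h y \<in> B"
    using h x B(1,2) unfolding continuous_on_topological by blast
  have "f (h y) < c" if "y \<in> A" "y \<in> L" for y
    using A(3) B(3) c hL that by (cases "h y = h x") auto
  then show "eventually (\<lambda>y. f (h y) < c) (at x within L)"
    unfolding eventually_at_topological using A(1,2) by blast
qed

lemma usc_on_subset: "usc_on S f \<Longrightarrow> K \<subseteq> S \<Longrightarrow> usc_on K f"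
  unfolding usc_on_def by (meson at_le filter_leD subsetD)

lemma supconv_argmax_exists:
  fixes u :: "'a::euclidean_space \<Rightarrow> real"
  assumes "compact K" "K \<noteq> {}" "usc_on K u"
  shows "\<exists>X. \<forall>\<xi>. X \<xi> \<in> K \<and> (\<forall>x\<in>K. u x - \<mu> / 2 * (norm (x - \<xi>))\<^sup>2 \<le> u (X \<xi>) - \<mu> / 2 * (norm (X \<xi> - \<xi>))\<^sup>2)"
proof -
  have "\<forall>\<xi>. \<exists>y. y \<in> K \<and> (\<forall>x\<in>K. u x - \<mu> / 2 * (norm (x - \<xi>))\<^sup>2 \<le> u y - \<mu> / 2 * (norm (y - \<xi>))\<^sup>2)"
  proof
    fix \<xi>
    have "usc_on K (\<lambda>x. u x + (- (\<mu> / 2 * (norm (x - \<xi>))\<^sup>2)))"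
      by (rule usc_on_add_continuous[OF assms(3)]) (intro continuous_intros)
    from usc_attains_max[OF assms(1,2) this]
    show "\<exists>y. y \<in> K \<and> (\<forall>x\<in>K. u x - \<mu> / 2 * (norm (x - \<xi>))\<^sup>2 \<le> u y - \<mu> / 2 * (norm (y - \<xi>))\<^sup>2)" by simp blast
  qed
  then show ?thesis by (rule choice)
qed

text \<open>The second-order superjet relative to \<open>K\<close>. The second-order part is a
  function \<open>q\<close> rather than a matrix, so that blocks of an operator on a product space
  can be inserted directly.\<close>

definition jet_above :: "('a::real_inner \<Rightarrow> real) \<Rightarrow> 'a set \<Rightarrow> 'a \<Rightarrow> 'a \<Rightarrow> ('a \<Rightarrow> real) \<Rightarrow> bool" where
  "jet_above u K x p q \<longleftrightarrow> (\<forall>e>0. \<exists>d>0. \<forall>k. norm k < d \<longrightarrow> x + k \<in> K \<longrightarrow>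
     u (x + k) \<le> u x + p \<bullet> k + q k / 2 + e * (norm k)\<^sup>2)"

text \<open>The maximiser for \<open>\<xi>\<close> competes for \<open>\<xi> + k\<close>. The
  sup-convolution is therefore touched from below at every point by a paraboloid of opening
  \<open>\<mu>\<close>: it is semiconvex.\<close>

lemma supconv_lower:
  fixes u :: "'a::euclidean_space \<Rightarrow> real"
  assumes X: "\<And>\<xi>. X \<xi> \<in> K" "\<And>\<xi> x. x \<in> K \<Longrightarrow> u x - \<mu> / 2 * (norm (x - \<xi>))\<^sup>2 \<le> u (X \<xi>) - \<mu> / 2 * (norm (X \<xi> - \<xi>))\<^sup>2"
    and \<mu>: "\<mu> > 0"
  defines "U \<equiv> \<lambda>\<xi>. u (X \<xi>) - \<mu> / 2 * (norm (X \<xi> - \<xi>))\<^sup>2"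
  shows "U \<xi> + (\<mu> *\<^sub>R (X \<xi> - \<xi>)) \<bullet> k - \<mu> / 2 * (norm k)\<^sup>2 \<le> U (\<xi> + k)"
proof -
  have "u (X \<xi>) - \<mu> / 2 * (norm (X \<xi> - (\<xi> + k)))\<^sup>2 \<le> U (\<xi> + k)" unfolding U_def by (rule X(2)[OF X(1)])
  moreover have "(norm (X \<xi> - (\<xi> + k)))\<^sup>2 = (norm (X \<xi> - \<xi>))\<^sup>2 - 2 * ((X \<xi> - \<xi>) \<bullet> k) + (norm k)\<^sup>2"
    using norm_diff_square[of "X \<xi> - \<xi>" k] by (simp add: diff_diff_eq)
  moreover have "(\<mu> *\<^sub>R (X \<xi> - \<xi>)) \<bullet> k = \<mu> * ((X \<xi> - \<xi>) \<bullet> k)" by simp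
  ultimately show ?thesis using \<mu> by (simp only: U_def) (simp add: field_simps)
qed

text \<open>The translation property of sup-convolutions: moving \<open>\<xi>\<close> and the
  competitor \<open>X \<xi>\<close> by the same \<open>k\<close> leaves the subtracted square
  unchanged, so an upper expansion of \<open>U\<close> at \<open>\<xi>\<close> is one of
  \<open>u\<close> at \<open>X \<xi>\<close>. The lower paraboloid at \<open>\<xi>\<close> has slope
  \<open>\<mu> (X \<xi> - \<xi>)\<close>, which must equal \<open>p\<close>.\<close>

lemma supconv_jet:
  fixes u :: "'a::euclidean_space \<Rightarrow> real"
  assumes X: "\<And>\<xi>. X \<xi> \<in> K" "\<And>\<xi> x. x \<in> K \<Longrightarrow> u x - \<mu> / 2 * (norm (x - \<xi>))\<^sup>2 \<le> u (X \<xi>) - \<mu> / 2 * (norm (X \<xi> - \<xi>))\<^sup>2"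
    and \<mu>: "\<mu> > 0"
  defines "U \<equiv> \<lambda>\<xi>. u (X \<xi>) - \<mu> / 2 * (norm (X \<xi> - \<xi>))\<^sup>2"
  assumes up: "\<And>e. e > 0 \<Longrightarrow> \<exists>d>0. \<forall>k. norm k < d \<longrightarrow> U (\<xi> + k) \<le> U \<xi> + p \<bullet> k + q k / 2 + e * (norm k)\<^sup>2"
    and q: "\<And>k. q k \<le> C * (norm k)\<^sup>2"
  shows "X \<xi> = \<xi> + p /\<^sub>R \<mu>" "jet_above u K (X \<xi>) p q"
proof -
  obtain d where d: "d > 0" "\<And>k. norm k < d \<Longrightarrow> U (\<xi> + k) \<le> U \<xi> + p \<bullet> k + q k / 2 + 1 * (norm k)\<^sup>2"
    using up[of 1] by auto
  have "\<mu> *\<^sub>R (X \<xi> - \<xi>) - p = 0"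
  proof (rule eq_zero_if_inner_le_square[OF d(1)])
    fix k :: 'a assume "norm k < d"
    from d(2)[OF this] supconv_lower[OF X \<mu>, of \<xi> k] q[of k]
    show "(\<mu> *\<^sub>R (X \<xi> - \<xi>) - p) \<bullet> k \<le> (C / 2 + 1 + \<mu> / 2) * (norm k)\<^sup>2"
      by (simp add: U_def inner_diff_left ring_distribs)
  qed
  then have "p = \<mu> *\<^sub>R (X \<xi> - \<xi>)" by simp
  then have "p /\<^sub>R \<mu> = (inverse \<mu> * \<mu>) *\<^sub>R (X \<xi> - \<xi>)" by (simp only: scaleR_scaleR)
  then have "p /\<^sub>R \<mu> = X \<xi> - \<xi>" using \<mu> by simp
  then show "X \<xi> = \<xi> + p /\<^sub>R \<mu>" by simp
  show "jet_above u K (X \<xi>) p q"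
    unfolding jet_above_def
  proof (intro allI impI)
    fix e :: real assume "e > 0"
    then obtain d where d: "d > 0" "\<And>k. norm k < d \<Longrightarrow> U (\<xi> + k) \<le> U \<xi> + p \<bullet> k + q k / 2 + e * (norm k)\<^sup>2"
      using up by metis
    show "\<exists>d>0. \<forall>k. norm k < d \<longrightarrow> X \<xi> + k \<in> K \<longrightarrow> u (X \<xi> + k) \<le> u (X \<xi>) + p \<bullet> k + q k / 2 + e * (norm k)\<^sup>2"
    proof (intro exI[of _ d] conjI allI impI d(1))
      fix k assume k: "norm k < d" "X \<xi> + k \<in> K"
      have "u (X \<xi> + k) - \<mu> / 2 * (norm ((X \<xi> + k) - (\<xi> + k)))\<^sup>2 \<le> U (\<xi> + k)"
        unfolding U_def by (rule X(2)[OF k(2)])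
      with d(2)[OF k(1)] show "u (X \<xi> + k) \<le> u (X \<xi>) + p \<bullet> k + q k / 2 + e * (norm k)\<^sup>2"
        by (simp add: U_def)
    qed
  qed
qed

text \<open>Both functions are replaced by sup-convolutions with the same \<open>\<mu>\<close>,
  whose sum \<open>g\<close> is semiconvex and lies below half the form of
  \<open>A + \<eta> A\<^sup>2\<close>. \<open>\<mu>\<close> is fixed before \<open>r\<close>, so the
  lower bound on \<open>L\<close> is uniform as \<open>r\<close> tends to 0; this yields compactness
  of the Hessians later.\<close>

theorem sums_quadratic:
  fixes u :: "'a::euclidean_space \<Rightarrow> real" and v :: "'b::euclidean_space \<Rightarrow> real"
    and A :: "'a \<times> 'b \<Rightarrow> 'a \<times> 'b"
  assumes K1: "compact K1" "0 \<in> K1" "usc_on K1 u" "u 0 = 0"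
    and K2: "compact K2" "0 \<in> K2" "usc_on K2 v" "v 0 = 0"
    and A: "symop A" and \<eta>: "\<eta> > 0"
    and le: "\<And>x y. x \<in> K1 \<Longrightarrow> y \<in> K2 \<Longrightarrow> u x + v y \<le> ((x, y) \<bullet> A (x, y)) / 2"
  shows "\<exists>\<mu>>0. \<forall>r>0. \<exists>x\<in>K1. \<exists>y\<in>K2. \<exists>p1 p2 L. norm x < r \<and> norm y < r \<and> norm p1 < r \<and> norm p2 < r \<and>
    - r < u x \<and> - r < v y \<and> linear L \<and>
    (\<forall>k. - \<mu> * (norm k)\<^sup>2 \<le> k \<bullet> L k) \<and>
    (\<forall>k. (fst k, 0) \<bullet> L (fst k, 0) + (0, snd k) \<bullet> L (0, snd k) \<le> k \<bullet> A k + \<eta> * (norm (A k))\<^sup>2 + r * (norm k)\<^sup>2) \<and>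
    jet_above u K1 x p1 (\<lambda>k. (k, 0) \<bullet> L (k, 0)) \<and> jet_above v K2 y p2 (\<lambda>k. (0, k) \<bullet> L (0, k))"
proof -
  have lA: "linear A" using A by (rule symop_linear)
  have sA: "x \<bullet> A y = y \<bullet> A x" for x y using A unfolding symop_def by blast
  obtain M where M: "M > 0" "\<And>k. \<bar>k \<bullet> A k\<bar> \<le> M * (norm k)\<^sup>2"
    using linear_form_bound[OF lA] by metis
  \<comment> \<open>The cross term obeys \<open>2 (A \<xi> \<bullet> k) \<le> \<eta> |A
    \<xi>|\<^sup>2 + |k|\<^sup>2 / \<eta>\<close>, and
    \<open>k \<bullet> A k \<le> M |k|\<^sup>2\<close>. After halving, the multiple of
    \<open>|k|\<^sup>2\<close> so produced is what the sup-convolutions subtract.\<close>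
  define \<mu> where "\<mu> = 1 / \<eta> + M"
  have \<mu>: "\<mu> > 0" using M \<eta> by (simp add: \<mu>_def add_pos_pos)
  obtain X where X': "\<forall>\<xi>. X \<xi> \<in> K1 \<and> (\<forall>x\<in>K1. u x - \<mu> / 2 * (norm (x - \<xi>))\<^sup>2 \<le> u (X \<xi>) - \<mu> / 2 * (norm (X \<xi> - \<xi>))\<^sup>2)"
    using supconv_argmax_exists[of K1 u \<mu>] K1 by blast
  obtain Y where Y': "\<forall>\<xi>. Y \<xi> \<in> K2 \<and> (\<forall>x\<in>K2. v x - \<mu> / 2 * (norm (x - \<xi>))\<^sup>2 \<le> v (Y \<xi>) - \<mu> / 2 * (norm (Y \<xi> - \<xi>))\<^sup>2)"
    using supconv_argmax_exists[of K2 v \<mu>] K2 by blast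
  have X: "X \<xi> \<in> K1" "x \<in> K1 \<Longrightarrow> u x - \<mu> / 2 * (norm (x - \<xi>))\<^sup>2 \<le> u (X \<xi>) - \<mu> / 2 * (norm (X \<xi> - \<xi>))\<^sup>2" for \<xi> x
    using X' by blast+
  have Y: "Y \<xi> \<in> K2" "x \<in> K2 \<Longrightarrow> v x - \<mu> / 2 * (norm (x - \<xi>))\<^sup>2 \<le> v (Y \<xi>) - \<mu> / 2 * (norm (Y \<xi> - \<xi>))\<^sup>2" for \<xi> x
    using Y' by blast+
  define U where "U = (\<lambda>\<xi>. u (X \<xi>) - \<mu> / 2 * (norm (X \<xi> - \<xi>))\<^sup>2)"
  define V where "V = (\<lambda>\<xi>. v (Y \<xi>) - \<mu> / 2 * (norm (Y \<xi> - \<xi>))\<^sup>2)"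
  define g where "g = (\<lambda>z. U (fst z) + V (snd z))"
  define B where "B = (\<lambda>z. A z + \<eta> *\<^sub>R A (A z))"
  have zB: "z \<bullet> B z = z \<bullet> A z + \<eta> * (norm (A z))\<^sup>2" for z
    using sA[of z "A z"] by (simp add: B_def inner_add_right power2_norm_eq_inner)
  have B: "symop B"
    unfolding symop_def
  proof (intro conjI allI)
    show "linear B" unfolding B_def
      by (intro linear_compose_add linear_compose_scale_right lA linear_compose[OF lA lA, unfolded o_def])
    show "x \<bullet> B y = y \<bullet> B x" for x y
      using sA[of x y] sA[of x "A y"] sA[of y "A x"] by (simp add: B_def inner_add_right inner_commute)
  qed
  have semi: "\<exists>p. \<forall>w. g x + p \<bullet> (w - x) - \<mu> / 2 * (norm (w - x))\<^sup>2 \<le> g w" for x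
  proof (intro exI allI)
    fix w :: "'a \<times> 'b"
    obtain x1 x2 where x: "x = (x1, x2)" by (cases x)
    obtain w1 w2 where w: "w = (w1, w2)" by (cases w)
    have "U x1 + (\<mu> *\<^sub>R (X x1 - x1)) \<bullet> (w1 - x1) - \<mu> / 2 * (norm (w1 - x1))\<^sup>2 \<le> U w1"
      using supconv_lower[OF X \<mu>, of x1 "w1 - x1"] unfolding U_def by simp
    moreover have "V x2 + (\<mu> *\<^sub>R (Y x2 - x2)) \<bullet> (w2 - x2) - \<mu> / 2 * (norm (w2 - x2))\<^sup>2 \<le> V w2"
      using supconv_lower[OF Y \<mu>, of x2 "w2 - x2"] unfolding V_def by simp
    moreover have "(norm (w - x))\<^sup>2 = (norm (w1 - x1))\<^sup>2 + (norm (w2 - x2))\<^sup>2"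
      by (simp add: x w norm_Pair)
    ultimately show "g x + (\<mu> *\<^sub>R (X (fst x) - fst x), \<mu> *\<^sub>R (Y (snd x) - snd x)) \<bullet> (w - x) - \<mu> / 2 * (norm (w - x))\<^sup>2 \<le> g w"
      by (simp add: x w g_def algebra_simps)
  qed
  have gB: "g \<xi> \<le> (\<xi> \<bullet> B \<xi>) / 2" for \<xi>
  proof -
    define z where "z = (X (fst \<xi>), Y (snd \<xi>))"
    define k where "k = z - \<xi>"
    have zk: "z = \<xi> + k" by (simp add: k_def)
    have "u (X (fst \<xi>)) + v (Y (snd \<xi>)) \<le> (z \<bullet> A z) / 2" unfolding z_def by (rule le) (use X Y in auto)
    also have "z \<bullet> A z = \<xi> \<bullet> A \<xi> + 2 * (A \<xi> \<bullet> k) + k \<bullet> A k" unfolding zk by (rule symop_expand[OF A])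
    also have "2 * (A \<xi> \<bullet> k) \<le> \<eta> * (norm (A \<xi>))\<^sup>2 + 1 / \<eta> * (norm k)\<^sup>2"
    proof -
      have "0 \<le> (norm (\<eta> *\<^sub>R A \<xi> - k))\<^sup>2" by simp
      also have "\<dots> = \<eta> * (\<eta> * (norm (A \<xi>))\<^sup>2) - \<eta> * (2 * (A \<xi> \<bullet> k)) + (norm k)\<^sup>2"
        using \<eta> unfolding norm_diff_square by (simp add: power_mult_distrib power2_eq_square)
      finally show ?thesis using \<eta> by (simp add: field_simps power2_eq_square)
    qed
    also have "k \<bullet> A k \<le> M * (norm k)\<^sup>2" using M(2)[of k] by linarith
    finally have "u (X (fst \<xi>)) + v (Y (snd \<xi>)) \<le> (\<xi> \<bullet> B \<xi>) / 2 + \<mu> / 2 * (norm k)\<^sup>2"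
      unfolding zB by (simp add: \<mu>_def field_simps)
    moreover have "(norm k)\<^sup>2 = (norm (X (fst \<xi>) - fst \<xi>))\<^sup>2 + (norm (Y (snd \<xi>) - snd \<xi>))\<^sup>2"
      by (cases \<xi>) (simp add: k_def z_def norm_Pair)
    ultimately show ?thesis by (simp add: g_def U_def V_def algebra_simps)
  qed
  have U0: "- (\<mu> / 2 * (norm \<xi>)\<^sup>2) \<le> U \<xi>" for \<xi> using X(2)[OF K1(2), of \<xi>] K1(4) by (simp add: U_def)
  have V0: "- (\<mu> / 2 * (norm \<xi>)\<^sup>2) \<le> V \<xi>" for \<xi> using Y(2)[OF K2(2), of \<xi>] K2(4) by (simp add: V_def)
  have g0: "0 \<le> g 0" using U0[of 0] V0[of 0] by (simp add: g_def)
  show ?thesis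
  proof (intro exI[of _ \<mu>] conjI allI impI \<mu>)
    fix r :: real assume r: "r > 0"
    \<comment> \<open>\<open>s D \<le> r\<close> brings both the displaced points
      \<open>\<xi> + p / \<mu>\<close> and the losses \<open>\<mu> / 2 |\<xi>|\<^sup>2\<close> in
      the values below \<open>r\<close>.\<close>
    define D where "D = 1 + 1 / \<mu> + \<mu>"
    have D: "D > 1" "D \<ge> 1 + 1 / \<mu>" "D \<ge> \<mu>" using \<mu> by (auto simp: D_def add_pos_pos)
    define s where "s = min 1 (r / D)"
    have s: "s > 0" "s \<le> 1" "s * D \<le> r" using r D by (auto simp: s_def min_def field_simps)
    obtain \<xi> p L where H: "norm \<xi> < s" "norm p < s" "expansion2 g \<xi> p L"
      "\<And>k. k \<bullet> L k \<le> k \<bullet> B k + r * (norm k)\<^sup>2"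
      by (rule semiconvex_max_expansion[OF semi less_imp_le[OF \<mu>] B gB g0 r s(1)]) blast
    obtain \<xi>1 \<xi>2 where \<xi>: "\<xi> = (\<xi>1, \<xi>2)" by (cases \<xi>)
    obtain p1 p2 where p: "p = (p1, p2)" by (cases p)
    have n: "norm \<xi>1 < s" "norm \<xi>2 < s" "norm p1 < s" "norm p2 < s"
      using H(1,2) norm_fst_le[of \<xi>1 \<xi>2] norm_snd_le[of \<xi>2 \<xi>1] norm_fst_le[of p1 p2] norm_snd_le[of p2 p1]
      by (auto simp: \<xi> p)
    have lL: "linear L" using H(3) by (simp add: expansion2_def)
    obtain C where C: "C > 0" "\<And>k. \<bar>k \<bullet> L k\<bar> \<le> C * (norm k)\<^sup>2" using linear_form_bound[OF lL] by metis
    have upU: "\<exists>d>0. \<forall>k. norm k < d \<longrightarrow> U (\<xi>1 + k) \<le> U \<xi>1 + p1 \<bullet> k + ((k, 0) \<bullet> L (k, 0)) / 2 + e * (norm k)\<^sup>2" if e: "e > 0" for e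
    proof -
      obtain d where d: "d > 0" "\<And>k. norm k < d \<Longrightarrow> \<bar>g (\<xi> + k) - g \<xi> - p \<bullet> k - (k \<bullet> L k) / 2\<bar> \<le> e * (norm k)\<^sup>2"
        using H(3) e unfolding expansion2_def by metis
      have "U (\<xi>1 + k) \<le> U \<xi>1 + p1 \<bullet> k + ((k, 0) \<bullet> L (k, 0)) / 2 + e * (norm k)\<^sup>2" if "norm k < d" for k
      proof -
        have "\<bar>g (\<xi> + (k, 0)) - g \<xi> - p \<bullet> (k, 0) - ((k, 0) \<bullet> L (k, 0)) / 2\<bar> \<le> e * (norm (k, 0::'b))\<^sup>2"
          by (rule d(2)) (use that in simp)
        then show ?thesis by (simp add: g_def \<xi> p del: inner_Pair) (simp add: inner_Pair[of p1 p2] del: inner_Pair)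
      qed
      with d(1) show ?thesis by blast
    qed
    have upV: "\<exists>d>0. \<forall>k. norm k < d \<longrightarrow> V (\<xi>2 + k) \<le> V \<xi>2 + p2 \<bullet> k + ((0, k) \<bullet> L (0, k)) / 2 + e * (norm k)\<^sup>2" if e: "e > 0" for e
    proof -
      obtain d where d: "d > 0" "\<And>k. norm k < d \<Longrightarrow> \<bar>g (\<xi> + k) - g \<xi> - p \<bullet> k - (k \<bullet> L k) / 2\<bar> \<le> e * (norm k)\<^sup>2"
        using H(3) e unfolding expansion2_def by metis
      have "V (\<xi>2 + k) \<le> V \<xi>2 + p2 \<bullet> k + ((0, k) \<bullet> L (0, k)) / 2 + e * (norm k)\<^sup>2" if "norm k < d" for k
      proof -
        have "\<bar>g (\<xi> + (0, k)) - g \<xi> - p \<bullet> (0, k) - ((0, k) \<bullet> L (0, k)) / 2\<bar> \<le> e * (norm (0::'a, k))\<^sup>2"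
          by (rule d(2)) (use that in simp)
        then show ?thesis by (simp add: g_def \<xi> p del: inner_Pair) (simp add: inner_Pair[of p1 p2] del: inner_Pair)
      qed
      with d(1) show ?thesis by blast
    qed
    have qU: "(k, 0) \<bullet> L (k, 0) \<le> C * (norm k)\<^sup>2" for k using C(2)[of "(k, 0)"] by simp
    have qV: "(0, k) \<bullet> L (0, k) \<le> C * (norm k)\<^sup>2" for k using C(2)[of "(0, k)"] by simp
    note JU' = supconv_jet[where X = X and K = K1 and u = u and \<mu> = \<mu> and \<xi> = \<xi>1 and p = p1 and C = C and q = "\<lambda>k. (k, 0) \<bullet> L (k, 0)", OF X \<mu> upU[unfolded U_def] qU]
    note JV' = supconv_jet[where X = Y and K = K2 and u = v and \<mu> = \<mu> and \<xi> = \<xi>2 and p = p2 and C = C and q = "\<lambda>k. (0, k) \<bullet> L (0, k)", OF Y \<mu> upV[unfolded V_def] qV]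
    have JU: "X \<xi>1 = \<xi>1 + p1 /\<^sub>R \<mu>" "jet_above u K1 (X \<xi>1) p1 (\<lambda>k. (k, 0) \<bullet> L (k, 0))"
      by (rule JU'(1), assumption+) (rule JU'(2), assumption+)
    have JV: "Y \<xi>2 = \<xi>2 + p2 /\<^sub>R \<mu>" "jet_above v K2 (Y \<xi>2) p2 (\<lambda>k. (0, k) \<bullet> L (0, k))"
      by (rule JV'(1), assumption+) (rule JV'(2), assumption+)
    have small: "a + b / \<mu> < r" if "a < s" "b < s" for a b
    proof -
      have "a + b / \<mu> < s + s / \<mu>" using that \<mu> by (intro add_strict_mono divide_strict_right_mono) auto
      also have "\<dots> = s * (1 + 1 / \<mu>)" by (simp add: field_simps)
      also have "\<dots> \<le> s * D" using s D by (intro mult_left_mono) auto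
      finally show ?thesis using s by simp
    qed
    have small2: "- r < - (\<mu> / 2 * a\<^sup>2)" if "a < s" "0 \<le> a" for a
    proof -
      have "a\<^sup>2 \<le> s\<^sup>2" using that by (intro power_mono) auto
      also have "\<dots> \<le> s" using s by (simp add: power2_eq_square mult_left_le_one_le)
      finally have "\<mu> / 2 * a\<^sup>2 \<le> \<mu> / 2 * s" using \<mu> by (intro mult_left_mono) auto
      also have "\<dots> < \<mu> * s" using \<mu> s by simp
      also have "\<dots> \<le> s * D" using mult_left_mono[OF D(3), of s] s by (simp add: mult.commute)
      finally show ?thesis using s by simp
    qed
    have sr: "s \<le> r" using mult_left_mono[of 1 D s, OF less_imp_le[OF D(1)] less_imp_le[OF s(1)]] s(3) by linarith
    show "\<exists>x\<in>K1. \<exists>y\<in>K2. \<exists>p1 p2 L. norm x < r \<and> norm y < r \<and> norm p1 < r \<and> norm p2 < r \<and>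
      - r < u x \<and> - r < v y \<and> linear L \<and>
      (\<forall>k. - \<mu> * (norm k)\<^sup>2 \<le> k \<bullet> L k) \<and>
    (\<forall>k. (fst k, 0) \<bullet> L (fst k, 0) + (0, snd k) \<bullet> L (0, snd k) \<le> k \<bullet> A k + \<eta> * (norm (A k))\<^sup>2 + r * (norm k)\<^sup>2) \<and>
      jet_above u K1 x p1 (\<lambda>k. (k, 0) \<bullet> L (k, 0)) \<and> jet_above v K2 y p2 (\<lambda>k. (0, k) \<bullet> L (0, k))"
    proof (intro bexI[of _ "X \<xi>1"] bexI[of _ "Y \<xi>2"] exI[of _ p1] exI[of _ p2] exI[of _ L] conjI X(1) Y(1) JU(2) JV(2) lL allI)
      have "norm (p1 /\<^sub>R \<mu>) = norm p1 / \<mu>" "norm (p2 /\<^sub>R \<mu>) = norm p2 / \<mu>" using \<mu> by (simp_all add: field_simps)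
      then show "norm (X \<xi>1) < r" "norm (Y \<xi>2) < r"
        using norm_triangle_ineq[of \<xi>1 "p1 /\<^sub>R \<mu>"] norm_triangle_ineq[of \<xi>2 "p2 /\<^sub>R \<mu>"]
          small[OF n(1,3)] small[OF n(2,4)] unfolding JU(1) JV(1) by linarith+
      show "norm p1 < r" "norm p2 < r" using n sr by auto
      have "U \<xi>1 \<le> u (X \<xi>1)" using \<mu> by (simp add: U_def)
      then show "- r < u (X \<xi>1)" using U0[of \<xi>1] small2[OF n(1) norm_ge_zero] by linarith
      have "V \<xi>2 \<le> v (Y \<xi>2)" using \<mu> by (simp add: V_def)
      then show "- r < v (Y \<xi>2)" using V0[of \<xi>2] small2[OF n(2) norm_ge_zero] by linarith
      fix k
      \<comment> \<open>The block diagonal part of \<open>L\<close>. As \<open>g\<close> is a sum of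
        functions of the separate variables, its second-order part has no mixed terms, so the form
        of \<open>D\<close> is bounded by that of \<open>L\<close>.\<close>
      define D where "D = (\<lambda>k. (fst (L (fst k, 0)), snd (L (0, snd k))))"
      have kD: "k \<bullet> D k = (fst k, 0) \<bullet> L (fst k, 0) + (0, snd k) \<bullet> L (0, snd k)" for k
        by (cases k, cases "L (fst k, 0)", cases "L (0, snd k)") (simp add: D_def)
      have "k \<bullet> D k \<le> k \<bullet> L k"
      proof (rule quadratic_le_if_small[OF _ lL])
        have lfst: "linear (\<lambda>k::'a \<times> 'b. (fst k, 0::'b))" and lsnd: "linear (\<lambda>k::'a \<times> 'b. (0::'a, snd k))"
          by (auto intro!: linearI)
        have "linear (\<lambda>k::'a \<times> 'b. L (fst k, 0))" "linear (\<lambda>k::'a \<times> 'b. L (0, snd k))"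
          using linear_compose[OF lfst lL] linear_compose[OF lsnd lL] by (simp_all add: o_def)
        note LL = linear_add[OF this(1)] linear_add[OF this(2)] linear_scale[OF this(1)] linear_scale[OF this(2)]
        show "linear D" unfolding D_def
          using LL by (intro linearI) simp_all
        fix e :: real assume e: "e > 0"
        obtain d where d: "d > 0" "\<And>k. norm k < d \<Longrightarrow> \<bar>g (\<xi> + k) - g \<xi> - p \<bullet> k - (k \<bullet> L k) / 2\<bar> \<le> e / 6 * (norm k)\<^sup>2"
          using H(3) e unfolding expansion2_def by (metis divide_pos_pos zero_less_numeral)
        have "k \<bullet> D k \<le> k \<bullet> L k + e * (norm k)\<^sup>2" if k: "norm k < d" for k
        proof -
          obtain k1 k2 where kk: "k = (k1, k2)" by (cases k)
          have nk: "norm (k1, 0::'b) \<le> norm k" "norm (0::'a, k2) \<le> norm k"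
            using norm_fst_le[of k1 k2] norm_snd_le[of k2 k1] by (simp_all add: kk)
          have e6: "e / 6 * (norm (k1, 0::'b))\<^sup>2 \<le> e / 6 * (norm k)\<^sup>2" "e / 6 * (norm (0::'a, k2))\<^sup>2 \<le> e / 6 * (norm k)\<^sup>2"
            using nk e by (auto intro!: mult_left_mono power_mono)
          have "\<bar>g (\<xi> + (k1, 0)) - g \<xi> - p \<bullet> (k1, 0) - ((k1, 0) \<bullet> L (k1, 0)) / 2\<bar> \<le> e / 6 * (norm k)\<^sup>2"
            using d(2)[of "(k1, 0)"] nk k e6 by linarith
          moreover have "\<bar>g (\<xi> + (0, k2)) - g \<xi> - p \<bullet> (0, k2) - ((0, k2) \<bullet> L (0, k2)) / 2\<bar> \<le> e / 6 * (norm k)\<^sup>2"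
            using d(2)[of "(0, k2)"] nk k e6 by linarith
          moreover have "g (\<xi> + k) - g \<xi> = (g (\<xi> + (k1, 0)) - g \<xi>) + (g (\<xi> + (0, k2)) - g \<xi>)"
            by (simp add: g_def kk \<xi>)
          moreover have "p \<bullet> k = p \<bullet> (k1, 0) + p \<bullet> (0, k2)" by (simp add: kk p)
          moreover have "k \<bullet> D k = (k1, 0) \<bullet> L (k1, 0) + (0, k2) \<bullet> L (0, k2)" unfolding kD by (simp add: kk)
          ultimately show ?thesis using d(2)[OF k] by (simp only: abs_le_iff) linarith
        qed
        with d(1) show "\<exists>d>0. \<forall>k. norm k < d \<longrightarrow> k \<bullet> D k \<le> k \<bullet> L k + e * (norm k)\<^sup>2" by blast
      qed
      then show "(fst k, 0) \<bullet> L (fst k, 0) + (0, snd k) \<bullet> L (0, snd k) \<le> k \<bullet> A k + \<eta> * (norm (A k))\<^sup>2 + r * (norm k)\<^sup>2"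
        using H(4)[of k] unfolding zB kD by linarith
      define N where "N = (\<lambda>k::'a \<times> 'b. - \<mu> *\<^sub>R k)"
      obtain p' where p': "\<And>w. g \<xi> + p' \<bullet> (w - \<xi>) - \<mu> / 2 * (norm (w - \<xi>))\<^sup>2 \<le> g w" using semi by blast
      obtain d0 where d0: "d0 > 0" "\<And>k. norm k < d0 \<Longrightarrow> \<bar>g (\<xi> + k) - g \<xi> - p \<bullet> k - (k \<bullet> L k) / 2\<bar> \<le> 1 * (norm k)\<^sup>2"
        using H(3) unfolding expansion2_def by (metis zero_less_one)
      \<comment> \<open>The slope of the lower paraboloid has to agree with that of the expansion
        before semiconvexity can bound the form of \<open>L\<close> from below by
        \<open>- \<mu>\<close>.\<close>
      have "p' - p = 0"
      proof (rule eq_zero_if_inner_le_square[OF d0(1)])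
        fix k :: "'a \<times> 'b" assume "norm k < d0"
        from d0(2)[OF this] p'[of "\<xi> + k"] C(2)[of k]
        show "(p' - p) \<bullet> k \<le> (\<mu> / 2 + C / 2 + 1) * (norm k)\<^sup>2"
          by (simp add: inner_diff_left ring_distribs abs_le_iff)
      qed
      then have pp: "p' = p" by simp
      have "k \<bullet> N k \<le> k \<bullet> L k"
      proof (rule quadratic_le_if_small[OF _ lL])
        show "linear N" unfolding N_def by (intro linear_compose_scale_right linear_ident)
        fix e :: real assume e: "e > 0"
        obtain d where d: "d > 0" "\<And>k. norm k < d \<Longrightarrow> \<bar>g (\<xi> + k) - g \<xi> - p \<bullet> k - (k \<bullet> L k) / 2\<bar> \<le> e / 2 * (norm k)\<^sup>2"
          using H(3) e unfolding expansion2_def by (metis half_gt_zero)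
        have "k \<bullet> N k \<le> k \<bullet> L k + e * (norm k)\<^sup>2" if "norm k < d" for k
        proof -
          have "g (\<xi> + k) - g \<xi> - p \<bullet> k - (k \<bullet> L k) / 2 \<le> e / 2 * (norm k)\<^sup>2" using d(2)[OF that] by linarith
          moreover have "g \<xi> + p \<bullet> k - \<mu> / 2 * (norm k)\<^sup>2 \<le> g (\<xi> + k)" using p'[of "\<xi> + k"] by (simp add: pp)
          moreover have "k \<bullet> N k = - \<mu> * (norm k)\<^sup>2" by (simp add: N_def power2_norm_eq_inner)
          ultimately show ?thesis by (simp add: field_simps)
        qed
        with d(1) show "\<exists>d>0. \<forall>k. norm k < d \<longrightarrow> k \<bullet> N k \<le> k \<bullet> L k + e * (norm k)\<^sup>2" by blast
      qed
      then show "- \<mu> * (norm k)\<^sup>2 \<le> k \<bullet> L k" by (simp add: N_def power2_norm_eq_inner)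
    qed
  qed
qed

section \<open>Viscosity inequalities at limit points\<close>

text \<open>The spatial block of \<open>Q\<close>. It is symmetrised because the operators supplied
  by the theorem on sums may fail to be symmetric, whereas the structural assumption speaks of
  symmetric matrices.\<close>

definition hess :: "(real \<times> (real^'n) \<Rightarrow> real \<times> (real^'n)) \<Rightarrow> real^'n^'n" where
  "hess Q = (\<chi> i j. ((0, axis i 1) \<bullet> Q (0, axis j 1) + (0, axis j 1) \<bullet> Q (0, axis i 1)) / 2)"

lemma sym_mat_hess: "sym_mat (hess Q)"
  by (simp add: sym_mat_def hess_def transpose_def vec_eq_iff add.commute)

lemma vec_expansion: "(h :: real^'n) = (\<Sum>i\<in>UNIV. (h $ i) *\<^sub>R axis i 1)"
  using basis_expansion[of h] by (simp add: scalar_mult_eq_scaleR)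

lemma bilinear_expansion:
  fixes h h' :: "real^'n" and Q :: "real \<times> (real^'n) \<Rightarrow> real \<times> (real^'n)"
  assumes Q: "linear Q"
  shows "(0, h) \<bullet> Q (0, h') = (\<Sum>i\<in>UNIV. \<Sum>j\<in>UNIV. h $ i * h' $ j * ((0, axis i 1) \<bullet> Q (0, axis j 1)))"
proof -
  have 0: "(0::real, h) = (\<Sum>i\<in>UNIV. (h $ i) *\<^sub>R (0, axis i 1))" for h :: "real^'n"
    using vec_expansion[of h] by (simp add: prod_eq_iff fst_sum snd_sum)
  have Qe: "Q (0, h') = (\<Sum>j\<in>UNIV. (h' $ j) *\<^sub>R Q (0, axis j 1))"
    by (subst 0[of h']) (simp only: linear_sum[OF Q] linear_scale[OF Q])
  show ?thesis
    unfolding Qe by (subst 0[of h], subst inner_sum_left)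
      (simp only: inner_sum_right inner_scaleR_left inner_scaleR_right sum_distrib_left mult.assoc mult.commute mult.left_commute)
qed

lemma inner_matrix_vector: "h \<bullet> ((M :: real^'n^'n) *v h') = (\<Sum>i\<in>UNIV. \<Sum>j\<in>UNIV. h $ i * h' $ j * M $ i $ j)"
  by (simp add: inner_vec_def matrix_vector_mult_def sum_distrib_left mult_ac)

lemma hess_form:
  assumes Q: "linear Q"
  shows "h \<bullet> (hess Q *v h') = ((0, h) \<bullet> Q (0, h') + (0, h') \<bullet> Q (0, h)) / 2"
proof -
  have "(0, h') \<bullet> Q (0, h) = (\<Sum>i\<in>UNIV. \<Sum>j\<in>UNIV. h $ i * h' $ j * ((0, axis j 1) \<bullet> Q (0, axis i 1)))"
    unfolding bilinear_expansion[OF Q, of h' h] by (subst sum.swap) (simp only: mult.commute mult.left_commute)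
  then show ?thesis
    unfolding inner_matrix_vector bilinear_expansion[OF Q, of h h']
    by (simp add: hess_def sum.distrib[symmetric] sum_divide_distrib distrib_left add_divide_distrib del: inner_Pair)
qed

lemma hess_quadratic_form:
  assumes Q: "linear Q"
  shows "h \<bullet> (hess Q *v h) = (0, h) \<bullet> Q (0, h)"
  using hess_form[OF Q, of h h] by simp

lemma matrix_snd_symop:
  fixes R :: "real \<times> (real^'n) \<Rightarrow> real \<times> (real^'n)"
  assumes R: "symop R"
  shows "snd (R (0, h)) = hess R *v h"
proof -
  have "h' \<bullet> snd (R (0, h)) = h' \<bullet> (hess R *v h)" for h'
  proof -
    have "(0, h') \<bullet> R (0, h) = (0, h) \<bullet> R (0, h')" using R unfolding symop_def by blast
    then have "h' \<bullet> (hess R *v h) = (0, h') \<bullet> R (0, h)"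
      using hess_form[OF symop_linear[OF R], of h' h] by simp
    then show ?thesis by (cases "R (0, h)") simp
  qed
  then show ?thesis by (metis vector_eq_ldot)
qed

text \<open>These quadratic polynomials in \<open>(t, x)\<close> serve as test functions in
  \<open>visc_sub_jet\<close>.\<close>

lemma C12_quadratic:
  fixes R :: "real \<times> (real^'n) \<Rightarrow> real \<times> (real^'n)" and z p :: "real \<times> (real^'n)" and c :: real
  assumes R: "symop R"
  defines "\<Phi> \<equiv> \<lambda>k. c + p \<bullet> k + (k \<bullet> R k) / 2"
  shows "C12 (\<lambda>s y. \<Phi> ((s, y) - z)) (\<lambda>s y. fst (p + R ((s, y) - z))) (\<lambda>s y. snd (p + R ((s, y) - z))) (\<lambda>s y. hess R)"
proof -
  have bR: "bounded_linear R" using symop_linear[OF R] by (simp add: linear_conv_bounded_linear)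
  have cR [continuous_intros]: "continuous_on S (\<lambda>x. R (g x))" if "continuous_on S g" for S and g :: "real \<times> (real^'n) \<Rightarrow> _"
    by (rule bounded_linear.continuous_on[OF bR that])
  have dR: "(R has_derivative R) F" for F by (rule bounded_linear_imp_has_derivative[OF bR])
  have d\<Phi>: "(\<Phi> has_derivative (\<lambda>h. (p + R k) \<bullet> h)) (at k)" for k
  proof -
    have "(\<Phi> has_derivative (\<lambda>h. p \<bullet> h + (k \<bullet> R h + h \<bullet> R k) / 2)) (at k)"
      unfolding \<Phi>_def by (auto intro!: derivative_eq_intros dR)
    moreover have "(\<lambda>h. p \<bullet> h + (k \<bullet> R h + h \<bullet> R k) / 2) = (\<lambda>h. (p + R k) \<bullet> h)"
    proof
      fix h
      have "k \<bullet> R h = h \<bullet> R k" using R unfolding symop_def by blast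
      then show "p \<bullet> h + (k \<bullet> R h + h \<bullet> R k) / 2 = (p + R k) \<bullet> h"
        by (simp add: inner_add_left inner_commute[of "R k" h])
    qed
    ultimately show ?thesis by (simp only:)
  qed
  show ?thesis
    unfolding C12_def
  proof (intro conjI allI)
    fix s :: real and y :: "real^'n"
    have "((\<lambda>s'. \<Phi> ((s', y) - z)) has_derivative (\<lambda>h. (p + R ((s, y) - z)) \<bullet> (h, 0))) (at s)"
      by (rule has_derivative_compose[OF _ d\<Phi>, where f = "\<lambda>s'. (s', y) - z" and f' = "\<lambda>h. (h, 0)"])
         (auto intro!: derivative_eq_intros simp: zero_prod_def)
    then show "((\<lambda>s'. \<Phi> ((s', y) - z)) has_real_derivative fst (p + R ((s, y) - z))) (at s)"
      unfolding has_field_derivative_def by (cases "p + R ((s, y) - z)") (simp add: mult.commute)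
    have "((\<lambda>y'. \<Phi> ((s, y') - z)) has_derivative (\<lambda>h. (p + R ((s, y) - z)) \<bullet> (0, h))) (at y)"
      by (rule has_derivative_compose[OF _ d\<Phi>, where f = "\<lambda>y'. (s, y') - z" and f' = "\<lambda>h. (0, h)"])
         (auto intro!: derivative_eq_intros simp: zero_prod_def)
    then show "((\<lambda>y'. \<Phi> ((s, y') - z)) has_derivative (\<lambda>h. snd (p + R ((s, y) - z)) \<bullet> h)) (at y)"
      by (cases "p + R ((s, y) - z)") simp
    have "((\<lambda>y'. R ((s, y') - z)) has_derivative (\<lambda>h. R (0, h))) (at y)"
      by (rule has_derivative_compose[OF _ dR, where f = "\<lambda>y'. (s, y') - z" and f' = "\<lambda>h. (0, h)"])
         (auto intro!: derivative_eq_intros simp: zero_prod_def)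
    from has_derivative_add[OF has_derivative_const[of p] this]
    have "((\<lambda>y'. p + R ((s, y') - z)) has_derivative (\<lambda>h. R (0, h))) (at y)" by simp
    then have "((\<lambda>y'. snd (p + R ((s, y') - z))) has_derivative (\<lambda>h. snd (R (0, h)))) (at y)"
      by (rule has_derivative_snd)
    then show "((\<lambda>y'. snd (p + R ((s, y') - z))) has_derivative (\<lambda>h. hess R *v h)) (at y)"
      by (simp only: matrix_snd_symop[OF R])
    show "continuous_on UNIV (\<lambda>(s, y). fst (p + R ((s, y) - z)))"
      unfolding case_prod_beta by (intro continuous_intros) 
    show "continuous_on UNIV (\<lambda>(s, y). snd (p + R ((s, y) - z)))"
      unfolding case_prod_beta by (intro continuous_intros)
    show "continuous_on UNIV (\<lambda>(s::real, y::real^'n). hess R)"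
      unfolding case_prod_beta by (intro continuous_intros)
  qed
qed

lemma symmetrize_exists:
  fixes Q :: "'a::euclidean_space \<Rightarrow> 'a"
  assumes Q: "linear Q"
  shows "\<exists>R. symop R \<and> (\<forall>k. k \<bullet> R k = k \<bullet> Q k) \<and> (\<forall>h k. h \<bullet> R k = (h \<bullet> Q k + k \<bullet> Q h) / 2)"
proof (intro exI conjI allI)
  let ?R = "\<lambda>k. (1/2) *\<^sub>R (Q k + adjoint Q k)"
  have adj: "h \<bullet> adjoint Q k = k \<bullet> Q h" for h k
    using adjoint_works[OF Q, of h k] by (simp add: inner_commute)
  have lR: "linear ?R" by (intro linear_compose_scale_right linear_compose_add Q adjoint_linear)
  show form: "h \<bullet> ?R k = (h \<bullet> Q k + k \<bullet> Q h) / 2" for h k by (simp add: adj inner_add_right)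
  show "k \<bullet> ?R k = k \<bullet> Q k" for k by (simp add: adj inner_add_right)
  show "symop ?R" unfolding symop_def using lR form by (auto simp: add.commute)
qed

lemma hess_add_scaleR:
  "hess (\<lambda>k. Q k + c *\<^sub>R k) = hess Q + c *\<^sub>R mat 1"
  by (auto simp: hess_def vec_eq_iff mat_def inner_add_right inner_axis_axis field_simps simp del: inner_Pair)
     (auto simp: inner_axis_axis)

lemma tendsto_H:
  fixes H :: "'a::t2_space \<Rightarrow> 'b::t2_space \<Rightarrow> 'c::t2_space \<Rightarrow> real"
  assumes H: "continuous_on UNIV (\<lambda>(x, p, X). H x p X)"
    and "(x \<longlongrightarrow> x0) F" "(p \<longlongrightarrow> p0) F" "(X \<longlongrightarrow> X0) F"
  shows "((\<lambda>i. H (x i) (p i) (X i)) \<longlongrightarrow> H x0 p0 X0) F"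
proof -
  have "isCont (\<lambda>(x, p, X). H x p X) (x0, p0, X0)" using H by (simp add: continuous_on_eq_continuous_at)
  from isCont_tendsto_compose[OF this tendsto_Pair[OF assms(2) tendsto_Pair[OF assms(3,4)]]] show ?thesis by simp
qed

text \<open>The error \<open>e |k|\<^sup>2\<close> of the jet is put into the quadratic test
  function, which then touches \<open>w\<close> from above and has spatial Hessian
  \<open>hess Q + 2 e I\<close>. Continuity of \<open>H\<close> removes \<open>e\<close>.\<close>

lemma visc_sub_jet:
  fixes H :: "real^'n \<Rightarrow> real^'n \<Rightarrow> real^'n^'n \<Rightarrow> real"
  assumes sub: "visc_sub \<rho> H w S" and z: "z \<in> S"
    and H: "continuous_on UNIV (\<lambda>(x, p, X). H x p X)" and Q: "linear Q"
    and jet: "jet_above (\<lambda>z. w (fst z) (snd z)) S z p (\<lambda>k. k \<bullet> Q k)"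
  shows "\<rho> * w (fst z) (snd z) - fst p + H (snd z) (snd p) (hess Q) \<le> 0"
proof -
  obtain R0 where R0: "symop R0" "\<And>k. k \<bullet> R0 k = k \<bullet> Q k" "\<And>h k. h \<bullet> R0 k = (h \<bullet> Q k + k \<bullet> Q h) / 2"
    using symmetrize_exists[OF Q] by blast
  have hR0: "hess R0 = hess Q" by (simp add: hess_def R0(3) add.commute vec_eq_iff del: inner_Pair)
  have step: "\<rho> * w (fst z) (snd z) - fst p + H (snd z) (snd p) (hess Q + (2 * e) *\<^sub>R mat 1) \<le> 0" if e: "e > 0" for e
  proof -
    define R where "R = (\<lambda>k. R0 k + (2 * e) *\<^sub>R k)"
    have R: "symop R"
      using R0(1) unfolding symop_def R_def
      by (auto intro!: linear_compose_add linear_compose_scale_right linear_ident simp: inner_add_right inner_commute)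
    have Rk: "k \<bullet> R k = k \<bullet> Q k + 2 * e * (norm k)\<^sup>2" for k
      by (simp add: R_def inner_add_right R0(2) power2_norm_eq_inner)
    have R00: "R 0 = 0" using symop_linear[OF R] by (rule linear_0)
    have hR: "hess R = hess Q + (2 * e) *\<^sub>R mat 1" unfolding R_def hess_add_scaleR hR0 ..
    obtain d where d: "d > 0" "\<And>k. norm k < d \<Longrightarrow> z + k \<in> S \<Longrightarrow>
        w (fst (z + k)) (snd (z + k)) \<le> w (fst z) (snd z) + p \<bullet> k + (k \<bullet> Q k) / 2 + e * (norm k)\<^sup>2"
      using jet e unfolding jet_above_def by blast
    define \<phi> where "\<phi> = (\<lambda>s y. w (fst z) (snd z) + p \<bullet> ((s, y) - z) + (((s, y) - z) \<bullet> R ((s, y) - z)) / 2)"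
    have C: "C12 \<phi> (\<lambda>s y. fst (p + R ((s, y) - z))) (\<lambda>s y. snd (p + R ((s, y) - z))) (\<lambda>s y. hess R)"
      unfolding \<phi>_def by (rule C12_quadratic[OF R])
    have "loc_max_rel (\<lambda>s y. w s y - \<phi> s y) S (fst z) (snd z)"
      unfolding loc_max_rel_def
    proof (intro exI[of _ d] conjI d(1) ballI)
      fix a assume a: "a \<in> S"
      obtain s y where sy: "a = (s, y)" by (cases a)
      have "w s y - \<phi> s y \<le> w (fst z) (snd z) - \<phi> (fst z) (snd z)" if "dist (s, y) (fst z, snd z) < d"
      proof -
        have "norm ((s, y) - z) < d" using that by (simp add: dist_norm)
        from d(2)[OF this] a sy show ?thesis unfolding \<phi>_def Rk by (simp add: R00 add_divide_distrib)
      qed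
      then show "case a of (s, y) \<Rightarrow> dist (s, y) (fst z, snd z) < d \<longrightarrow> w s y - \<phi> s y \<le> w (fst z) (snd z) - \<phi> (fst z) (snd z)"
        by (simp add: sy)
    qed
    then have "\<rho> * w (fst z) (snd z) - fst (p + R ((fst z, snd z) - z)) + H (snd z) (snd (p + R ((fst z, snd z) - z))) (hess R) \<le> 0"
      using sub[unfolded visc_sub_def, rule_format, OF _ C, of "fst z" "snd z"] z by simp
    then show ?thesis by (simp add: R00 hR)
  qed
  have lim: "((\<lambda>e. \<rho> * w (fst z) (snd z) - fst p + H (snd z) (snd p) (hess Q + (2 * e) *\<^sub>R mat 1)) \<longlongrightarrow>
      \<rho> * w (fst z) (snd z) - fst p + H (snd z) (snd p) (hess Q + (2 * 0) *\<^sub>R mat 1)) (at_right 0)"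
    by (intro tendsto_intros tendsto_H[OF H])
  have "eventually (\<lambda>e. \<rho> * w (fst z) (snd z) - fst p + H (snd z) (snd p) (hess Q + (2 * e) *\<^sub>R mat 1) \<le> 0) (at_right 0)"
    using step by (auto simp: eventually_at_right_less intro: eventually_mono[OF eventually_at_right_less])
  from tendsto_upperbound[OF lim this] show ?thesis by simp
qed

lemma uminus_matrix_vector_mult: "(- M) *v h = - (M *v h)" for M :: "real^'n^'m"
  by (simp add: vec_eq_iff matrix_vector_mult_def sum_negf)

text \<open>Reflection reduces the supersolution side of the theorem on sums to
  \<open>visc_sub_jet\<close>.\<close>

lemma visc_sub_minus:
  fixes H :: "real^'n \<Rightarrow> real^'n \<Rightarrow> real^'n^'n \<Rightarrow> real"
  assumes "visc_super \<rho> H w S"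
  shows "visc_sub \<rho> (\<lambda>x p X. - H x (- p) (- X)) (\<lambda>s y. - w s y) S"
  unfolding visc_sub_def
proof (intro allI impI)
  fix t x \<phi> \<phi>t D\<phi> D2\<phi>
  assume tx: "(t, x) \<in> S" and C: "C12 \<phi> \<phi>t D\<phi> D2\<phi>" and l: "loc_max_rel (\<lambda>s y. - w s y - \<phi> s y) S t x"
  have "C12 (\<lambda>s y. - \<phi> s y) (\<lambda>s y. - \<phi>t s y) (\<lambda>s y. - D\<phi> s y) (\<lambda>s y. - D2\<phi> s y)"
    using C unfolding C12_def case_prod_beta
    by (auto intro!: derivative_eq_intros continuous_intros simp: uminus_matrix_vector_mult)
  moreover have "loc_min_rel (\<lambda>s y. w s y - (- \<phi> s y)) S t x"
    using l unfolding loc_max_rel_def loc_min_rel_def by (fastforce simp: case_prod_beta)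
  ultimately have "\<rho> * w t x - (- \<phi>t t x) + H x (- D\<phi> t x) (- D2\<phi> t x) \<ge> 0"
    using assms[unfolded visc_super_def, rule_format, OF tx] by blast
  then show "\<rho> * (- w t x) - \<phi>t t x + - H x (- D\<phi> t x) (- D2\<phi> t x) \<le> 0" by simp
qed

text \<open>Polarisation: the entry \<open>(i, j)\<close> is read off from the form at
  \<open>axis i 1 + axis j 1\<close>, whose square norm is at most 4. The bound later confines the
  matrices to a compact ball.\<close>

lemma norm_sym_mat_le:
  fixes X :: "real^'n^'n"
  assumes X: "sym_mat X" and b: "\<And>h. \<bar>h \<bullet> (X *v h)\<bar> \<le> C * (norm h)\<^sup>2"
  shows "norm X \<le> real (DIM(real^'n^'n)) * (3 * C)"
proof -
  have "0 \<le> C * (norm (axis undefined 1 :: real^'n))\<^sup>2" by (rule order_trans[OF abs_ge_zero b])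
  then have C: "C \<ge> 0" by simp
  have e: "X $ i $ j = axis i 1 \<bullet> (X *v axis j 1)" for i j
    by (simp add: inner_axis' matrix_vector_mult_basis column_def)
  have s: "X $ i $ j = X $ j $ i" for i j
    using X unfolding sym_mat_def transpose_def by (metis vec_lambda_beta)
  have ent: "\<bar>X $ i $ j\<bar> \<le> 3 * C" for i j
  proof -
    let ?a = "axis i (1::real) :: real^'n" and ?b = "axis j (1::real) :: real^'n"
    have "(?a + ?b) \<bullet> (X *v (?a + ?b)) = ?a \<bullet> (X *v ?a) + ?b \<bullet> (X *v ?b) + 2 * X $ i $ j"
      using e[of i j] e[of j i] s[of i j] by (simp add: matrix_vector_right_distrib inner_add_left inner_add_right)
    moreover have "\<bar>?a \<bullet> (X *v ?a)\<bar> \<le> C" "\<bar>?b \<bullet> (X *v ?b)\<bar> \<le> C" using b[of ?a] b[of ?b] by simp_all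
    moreover have "\<bar>(?a + ?b) \<bullet> (X *v (?a + ?b))\<bar> \<le> 4 * C"
    proof -
      have "norm (?a + ?b) \<le> 2" using norm_triangle_ineq[of ?a ?b] by simp
      then have "(norm (?a + ?b))\<^sup>2 \<le> 2\<^sup>2" by (intro power_mono) auto
      then have "C * (norm (?a + ?b))\<^sup>2 \<le> C * 4" using C by (intro mult_left_mono) auto
      then show ?thesis using b[of "?a + ?b"] by simp
    qed
    ultimately show ?thesis by linarith
  qed
  have "norm X \<le> (\<Sum>b\<in>Basis. \<bar>X \<bullet> b\<bar>)" by (rule norm_le_l1)
  also have "\<dots> \<le> (\<Sum>b\<in>(Basis :: (real^'n^'n) set). 3 * C)"
  proof (rule sum_mono)
    fix B :: "real^'n^'n" assume "B \<in> Basis"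
    then obtain i b where "B = axis i b" "b \<in> Basis" by (auto simp: Basis_vec_def)
    moreover obtain j where "b = axis j 1" using \<open>b \<in> Basis\<close> by (auto simp: Basis_vec_def)
    ultimately have "X \<bullet> B = X $ i $ j" by (simp add: inner_axis)
    then show "\<bar>X \<bullet> B\<bar> \<le> 3 * C" using ent by simp
  qed
  finally show ?thesis by simp
qed


lemma usc_on_translate:
  fixes f :: "'a::real_normed_vector \<Rightarrow> real"
  assumes "usc_on S f"
  shows "usc_on {k. z + k \<in> S} (\<lambda>k. f (z + k))"
  by (rule usc_on_compose[OF assms]) (auto intro!: continuous_intros)

lemma usc_on_minus_if_lsc_on: "lsc_on S f \<Longrightarrow> usc_on S (\<lambda>x. - f x)"
  unfolding lsc_on_def usc_on_def by (auto simp: minus_less_iff)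

lemma jet_above_translate:
  assumes jet: "jet_above (\<lambda>k. f (z + k) - c - a \<bullet> k) {k \<in> cball 0 r0. z + k \<in> S} x p q"
    and x: "norm x < r0"
  shows "jet_above f S (z + x) (a + p) q"
  unfolding jet_above_def
proof (intro allI impI)
  fix e :: real assume "e > 0"
  then obtain d where d: "d > 0" "\<And>k. norm k < d \<Longrightarrow> x + k \<in> {k \<in> cball 0 r0. z + k \<in> S} \<Longrightarrow>
      f (z + (x + k)) - c - a \<bullet> (x + k) \<le> f (z + x) - c - a \<bullet> x + p \<bullet> k + q k / 2 + e * (norm k)\<^sup>2"
    using jet unfolding jet_above_def by blast
  show "\<exists>d>0. \<forall>k. norm k < d \<longrightarrow> z + x + k \<in> S \<longrightarrow>
      f (z + x + k) \<le> f (z + x) + (a + p) \<bullet> k + q k / 2 + e * (norm k)\<^sup>2"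
  proof (intro exI[of _ "min d (r0 - norm x)"] conjI allI impI)
    show "min d (r0 - norm x) > 0" using d x by simp
    fix k assume k: "norm k < min d (r0 - norm x)" "z + x + k \<in> S"
    have "norm (x + k) \<le> r0" using norm_triangle_ineq[of x k] k by simp
    then have "f (z + (x + k)) - c - a \<bullet> (x + k) \<le> f (z + x) - c - a \<bullet> x + p \<bullet> k + q k / 2 + e * (norm k)\<^sup>2"
      using k by (intro d(2)) (auto simp: add.assoc)
    then show "f (z + x + k) \<le> f (z + x) + (a + p) \<bullet> k + q k / 2 + e * (norm k)\<^sup>2"
      by (simp add: inner_add_left inner_add_right add.assoc)
  qed
qed

lemma sym_mat_iff: "sym_mat X \<longleftrightarrow> (\<forall>i j. X $ i $ j = X $ j $ i)"
  by (auto simp: sym_mat_def transpose_def vec_eq_iff)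

text \<open>The expansions are taken at points approaching \<open>z1\<close> and \<open>z2\<close>; the matrices stay bounded,
  and a limit point satisfies the block inequality without error term.\<close>

theorem parabolic_sums:
  fixes w1 w2 :: "real \<Rightarrow> real^'n \<Rightarrow> real" and H :: "real^'n \<Rightarrow> real^'n \<Rightarrow> real^'n^'n \<Rightarrow> real"
    and A :: "(real \<times> (real^'n)) \<times> (real \<times> (real^'n)) \<Rightarrow> (real \<times> (real^'n)) \<times> (real \<times> (real^'n))"
  defines "W1 \<equiv> \<lambda>z. w1 (fst z) (snd z)" and "W2 \<equiv> \<lambda>z. w2 (fst z) (snd z)"
  assumes sub: "visc_sub \<rho> H w1 S1" and super: "visc_super \<rho> H w2 S2" and \<rho>: "\<rho> > 0"
    and H: "continuous_on UNIV (\<lambda>(x, p, X). H x p X)"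
    and z: "z1 \<in> S1" "z2 \<in> S2" and r0: "r0 > 0"
    and cpt: "compact (S1 \<inter> cball z1 r0)" "compact (S2 \<inter> cball z2 r0)"
    and usc: "usc_on S1 W1" and lsc: "lsc_on S2 W2" and A: "symop A"
    and max: "\<And>k1 k2. norm k1 \<le> r0 \<Longrightarrow> norm k2 \<le> r0 \<Longrightarrow> z1 + k1 \<in> S1 \<Longrightarrow> z2 + k2 \<in> S2 \<Longrightarrow>
      W1 (z1 + k1) - W2 (z2 + k2) \<le> W1 z1 - W2 z2 + a1 \<bullet> k1 + a2 \<bullet> k2 + ((k1, k2) \<bullet> A (k1, k2)) / 2"
    and \<eta>: "\<eta> > 0"
  shows "\<exists>X Y. sym_mat X \<and> sym_mat Y \<and>
    \<rho> * W1 z1 - fst a1 + H (snd z1) (snd a1) X \<le> 0 \<and>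
    0 \<le> \<rho> * W2 z2 + fst a2 + H (snd z2) (- snd a2) Y \<and>
    (\<forall>h1 h2. h1 \<bullet> (X *v h1) - h2 \<bullet> (Y *v h2) \<le>
      ((0, h1), (0, h2)) \<bullet> A ((0, h1), (0, h2)) + \<eta> * (norm (A ((0, h1), (0, h2))))\<^sup>2)"
proof -
  have cK: "compact {k \<in> cball 0 r0. z + k \<in> S}" if "compact (S \<inter> cball z r0)" for S and z :: "real \<times> (real^'n)"
  proof -
    have "{k \<in> cball 0 r0. z + k \<in> S} = (+) (- z) ` (S \<inter> cball z r0)"
    proof (rule set_eqI)
      fix k show "k \<in> {k \<in> cball 0 r0. z + k \<in> S} \<longleftrightarrow> k \<in> (+) (- z) ` (S \<inter> cball z r0)"
        by (auto simp: image_iff dist_norm norm_minus_commute intro!: bexI[of _ "z + k"])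
    qed
    then show ?thesis using compact_translation[OF that, of "- z"] by simp
  qed
  define K1 where "K1 = {k \<in> cball 0 r0. z1 + k \<in> S1}"
  define K2 where "K2 = {k \<in> cball 0 r0. z2 + k \<in> S2}"
  \<comment> \<open>Recentring at \<open>z1\<close> and \<open>z2\<close> and removing the slopes
    \<open>a1\<close>, \<open>a2\<close> leaves a purely quadratic majorant with contact at 0, as
    \<open>sums_quadratic\<close> requires.\<close>
  define u where "u = (\<lambda>k. W1 (z1 + k) - W1 z1 - a1 \<bullet> k)"
  define v where "v = (\<lambda>k. - W2 (z2 + k) - (- W2 z2) - a2 \<bullet> k)"
  have K1: "compact K1" "0 \<in> K1" "u 0 = 0" unfolding K1_def u_def using cK cpt z r0 by auto
  have K2: "compact K2" "0 \<in> K2" "v 0 = 0" unfolding K2_def v_def using cK cpt z r0 by auto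
  have uK: "usc_on K1 u"
  proof -
    have "usc_on K1 (\<lambda>k. W1 (z1 + k))" by (rule usc_on_subset[OF usc_on_translate[OF usc]]) (auto simp: K1_def)
    from usc_on_add_continuous[OF this, of "\<lambda>k. - W1 z1 - a1 \<bullet> k"] show ?thesis
      by (simp add: u_def continuous_intros algebra_simps)
  qed
  have vK: "usc_on K2 v"
  proof -
    have "usc_on K2 (\<lambda>k. - W2 (z2 + k))"
      by (rule usc_on_subset[OF usc_on_translate[OF usc_on_minus_if_lsc_on[OF lsc]]]) (auto simp: K2_def)
    from usc_on_add_continuous[OF this, of "\<lambda>k. W2 z2 - a2 \<bullet> k"] show ?thesis
      by (simp add: v_def continuous_intros algebra_simps)
  qed
  have uv: "u x + v y \<le> ((x, y) \<bullet> A (x, y)) / 2" if "x \<in> K1" "y \<in> K2" for x y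
    using max[of x y] that by (simp add: K1_def K2_def u_def v_def del: inner_Pair)
  obtain \<mu> where \<mu>: "\<mu> > 0" and S: "\<forall>r>0. \<exists>x\<in>K1. \<exists>y\<in>K2. \<exists>p1 p2 L. norm x < r \<and> norm y < r \<and> norm p1 < r \<and> norm p2 < r \<and>
    - r < u x \<and> - r < v y \<and> linear L \<and> (\<forall>k. - \<mu> * (norm k)\<^sup>2 \<le> k \<bullet> L k) \<and>
    (\<forall>k. (fst k, 0) \<bullet> L (fst k, 0) + (0, snd k) \<bullet> L (0, snd k) \<le> k \<bullet> A k + \<eta> * (norm (A k))\<^sup>2 + r * (norm k)\<^sup>2) \<and>
    jet_above u K1 x p1 (\<lambda>k. (k, 0) \<bullet> L (k, 0)) \<and> jet_above v K2 y p2 (\<lambda>k. (0, k) \<bullet> L (0, k))"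
    using sums_quadratic[OF K1(1,2) uK K1(3) K2(1,2) vK K2(3) A \<eta> uv] by blast
  obtain M where M: "M > 0" "\<And>k. norm (A k) \<le> M * norm k" "\<And>k. \<bar>k \<bullet> A k\<bar> \<le> M * (norm k)\<^sup>2"
    using linear_form_bound[OF symop_linear[OF A]] by metis
  \<comment> \<open>One constant for the forms of both spatial blocks: \<open>\<mu>\<close> bounds
    them from below, \<open>A + \<eta> A\<^sup>2 + r\<close> from above, for all
    \<open>r \<le> r0\<close> at once.\<close>
  define C where "C = max \<mu> (M + \<eta> * M\<^sup>2 + r0)"
  define B where "B = real (DIM(real^'n^'n)) * (3 * C)"
  define q where "q = (\<lambda>h1 h2. ((0, h1), (0, h2)) \<bullet> A ((0, h1), (0, h2)) + \<eta> * (norm (A ((0, h1), (0, h2))))\<^sup>2)"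
  \<comment> \<open>Collects what passes to the limit. The values of \<open>w1\<close> and
    \<open>- w2\<close> at the nearby points are replaced by lower bounds, taken from
    \<open>- r < u x\<close> and \<open>- r < v y\<close>, because semicontinuity alone bounds them
    only from above.\<close>
  define F where "F = (\<lambda>r x y p1 p2 X Y. norm x \<le> r \<and> norm y \<le> r \<and> norm p1 \<le> r \<and> norm p2 \<le> r \<and>
    sym_mat X \<and> sym_mat Y \<and> X \<in> cball 0 B \<and> Y \<in> cball 0 B \<and>
    \<rho> * (W1 z1 + a1 \<bullet> x - r) - fst (a1 + p1) + H (snd (z1 + x)) (snd (a1 + p1)) X \<le> 0 \<and>
    \<rho> * (- W2 z2 + a2 \<bullet> y - r) - fst (a2 + p2) - H (snd (z2 + y)) (- snd (a2 + p2)) Y \<le> 0 \<and>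
    (\<forall>h1 h2. h1 \<bullet> (X *v h1) - h2 \<bullet> (Y *v h2) \<le> q h1 h2 + r * (norm ((0::real, h1), (0::real, h2)))\<^sup>2))"
  have ex: "\<exists>x y p1 p2 X Y. F r x y p1 p2 X Y" if r: "0 < r" "r \<le> r0" for r
  proof -
    obtain x y p1 p2 L where xy: "x \<in> K1" "y \<in> K2" and n: "norm x < r" "norm y < r" "norm p1 < r" "norm p2 < r"
      and val: "- r < u x" "- r < v y" and L: "linear L" and lo: "\<forall>k. - \<mu> * (norm k)\<^sup>2 \<le> k \<bullet> L k"
      and up: "\<forall>k. (fst k, 0) \<bullet> L (fst k, 0) + (0, snd k) \<bullet> L (0, snd k) \<le> k \<bullet> A k + \<eta> * (norm (A k))\<^sup>2 + r * (norm k)\<^sup>2"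
      and j1: "jet_above u K1 x p1 (\<lambda>k. (k, 0) \<bullet> L (k, 0))" and j2: "jet_above v K2 y p2 (\<lambda>k. (0, k) \<bullet> L (0, k))"
      using S[rule_format, OF r(1)] by blast
    define Q1 where "Q1 = (\<lambda>k. fst (L (k, 0)))"
    define Q2 where "Q2 = (\<lambda>k. snd (L (0, k)))"
    have i1: "(k, 0) \<bullet> L (k, 0) = k \<bullet> Q1 k" for k by (cases "L (k, 0)") (simp add: Q1_def)
    have i2: "(0, k) \<bullet> L (0, k) = k \<bullet> Q2 k" for k by (cases "L (0, k)") (simp add: Q2_def)
    have lp: "linear (\<lambda>k::real \<times> (real^'n). (k, 0::real \<times> (real^'n)))" "linear (\<lambda>k::real \<times> (real^'n). (0::real \<times> (real^'n), k))"
      by (auto intro!: linearI)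
    have "linear (\<lambda>k. L (k, 0))" "linear (\<lambda>k. L (0, k))"
      using linear_compose[OF lp(1) L] linear_compose[OF lp(2) L] by (simp_all add: o_def)
    note LL = linear_add[OF this(1)] linear_add[OF this(2)] linear_scale[OF this(1)] linear_scale[OF this(2)]
    have Q1: "linear Q1" and Q2: "linear Q2" unfolding Q1_def Q2_def by (intro linearI; simp only: LL fst_add snd_add fst_scaleR snd_scaleR)+
    \<comment> \<open>The second Hessian changes sign because \<open>v\<close> is built from
      \<open>- W2\<close>.\<close>
    let ?X = "hess Q1" and ?Y = "- hess Q2"
    have Xf: "h \<bullet> (hess Q1 *v h) = ((0, h), 0) \<bullet> L ((0, h), 0)" for h
      unfolding hess_quadratic_form[OF Q1] i1 ..
    have Yf: "h \<bullet> (hess Q2 *v h) = (0, (0, h)) \<bullet> L (0, (0, h))" for h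
      unfolding hess_quadratic_form[OF Q2] i2 ..
    have block: "((0, h1), 0) \<bullet> L ((0, h1), 0) + (0, (0, h2)) \<bullet> L (0, (0, h2)) \<le> q h1 h2 + r * (norm ((0::real, h1), (0::real, h2)))\<^sup>2" for h1 h2
      using up[rule_format, of "((0, h1), (0, h2))"] by (simp add: q_def del: inner_Pair)
    have qb: "q h1 h2 + r * (norm ((0::real, h1), (0::real, h2)))\<^sup>2 \<le> C * (norm ((0::real, h1), (0::real, h2)))\<^sup>2" for h1 h2
    proof -
      let ?k = "((0::real, h1), (0::real, h2))"
      have "(norm (A ?k))\<^sup>2 \<le> (M * norm ?k)\<^sup>2" using M(2)[of ?k] by (intro power_mono) auto
      then have "\<eta> * (norm (A ?k))\<^sup>2 \<le> \<eta> * (M\<^sup>2 * (norm ?k)\<^sup>2)" using \<eta> by (intro mult_left_mono) (auto simp: power_mult_distrib)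
      moreover have "?k \<bullet> A ?k \<le> M * (norm ?k)\<^sup>2" using M(3)[of ?k] by linarith
      moreover have "r * (norm ?k)\<^sup>2 \<le> r0 * (norm ?k)\<^sup>2" using r by (intro mult_right_mono) auto
      moreover have "(M + \<eta> * M\<^sup>2 + r0) * (norm ?k)\<^sup>2 \<le> C * (norm ?k)\<^sup>2" by (intro mult_right_mono) (auto simp: C_def)
      ultimately show ?thesis unfolding q_def by (simp add: ring_distribs mult.assoc del: inner_Pair)
    qed
    have \<mu>C: "\<mu> * s \<le> C * s" if "s \<ge> 0" for s using that by (intro mult_right_mono) (auto simp: C_def)
    have L0: "L 0 = 0" using L by (rule linear_0)
    have "norm (hess Q1) \<le> B" unfolding B_def
    proof (rule norm_sym_mat_le[OF sym_mat_hess])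
      fix h
      have "h \<bullet> (hess Q1 *v h) \<le> C * (norm h)\<^sup>2"
        using block[of h 0] qb[of h 0] L0 unfolding Xf by (simp add: zero_prod_def[symmetric] del: inner_Pair)
      moreover have "- (C * (norm h)\<^sup>2) \<le> h \<bullet> (hess Q1 *v h)"
        using lo[rule_format, of "((0, h), 0)"] \<mu>C[of "(norm h)\<^sup>2"] unfolding Xf by (simp del: inner_Pair)
      ultimately show "\<bar>h \<bullet> (hess Q1 *v h)\<bar> \<le> C * (norm h)\<^sup>2" by linarith
    qed
    moreover have "norm (hess Q2) \<le> B" unfolding B_def
    proof (rule norm_sym_mat_le[OF sym_mat_hess])
      fix h
      have "h \<bullet> (hess Q2 *v h) \<le> C * (norm h)\<^sup>2"
        using block[of 0 h] qb[of 0 h] L0 unfolding Yf by (simp add: zero_prod_def[symmetric] del: inner_Pair)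
      moreover have "- (C * (norm h)\<^sup>2) \<le> h \<bullet> (hess Q2 *v h)"
        using lo[rule_format, of "(0, (0, h))"] \<mu>C[of "(norm h)\<^sup>2"] unfolding Yf by (simp del: inner_Pair)
      ultimately show "\<bar>h \<bullet> (hess Q2 *v h)\<bar> \<le> C * (norm h)\<^sup>2" by linarith
    qed
    moreover have "sym_mat (- hess Q2)" using sym_mat_hess[of Q2] by (simp add: sym_mat_iff)
    moreover have "\<rho> * (W1 z1 + a1 \<bullet> x - r) - fst (a1 + p1) + H (snd (z1 + x)) (snd (a1 + p1)) ?X \<le> 0"
    proof -
      have "jet_above (\<lambda>z. w1 (fst z) (snd z)) S1 (z1 + x) (a1 + p1) (\<lambda>k. k \<bullet> Q1 k)"
        using jet_above_translate[of W1 z1 "W1 z1" a1 r0 S1 x p1 "\<lambda>k. k \<bullet> Q1 k"] j1 n r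
        unfolding u_def K1_def i1 W1_def by simp
      then have "\<rho> * W1 (z1 + x) - fst (a1 + p1) + H (snd (z1 + x)) (snd (a1 + p1)) ?X \<le> 0"
        using visc_sub_jet[OF sub _ H Q1] xy unfolding K1_def W1_def by blast
      moreover have "\<rho> * (W1 z1 + a1 \<bullet> x - r) \<le> \<rho> * W1 (z1 + x)"
        using val(1) \<rho> by (intro mult_left_mono) (auto simp: u_def)
      ultimately show ?thesis by linarith
    qed
    moreover have "\<rho> * (- W2 z2 + a2 \<bullet> y - r) - fst (a2 + p2) - H (snd (z2 + y)) (- snd (a2 + p2)) ?Y \<le> 0"
    proof -
      have "jet_above (\<lambda>z. - w2 (fst z) (snd z)) S2 (z2 + y) (a2 + p2) (\<lambda>k. k \<bullet> Q2 k)"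
        using jet_above_translate[of "\<lambda>z. - W2 z" z2 "- W2 z2" a2 r0 S2 y p2 "\<lambda>k. k \<bullet> Q2 k"] j2 n r
        unfolding v_def K2_def i2 W2_def by simp
      moreover have "continuous_on UNIV (\<lambda>(x, p, X). - H x (- p) (- X))"
      proof -
        have "continuous_on UNIV (\<lambda>a. (\<lambda>(x, p, X). H x p X) (fst a, - fst (snd a), - snd (snd a)))"
          by (rule continuous_on_compose2[OF H]) (auto intro!: continuous_intros)
        then show ?thesis by (auto simp: case_prod_beta intro!: continuous_intros)
      qed
      ultimately have "\<rho> * (- W2 (z2 + y)) - fst (a2 + p2) + - H (snd (z2 + y)) (- snd (a2 + p2)) ?Y \<le> 0"
        using visc_sub_jet[OF visc_sub_minus[OF super] _ _ Q2] xy unfolding K2_def W2_def by blast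
      moreover have "\<rho> * (- W2 z2 + a2 \<bullet> y - r) \<le> \<rho> * (- W2 (z2 + y))"
        using val(2) \<rho> by (intro mult_left_mono) (auto simp: v_def)
      ultimately show ?thesis by linarith
    qed
    moreover have "h1 \<bullet> (?X *v h1) - h2 \<bullet> (?Y *v h2) \<le> q h1 h2 + r * (norm ((0::real, h1), (0::real, h2)))\<^sup>2" for h1 h2
      using block[of h1 h2] by (simp add: uminus_matrix_vector_mult Xf Yf del: inner_Pair)
    ultimately have "F r x y p1 p2 ?X ?Y" unfolding F_def using n sym_mat_hess[of Q1] by auto
    then show ?thesis by blast
  qed
  define r where "r = (\<lambda>m. r0 * inverse (real (Suc m)))"
  have r: "0 < r m" "r m \<le> r0" for m using r0 by (auto simp: r_def field_simps)
  have rlim: "r \<longlonglongrightarrow> 0" unfolding r_def using tendsto_mult[OF tendsto_const LIMSEQ_inverse_real_of_nat, of r0] by simp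
  have E0: "\<forall>m. \<exists>x y p1 p2 X Y. F (r m) x y p1 p2 X Y" using ex r by blast
  from choice[OF E0] obtain x where E1: "\<forall>m. \<exists>y p1 p2 X Y. F (r m) (x m) y p1 p2 X Y" ..
  from choice[OF E1] obtain y where E2: "\<forall>m. \<exists>p1 p2 X Y. F (r m) (x m) (y m) p1 p2 X Y" ..
  from choice[OF E2] obtain p1 where E3: "\<forall>m. \<exists>p2 X Y. F (r m) (x m) (y m) (p1 m) p2 X Y" ..
  from choice[OF E3] obtain p2 where E4: "\<forall>m. \<exists>X Y. F (r m) (x m) (y m) (p1 m) (p2 m) X Y" ..
  from choice[OF E4] obtain X where E5: "\<forall>m. \<exists>Y. F (r m) (x m) (y m) (p1 m) (p2 m) (X m) Y" ..
  from choice[OF E5] obtain Y where E6: "\<forall>m. F (r m) (x m) (y m) (p1 m) (p2 m) (X m) (Y m)" ..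
  have xl: "x \<longlonglongrightarrow> 0" and yl: "y \<longlonglongrightarrow> 0" and p1l: "p1 \<longlonglongrightarrow> 0" and p2l: "p2 \<longlonglongrightarrow> 0"
    using E6 by (auto intro!: Lim_null_comparison[OF _ rlim] always_eventually simp: F_def)
  have "compact (cball (0::real^'n^'n) B \<times> cball (0::real^'n^'n) B)" by (intro compact_Times compact_cball)
  then have "seq_compact (cball (0::real^'n^'n) B \<times> cball (0::real^'n^'n) B)" by (simp only: compact_eq_seq_compact_metric)
  moreover have "\<forall>m. (X m, Y m) \<in> cball 0 B \<times> cball 0 B" using E6 by (auto simp: F_def)
  ultimately obtain XY s where s: "strict_mono (s :: nat \<Rightarrow> nat)" "((\<lambda>m. (X m, Y m)) \<circ> s) \<longlonglongrightarrow> XY"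
    by (rule seq_compactE)
  obtain X0 Y0 where XY: "XY = (X0, Y0)" by (cases XY)
  have Xl: "(\<lambda>m. X (s m)) \<longlonglongrightarrow> X0" and Yl: "(\<lambda>m. Y (s m)) \<longlonglongrightarrow> Y0"
    using tendsto_fst[OF s(2)] tendsto_snd[OF s(2)] by (simp_all add: XY o_def)
  note sl = LIMSEQ_subseq_LIMSEQ[OF _ s(1), unfolded o_def]
  have sm: "sym_mat Z0" if "(\<lambda>m. Z m) \<longlonglongrightarrow> Z0" "\<And>m. sym_mat (Z m)" for Z and Z0 :: "real^'n^'n"
    unfolding sym_mat_iff
  proof (intro allI)
    fix i j
    have "(\<lambda>m. Z m $ i $ j) \<longlonglongrightarrow> Z0 $ i $ j" "(\<lambda>m. Z m $ j $ i) \<longlonglongrightarrow> Z0 $ j $ i"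
      by (intro tendsto_vec_nth that(1))+
    moreover have "(\<lambda>m. Z m $ i $ j) = (\<lambda>m. Z m $ j $ i)" using that(2) unfolding sym_mat_iff by auto
    ultimately show "Z0 $ i $ j = Z0 $ j $ i" using LIMSEQ_unique by metis
  qed
  have fl: "(\<lambda>m. h \<bullet> (Z m *v h)) \<longlonglongrightarrow> h \<bullet> (Z0 *v h)" if "(\<lambda>m. Z m) \<longlonglongrightarrow> Z0" for Z and Z0 :: "real^'n^'n" and h
    unfolding inner_matrix_vector by (intro tendsto_intros that)
  show ?thesis
  proof (intro exI conjI allI)
    show "sym_mat X0" by (rule sm[OF Xl]) (use E6 in \<open>auto simp: F_def\<close>)
    show "sym_mat Y0" by (rule sm[OF Yl]) (use E6 in \<open>auto simp: F_def\<close>)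
    have "(\<lambda>m. \<rho> * (W1 z1 + a1 \<bullet> x (s m) - r (s m)) - fst (a1 + p1 (s m)) + H (snd (z1 + x (s m))) (snd (a1 + p1 (s m))) (X (s m)))
        \<longlonglongrightarrow> \<rho> * (W1 z1 + a1 \<bullet> 0 - 0) - fst (a1 + 0) + H (snd (z1 + 0)) (snd (a1 + 0)) X0"
      by (intro tendsto_intros tendsto_H[OF H] Xl sl xl p1l rlim)
    then have "\<rho> * (W1 z1 + a1 \<bullet> 0 - 0) - fst (a1 + 0) + H (snd (z1 + 0)) (snd (a1 + 0)) X0 \<le> 0"
      by (rule LIMSEQ_le_const2) (use E6 in \<open>auto simp: F_def\<close>)
    then show "\<rho> * W1 z1 - fst a1 + H (snd z1) (snd a1) X0 \<le> 0" by simp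
    have "(\<lambda>m. \<rho> * (- W2 z2 + a2 \<bullet> y (s m) - r (s m)) - fst (a2 + p2 (s m)) - H (snd (z2 + y (s m))) (- snd (a2 + p2 (s m))) (Y (s m)))
        \<longlonglongrightarrow> \<rho> * (- W2 z2 + a2 \<bullet> 0 - 0) - fst (a2 + 0) - H (snd (z2 + 0)) (- snd (a2 + 0)) Y0"
      by (intro tendsto_intros tendsto_H[OF H] Yl sl yl p2l rlim)
    then have "\<rho> * (- W2 z2 + a2 \<bullet> 0 - 0) - fst (a2 + 0) - H (snd (z2 + 0)) (- snd (a2 + 0)) Y0 \<le> 0"
      by (rule LIMSEQ_le_const2) (use E6 in \<open>auto simp: F_def\<close>)
    then show "0 \<le> \<rho> * W2 z2 + fst a2 + H (snd z2) (- snd a2) Y0" by simp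
    fix h1 h2
    have "(\<lambda>m. h1 \<bullet> (X (s m) *v h1) - h2 \<bullet> (Y (s m) *v h2)) \<longlonglongrightarrow> h1 \<bullet> (X0 *v h1) - h2 \<bullet> (Y0 *v h2)"
      by (intro tendsto_diff fl Xl Yl)
    moreover have "(\<lambda>m. q h1 h2 + r (s m) * (norm ((0::real, h1), (0::real, h2)))\<^sup>2) \<longlonglongrightarrow> q h1 h2 + 0 * (norm ((0::real, h1), (0::real, h2)))\<^sup>2"
      by (intro tendsto_intros sl rlim)
    ultimately have "h1 \<bullet> (X0 *v h1) - h2 \<bullet> (Y0 *v h2) \<le> q h1 h2 + 0 * (norm ((0::real, h1), (0::real, h2)))\<^sup>2"
      by (rule LIMSEQ_le) (use E6 in \<open>auto simp: F_def simp del: inner_Pair norm_Pair\<close>)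
    then show "h1 \<bullet> (X0 *v h1) - h2 \<bullet> (Y0 *v h2) \<le>
      ((0, h1), (0, h2)) \<bullet> A ((0, h1), (0, h2)) + \<eta> * (norm (A ((0, h1), (0, h2))))\<^sup>2" by (simp add: q_def del: inner_Pair)
  qed
qed


section \<open>Block matrices and the use of the structural assumption\<close>

lemma sum_UNIV_sum_type: "(\<Sum>i\<in>UNIV. f i) = (\<Sum>a\<in>UNIV. f (Inl a)) + (\<Sum>b\<in>UNIV. f (Inr b))"
  for f :: "'a::finite + 'b::finite \<Rightarrow> 'c::comm_monoid_add"
  by (subst UNIV_Plus_UNIV[symmetric], subst sum.Plus) (auto simp: o_def)

definition vec_join :: "real^'n \<Rightarrow> real^'m \<Rightarrow> real^('n + 'm)" where
  "vec_join h1 h2 = (\<chi> i. case i of Inl a \<Rightarrow> h1 $ a | Inr b \<Rightarrow> h2 $ b)"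

lemma vec_join_cases: obtains h1 h2 where "v = vec_join h1 h2"
proof
  show "v = vec_join (\<chi> a. v $ Inl a) (\<chi> b. v $ Inr b)"
    by (auto simp: vec_join_def vec_eq_iff split: sum.splits)
qed

lemma inner_vec_join: "vec_join h1 h2 \<bullet> vec_join g1 g2 = h1 \<bullet> g1 + h2 \<bullet> g2"
  by (simp add: inner_vec_def vec_join_def sum_UNIV_sum_type)

lemma blk_diag_vec_join: "blk_diag X Y *v vec_join h1 h2 = vec_join (X *v h1) (- (Y *v h2))"
  by (auto simp: blk_diag_def vec_join_def vec_eq_iff matrix_vector_mult_def sum_UNIV_sum_type sum_negf split: sum.splits)

lemma J_mat_vec_join: "J_mat *v vec_join h1 h2 = vec_join (h1 - h2) (h2 - h1)"
  by (auto simp: J_mat_def vec_join_def vec_eq_iff matrix_vector_mult_def sum_UNIV_sum_type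
      if_distrib[of "\<lambda>c. c * _"] sum_negf cong: if_cong split: sum.splits)

lemma sym_mat_blk_diag: "sym_mat X \<Longrightarrow> sym_mat Y \<Longrightarrow> sym_mat (blk_diag X Y)"
  by (auto simp: sym_mat_iff blk_diag_def split: sum.splits)

text \<open>The matrix \<open>Q\<close> of the structural assumption will be a multiple of this one:
  the penalty and the localising term are attached to the first variable only, so only the upper
  left block is perturbed.\<close>

definition corner :: "real^('n::finite + 'n)^('n + 'n)" where
  "corner = blk_diag (mat 1) 0"

lemma A_mat_vec_join:
  "A_mat n (c *\<^sub>R corner) *v vec_join h1 h2 =
     vec_join ((real n)\<^sup>2 *\<^sub>R (h1 - h2) + c *\<^sub>R h1) ((real n)\<^sup>2 *\<^sub>R (h2 - h1))"
  unfolding A_mat_def corner_def matrix_vector_mult_add_rdistrib scaleR_matrix_vector_assoc[symmetric]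
    J_mat_vec_join blk_diag_vec_join
  by (auto simp: vec_join_def vec_eq_iff split: sum.splits)

text \<open>The second-order part of the doubled test function: the coupling acts on time and space
  alike, while \<open>b\<close> and \<open>c\<close> carry the quadratic terms in the time and space
  components of the first variable.\<close>

definition penal_op :: "nat \<Rightarrow> real \<Rightarrow> real \<Rightarrow>
    (real \<times> (real^'n)) \<times> (real \<times> (real^'n)) \<Rightarrow> (real \<times> (real^'n)) \<times> (real \<times> (real^'n))" where
  "penal_op n b c k = ((real n)\<^sup>2 *\<^sub>R (fst k - snd k) + (b * fst (fst k), c *\<^sub>R snd (fst k)),
     (real n)\<^sup>2 *\<^sub>R (snd k - fst k))"

lemma symop_penal_op: "symop (penal_op n b c)"
  unfolding symop_def
proof (intro conjI allI)
  show "linear (penal_op n b c)"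
    by (rule linearI) (auto simp: penal_op_def algebra_simps)
  fix x y :: "(real \<times> (real^'n)) \<times> (real \<times> (real^'n))"
  obtain x1 x2 x3 x4 where x: "x = ((x1, x2), (x3, x4))" by (metis prod.exhaust)
  obtain y1 y2 y3 y4 where y: "y = ((y1, y2), (y3, y4))" by (metis prod.exhaust)
  show "x \<bullet> penal_op n b c y = y \<bullet> penal_op n b c x"
    by (simp add: x y penal_op_def inner_diff_right inner_add_right inner_commute algebra_simps)
qed

lemma penal_op_form:
  "((k1, k2) \<bullet> penal_op n b c (k1, k2)) =
     (real n)\<^sup>2 * (norm (k1 - k2))\<^sup>2 + b * (fst k1)\<^sup>2 + c * (norm (snd k1))\<^sup>2"
  unfolding power2_norm_eq_inner
  by (cases k1; cases k2) (simp add: penal_op_def inner_diff_left inner_diff_right inner_add_right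
      inner_commute power2_eq_square algebra_simps)

text \<open>Restricted to the space directions, \<open>penal_op\<close> acts as the matrix of the structural
  assumption; the time directions decouple.\<close>

lemma mat_le_blk_diag_penal:
  fixes X Y :: "real^'n^'n"
  assumes le: "\<And>h1 h2. h1 \<bullet> (X *v h1) - h2 \<bullet> (Y *v h2) \<le>
    ((0, h1), (0, h2)) \<bullet> penal_op n b c ((0, h1), (0, h2)) + \<eta> * (norm (penal_op n b c ((0, h1), (0, h2))))\<^sup>2"
  shows "mat_le (blk_diag X Y) (A_mat n (c *\<^sub>R corner) + \<eta> *\<^sub>R (A_mat n (c *\<^sub>R corner) ** A_mat n (c *\<^sub>R corner)))"
  unfolding mat_le_def
proof
  fix v :: "real^('n + 'n)"
  obtain h1 h2 where v: "v = vec_join h1 h2" by (rule vec_join_cases)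
  define N where "N = (real n)\<^sup>2"
  define g1 where "g1 = N *\<^sub>R (h1 - h2) + c *\<^sub>R h1"
  define g2 where "g2 = N *\<^sub>R (h2 - h1)"
  let ?A = "A_mat n (c *\<^sub>R corner)"
  have Av: "?A *v v = vec_join g1 g2" unfolding v A_mat_vec_join g1_def g2_def N_def ..
  have AAv: "(?A ** ?A) *v v = vec_join (N *\<^sub>R (g1 - g2) + c *\<^sub>R g1) (N *\<^sub>R (g2 - g1))"
    unfolding matrix_vector_mul_assoc[symmetric] Av A_mat_vec_join N_def ..
  have sym: "h1 \<bullet> (N *\<^sub>R (g1 - g2) + c *\<^sub>R g1) + h2 \<bullet> (N *\<^sub>R (g2 - g1)) = (norm g1)\<^sup>2 + (norm g2)\<^sup>2"
  proof -
    have "h1 \<bullet> (N *\<^sub>R (g1 - g2) + c *\<^sub>R g1) + h2 \<bullet> (N *\<^sub>R (g2 - g1)) =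
        g1 \<bullet> (N *\<^sub>R (h1 - h2) + c *\<^sub>R h1) + g2 \<bullet> (N *\<^sub>R (h2 - h1))"
      by (simp add: inner_add_right inner_diff_right inner_commute algebra_simps)
    then show ?thesis by (simp only: g1_def[symmetric] g2_def[symmetric] power2_norm_eq_inner)
  qed
  have pen: "penal_op n b c ((0, h1), (0, h2)) = ((0, g1), (0, g2))"
    by (simp add: penal_op_def g1_def g2_def N_def)
  have npen: "(norm ((0::real, g1), (0::real, g2)))\<^sup>2 = (norm g1)\<^sup>2 + (norm g2)\<^sup>2"
    by (simp add: norm_Pair)
  have "v \<bullet> (blk_diag X Y *v v) = h1 \<bullet> (X *v h1) - h2 \<bullet> (Y *v h2)"
    unfolding v blk_diag_vec_join inner_vec_join by simp
  also have "\<dots> \<le> (h1 \<bullet> g1 + h2 \<bullet> g2) + \<eta> * ((norm g1)\<^sup>2 + (norm g2)\<^sup>2)"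
    using le[of h1 h2] unfolding pen npen by simp
  also have "\<dots> = v \<bullet> ((?A + \<eta> *\<^sub>R (?A ** ?A)) *v v)"
    unfolding matrix_vector_mult_add_rdistrib scaleR_matrix_vector_assoc[symmetric] inner_add_right inner_scaleR_right Av AAv
    unfolding v inner_vec_join sym ..
  finally show "v \<bullet> (blk_diag X Y *v v) \<le> v \<bullet> ((?A + \<eta> *\<^sub>R (?A ** ?A)) *v v)" .
qed

text \<open>For each \<open>\<eta>\<close> the two inequalities of \<open>parabolic_sums\<close> are
  subtracted; the difference of the values of \<open>H\<close> is then bounded below independently
  of \<open>\<eta>\<close>. The matrices form a family admissible for the structural assumption,
  which bounds the liminf from above. The momenta are \<open>a1\<close> and \<open>- a2\<close>; the
  time slopes remain on the left.\<close>

lemma viscosity_gap: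
  fixes w1 w2 :: "real \<Rightarrow> real^'n \<Rightarrow> real" and H :: "real^'n \<Rightarrow> real^'n \<Rightarrow> real^'n^'n \<Rightarrow> real"
  defines "W1 \<equiv> \<lambda>z. w1 (fst z) (snd z)" and "W2 \<equiv> \<lambda>z. w2 (fst z) (snd z)"
  assumes E: "\<And>x y p q Q (n::nat) Xf Yf. x \<in> closure U \<Longrightarrow> y \<in> closure U \<Longrightarrow> norm (x - y) \<le> 1 \<Longrightarrow> sym_mat Q \<Longrightarrow> n \<ge> 1 \<Longrightarrow>
        (\<forall>\<eta>>0. sym_mat (Xf \<eta>) \<and> sym_mat (Yf \<eta>) \<and>
           mat_le (blk_diag (Xf \<eta>) (Yf \<eta>)) (A_mat n Q + \<eta> *\<^sub>R (A_mat n Q ** A_mat n Q))) \<Longrightarrow>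
        Liminf (at_right 0) (\<lambda>\<eta>. ereal (H y q (Yf \<eta>) - H x p (Xf \<eta>)))
          \<le> ereal (\<alpha> * (norm (x - y) * (1 + norm q + real n ^ 2 * norm (x - y))
                        + (1 + norm x) * norm (p - q) + (1 + norm x ^ 2) * norm Q))"
    and sub: "visc_sub \<rho> H w1 S1" and super: "visc_super \<rho> H w2 S2" and \<rho>: "\<rho> > 0"
    and H: "continuous_on UNIV (\<lambda>(x, p, X). H x p X)"
    and z: "z1 \<in> S1" "z2 \<in> S2" and r0: "r0 > 0"
    and cpt: "compact (S1 \<inter> cball z1 r0)" "compact (S2 \<inter> cball z2 r0)"
    and usc: "usc_on S1 W1" and lsc: "lsc_on S2 W2"
    and max: "\<And>k1 k2. norm k1 \<le> r0 \<Longrightarrow> norm k2 \<le> r0 \<Longrightarrow> z1 + k1 \<in> S1 \<Longrightarrow> z2 + k2 \<in> S2 \<Longrightarrow>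
      W1 (z1 + k1) - W2 (z2 + k2) \<le> W1 z1 - W2 z2 + a1 \<bullet> k1 + a2 \<bullet> k2
        + ((real n)\<^sup>2 * (norm (k1 - k2))\<^sup>2 + b * (fst k1)\<^sup>2 + c * (norm (snd k1))\<^sup>2) / 2"
    and cl: "snd z1 \<in> closure U" "snd z2 \<in> closure U" "norm (snd z1 - snd z2) \<le> 1" and n: "n \<ge> 1"
  shows "\<rho> * (W1 z1 - W2 z2) - (fst a1 + fst a2) \<le>
    \<alpha> * (norm (snd z1 - snd z2) * (1 + norm (snd a2) + (real n)\<^sup>2 * norm (snd z1 - snd z2))
         + (1 + norm (snd z1)) * norm (snd a1 + snd a2)
         + (1 + (norm (snd z1))\<^sup>2) * (\<bar>c\<bar> * norm (corner :: real^('n + 'n)^('n + 'n))))"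
proof -
  define A :: "(real \<times> (real^'n)) \<times> (real \<times> (real^'n)) \<Rightarrow> (real \<times> (real^'n)) \<times> (real \<times> (real^'n))"
    where "A = penal_op n b c"
  define G where "G = (\<lambda>\<eta> X Y. sym_mat X \<and> sym_mat Y \<and>
    \<rho> * W1 z1 - fst a1 + H (snd z1) (snd a1) X \<le> 0 \<and>
    0 \<le> \<rho> * W2 z2 + fst a2 + H (snd z2) (- snd a2) Y \<and>
    (\<forall>h1 h2. h1 \<bullet> (X *v h1) - h2 \<bullet> (Y *v h2) \<le>
      ((0, h1), (0, h2)) \<bullet> A ((0, h1), (0, h2)) + \<eta> * (norm (A ((0, h1), (0, h2))))\<^sup>2))"
  have "\<exists>X Y. G \<eta> X Y" if \<eta>: "\<eta> > 0" for \<eta>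
    unfolding G_def W1_def W2_def A_def
  proof (rule parabolic_sums[OF sub super \<rho> H z r0 cpt _ _ symop_penal_op _ \<eta>])
    show "usc_on S1 (\<lambda>z. w1 (fst z) (snd z))" "lsc_on S2 (\<lambda>z. w2 (fst z) (snd z))"
      using usc lsc by (simp_all add: W1_def W2_def)
  qed (use max in \<open>simp only: penal_op_form W1_def W2_def\<close>)
  then have "\<forall>\<eta>. \<exists>X Y. \<eta> > 0 \<longrightarrow> G \<eta> X Y" by blast
  from choice[OF this] obtain Xf where "\<forall>\<eta>. \<exists>Y. \<eta> > 0 \<longrightarrow> G \<eta> (Xf \<eta>) Y" ..
  from choice[OF this] obtain Yf where "\<forall>\<eta>. \<eta> > 0 \<longrightarrow> G \<eta> (Xf \<eta>) (Yf \<eta>)" ..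
  note XY = this[unfolded G_def]
  define Q where "Q = c *\<^sub>R (corner :: real^('n + 'n)^('n + 'n))"
  have "sym_mat (corner :: real^('n + 'n)^('n + 'n))"
    unfolding corner_def by (rule sym_mat_blk_diag) (auto simp: sym_mat_iff mat_def)
  then have Q: "sym_mat Q" by (simp add: Q_def sym_mat_iff)
  have fam: "\<forall>\<eta>>0. sym_mat (Xf \<eta>) \<and> sym_mat (Yf \<eta>) \<and>
     mat_le (blk_diag (Xf \<eta>) (Yf \<eta>)) (A_mat n Q + \<eta> *\<^sub>R (A_mat n Q ** A_mat n Q))"
  proof (intro allI impI conjI)
    fix \<eta> :: real assume \<eta>: "\<eta> > 0"
    then show "sym_mat (Xf \<eta>)" "sym_mat (Yf \<eta>)" using XY by blast+
    show "mat_le (blk_diag (Xf \<eta>) (Yf \<eta>)) (A_mat n Q + \<eta> *\<^sub>R (A_mat n Q ** A_mat n Q))"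
      unfolding Q_def
    proof (rule mat_le_blk_diag_penal)
      fix h1 h2
      show "h1 \<bullet> (Xf \<eta> *v h1) - h2 \<bullet> (Yf \<eta> *v h2) \<le>
        ((0, h1), (0, h2)) \<bullet> penal_op n b c ((0, h1), (0, h2)) + \<eta> * (norm (penal_op n b c ((0, h1), (0, h2))))\<^sup>2"
        using XY \<eta> unfolding A_def by blast
    qed
  qed
  have "eventually (\<lambda>\<eta>. ereal (\<rho> * (W1 z1 - W2 z2) - (fst a1 + fst a2)) \<le>
      ereal (H (snd z2) (- snd a2) (Yf \<eta>) - H (snd z1) (snd a1) (Xf \<eta>))) (at_right 0)"
  proof (rule eventually_mono[OF eventually_at_right_less])
    fix \<eta> :: real assume "0 < \<eta>"
    then have "\<rho> * W1 z1 - fst a1 + H (snd z1) (snd a1) (Xf \<eta>) \<le> 0"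
      "0 \<le> \<rho> * W2 z2 + fst a2 + H (snd z2) (- snd a2) (Yf \<eta>)" using XY by blast+
    then show "ereal (\<rho> * (W1 z1 - W2 z2) - (fst a1 + fst a2)) \<le>
      ereal (H (snd z2) (- snd a2) (Yf \<eta>) - H (snd z1) (snd a1) (Xf \<eta>))"
      by (simp add: right_diff_distrib)
  qed
  then have "ereal (\<rho> * (W1 z1 - W2 z2) - (fst a1 + fst a2)) \<le>
      Liminf (at_right 0) (\<lambda>\<eta>. ereal (H (snd z2) (- snd a2) (Yf \<eta>) - H (snd z1) (snd a1) (Xf \<eta>)))"
    by (rule Liminf_bounded)
  also have "\<dots> \<le> ereal (\<alpha> * (norm (snd z1 - snd z2) * (1 + norm (- snd a2) + real n ^ 2 * norm (snd z1 - snd z2))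
                        + (1 + norm (snd z1)) * norm (snd a1 - (- snd a2)) + (1 + norm (snd z1) ^ 2) * norm Q))"
    by (rule E[OF cl Q n fam])
  finally show ?thesis by (simp add: Q_def)
qed

section \<open>The penalty and its quadratic majorant\<close>

lemma exp_le_quadratic:
  fixes x :: real assumes "\<bar>x\<bar> \<le> 1" shows "exp x \<le> 1 + x + x\<^sup>2"
proof (cases "x \<ge> 0")
  case True
  with assms show ?thesis by (intro exp_bound) auto
next
  case False
  define y where "y = - x"
  have y: "y > 0" using False by (simp add: y_def)
  have "(1 - y + y\<^sup>2) * (1 + y) = 1 + y ^ 3" by (simp add: power2_eq_square power3_eq_cube algebra_simps)
  also have "\<dots> \<ge> 1" using y by simp
  finally have 1: "1 \<le> (1 - y + y\<^sup>2) * (1 + y)" .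
  have pos: "1 - y + y\<^sup>2 \<ge> 0" using y assms by (simp add: y_def)
  have "(1 - y + y\<^sup>2) * (1 + y) \<le> (1 - y + y\<^sup>2) * exp y" using pos by (intro mult_left_mono) auto
  with 1 have "1 \<le> (1 - y + y\<^sup>2) * exp y" by linarith
  then have "exp (- y) * 1 \<le> exp (- y) * ((1 - y + y\<^sup>2) * exp y)" by (intro mult_left_mono) auto
  also have "\<dots> = (1 - y + y\<^sup>2) * (exp (- y) * exp y)" by (simp only: mult_ac)
  also have "\<dots> = 1 - y + y\<^sup>2" by (simp add: exp_add[symmetric])
  finally show ?thesis by (simp add: y_def)
qed

definition penalty :: "real \<Rightarrow> real \<Rightarrow> nat \<Rightarrow> real \<times> (real^'n) \<Rightarrow> real" where
  "penalty T \<kappa> m z = exp (\<kappa> * (T - fst z)) * (1 + (norm (snd z))\<^sup>2) ^ m"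

lemma penalty_pos: "penalty T \<kappa> m z > 0"
  unfolding penalty_def by (intro mult_pos_pos zero_less_power) (auto intro: add_pos_nonneg)

text \<open>The majorant has the value and the slope of the penalty at \<open>z\<close> and fits the
  theorem on sums, which is stated for quadratic bounds. The divisions by \<open>s0\<close>
  compensate the weights \<open>1 + |x|\<close> and \<open>1 + |x|\<^sup>2\<close> of the structural
  assumption.\<close>

lemma penalty_upper_quadratic:
  fixes z k :: "real \<times> (real^'n)"
  assumes \<kappa>: "\<kappa> \<ge> 0" and k: "norm k \<le> 1 / (1 + \<kappa> + 3 * real m)"
  defines "s0 \<equiv> 1 + (norm (snd z))\<^sup>2"
  shows "penalty T \<kappa> m (z + k) \<le> penalty T \<kappa> m z *
    (1 + (- \<kappa> * fst k + 2 * real m * (snd z \<bullet> snd k) / s0)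
       + (real m + 18 * (real m)\<^sup>2) * (norm (snd k))\<^sup>2 / s0 + 2 * \<kappa>\<^sup>2 * (fst k)\<^sup>2)"
proof -
  obtain t x where z: "z = (t, x)" by (cases z)
  obtain \<tau> h where kk: "k = (\<tau>, h)" by (cases k)
  have s0: "s0 \<ge> 1" "s0 > 0" by (simp_all add: s0_def add_pos_nonneg)
  define r where "r = 1 / (1 + \<kappa> + 3 * real m)"
  have r: "0 < r" "r \<le> 1" "(\<kappa> + 3 * real m) * r \<le> 1" using \<kappa> by (auto simp: r_def field_simps)
  have th: "\<bar>\<tau>\<bar> \<le> r" "norm h \<le> r"
    using k norm_fst_le[of \<tau> h] norm_snd_le[of h \<tau>] by (auto simp: kk r_def)
  \<comment> \<open>The relative increment of \<open>1 + |x|\<^sup>2\<close>. The penalty is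
    multiplied by \<open>exp (- \<kappa> \<tau>) (1 + \<delta>) ^ m\<close>, at most
    \<open>exp D\<close> for the \<open>D\<close> defined below, and the radius \<open>r\<close>
    ensures \<open>|D| \<le> 1\<close>, where \<open>exp D \<le> 1 + D + D\<^sup>2\<close>.\<close>
  define \<delta> where "\<delta> = (2 * (x \<bullet> h) + (norm h)\<^sup>2) / s0"
  have nx: "1 + (norm (x + h))\<^sup>2 = s0 * (1 + \<delta>)"
    using s0 by (simp add: \<delta>_def s0_def z power2_norm_eq_inner inner_add_left inner_add_right inner_commute field_simps)
  have d1: "0 \<le> 1 + \<delta>" using nx s0 by (smt (verit) zero_le_power2 zero_le_mult_iff)
  have dsq: "\<delta>\<^sup>2 \<le> 9 * (norm h)\<^sup>2 / s0"
  proof -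
    have "\<bar>2 * (x \<bullet> h) + (norm h)\<^sup>2\<bar> \<le> 2 * (norm x * norm h) + (norm h)\<^sup>2"
      using Cauchy_Schwarz_ineq2[of x h] zero_le_power2[of "norm h"] by linarith
    also have "\<dots> = norm h * (2 * norm x + norm h)" by (simp add: power2_eq_square algebra_simps)
    also have "\<dots> \<le> norm h * (2 * norm x + 1)" using th r by (intro mult_left_mono) auto
    finally have "\<bar>2 * (x \<bullet> h) + (norm h)\<^sup>2\<bar> \<le> \<bar>norm h * (2 * norm x + 1)\<bar>" by linarith
    then have "(2 * (x \<bullet> h) + (norm h)\<^sup>2)\<^sup>2 \<le> (norm h * (2 * norm x + 1))\<^sup>2"
      by (simp only: abs_le_square_iff)
    also have "\<dots> \<le> (norm h)\<^sup>2 * (9 * s0)"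
    proof -
      have "(2 * norm x + 1)\<^sup>2 \<le> 9 * s0"
      proof -
        have "(2 * norm x + 1)\<^sup>2 = 4 * (norm x)\<^sup>2 + 4 * norm x + 1" by (simp add: power2_eq_square algebra_simps)
        moreover have "2 * norm x \<le> 1 + (norm x)\<^sup>2" using sum_squares_bound[of "norm x" 1] by simp
        moreover have "s0 = 1 + (norm x)\<^sup>2" by (simp add: s0_def z)
        ultimately show ?thesis using zero_le_power2[of "norm x"] by linarith
      qed
      then show ?thesis unfolding power_mult_distrib by (intro mult_left_mono) auto
    qed
    finally have "(2 * (x \<bullet> h) + (norm h)\<^sup>2)\<^sup>2 / s0\<^sup>2 \<le> (norm h)\<^sup>2 * (9 * s0) / s0\<^sup>2" by (rule divide_right_mono) simp
    also have "\<dots> = 9 * (norm h)\<^sup>2 / s0" using s0 by (simp add: power2_eq_square field_simps)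
    finally show ?thesis by (simp add: \<delta>_def power_divide)
  qed
  have dabs: "\<bar>\<delta>\<bar> \<le> 3 * r"
  proof -
    have "9 * (norm h)\<^sup>2 / s0 \<le> 9 * (norm h)\<^sup>2 / 1" using s0 by (intro divide_left_mono) auto
    also have "\<dots> \<le> (3 * r)\<^sup>2" using th by (simp add: power_mult_distrib power_mono)
    finally have "\<delta>\<^sup>2 \<le> (3 * r)\<^sup>2" using dsq by linarith
    then have "\<bar>\<delta>\<bar> \<le> \<bar>3 * r\<bar>" by (simp only: abs_le_square_iff)
    then show ?thesis using r by simp
  qed
  define D where "D = - \<kappa> * \<tau> + real m * \<delta>"
  have Dabs: "\<bar>D\<bar> \<le> 1"
  proof -
    have "\<bar>D\<bar> \<le> \<kappa> * \<bar>\<tau>\<bar> + real m * \<bar>\<delta>\<bar>" unfolding D_def using \<kappa> by (intro order_trans[OF abs_triangle_ineq]) (simp add: abs_mult)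
    also have "\<dots> \<le> \<kappa> * r + real m * (3 * r)" using th dabs \<kappa> by (intro add_mono mult_left_mono) auto
    finally show ?thesis using r(3) by (simp add: algebra_simps)
  qed
  have "penalty T \<kappa> m (z + k) = exp (\<kappa> * (T - t)) * exp (- \<kappa> * \<tau>) * (s0 * (1 + \<delta>)) ^ m"
    unfolding penalty_def z kk add_Pair fst_conv snd_conv nx by (simp add: exp_add[symmetric] right_diff_distrib distrib_left)
  also have "\<dots> = penalty T \<kappa> m z * (exp (- \<kappa> * \<tau>) * (1 + \<delta>) ^ m)"
    by (simp add: penalty_def z s0_def power_mult_distrib)
  also have "\<dots> \<le> penalty T \<kappa> m z * exp D"
  proof (intro mult_left_mono less_imp_le[OF penalty_pos])
    have "(1 + \<delta>) ^ m \<le> exp \<delta> ^ m" using d1 by (intro power_mono) auto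
    also have "\<dots> = exp (real m * \<delta>)" by (simp add: exp_of_nat_mult)
    finally show "exp (- \<kappa> * \<tau>) * (1 + \<delta>) ^ m \<le> exp D"
      unfolding D_def exp_add by (intro mult_left_mono) auto
  qed
  also have "\<dots> \<le> penalty T \<kappa> m z * (1 + D + D\<^sup>2)"
    by (intro mult_left_mono less_imp_le[OF penalty_pos] exp_le_quadratic Dabs)
  also have "\<dots> \<le> penalty T \<kappa> m z *
    (1 + (- \<kappa> * \<tau> + 2 * real m * (x \<bullet> h) / s0) + (real m + 18 * (real m)\<^sup>2) * (norm h)\<^sup>2 / s0 + 2 * \<kappa>\<^sup>2 * \<tau>\<^sup>2)"
  proof (intro mult_left_mono less_imp_le[OF penalty_pos])
    have "D\<^sup>2 \<le> 2 * (\<kappa> * \<tau>)\<^sup>2 + 2 * (real m * \<delta>)\<^sup>2"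
      using zero_le_power2[of "\<kappa> * \<tau> + real m * \<delta>"] by (simp add: D_def power2_eq_square algebra_simps)
    also have "(real m * \<delta>)\<^sup>2 \<le> (real m)\<^sup>2 * (9 * (norm h)\<^sup>2 / s0)"
      unfolding power_mult_distrib using dsq by (intro mult_left_mono) auto
    finally have "D\<^sup>2 \<le> 2 * \<kappa>\<^sup>2 * \<tau>\<^sup>2 + 18 * (real m)\<^sup>2 * (norm h)\<^sup>2 / s0" by (simp add: power_mult_distrib)
    moreover have "D = - \<kappa> * \<tau> + 2 * real m * (x \<bullet> h) / s0 + real m * (norm h)\<^sup>2 / s0"
      by (simp add: D_def \<delta>_def add_divide_distrib algebra_simps)
    ultimately show "1 + D + D\<^sup>2 \<le> 1 + (- \<kappa> * \<tau> + 2 * real m * (x \<bullet> h) / s0) + (real m + 18 * (real m)\<^sup>2) * (norm h)\<^sup>2 / s0 + 2 * \<kappa>\<^sup>2 * \<tau>\<^sup>2"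
      by (simp add: distrib_right add_divide_distrib)
  qed
  finally show ?thesis by (simp add: z kk)
qed

section \<open>Doubling of variables\<close>

lemma usc_on_sequentially:
  fixes f :: "'a::metric_space \<Rightarrow> real"
  assumes f: "usc_on K f" and a: "a \<in> K" "f a < c" and X: "\<And>n. X n \<in> K" "X \<longlonglongrightarrow> a"
  shows "eventually (\<lambda>n. f (X n) < c) sequentially"
proof -
  have "eventually (\<lambda>z. f z < c) (at a within K)" using f a unfolding usc_on_def by blast
  then obtain d where d: "d > 0" "\<forall>x\<in>K. x \<noteq> a \<and> dist x a < d \<longrightarrow> f x < c" unfolding eventually_at by blast
  have "eventually (\<lambda>n. dist (X n) a < d) sequentially" using X(2) d(1) by (rule tendstoD)
  then show ?thesis
  proof eventually_elim
    case (elim n)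
    then show ?case using d(2) X(1)[of n] a by (cases "X n = a") auto
  qed
qed

text \<open>The pair \<open>(z0, z0 + e n)\<close> has zero coupling and, by the assumed convergence
  of \<open>g\<close>, value tending to \<open>f z0 - g z0\<close>. The maximisers do at least as
  well; semicontinuity then makes the limit of a convergent subsequence a maximiser of
  \<open>f - g\<close>, hence \<open>z0\<close>, and leaves nothing for the coupling term.\<close>

lemma doubling_maximizers_converge:
  fixes f g :: "'a::euclidean_space \<Rightarrow> real" and N :: "nat \<Rightarrow> real"
  assumes K: "compact K" and f: "usc_on K f" and g: "lsc_on K g" and z0: "z0 \<in> K"
    and strict: "\<And>z. z \<in> K \<Longrightarrow> z \<noteq> z0 \<Longrightarrow> f z - g z < f z0 - g z0"
    and e: "e \<longlonglongrightarrow> 0" and N: "filterlim N at_top sequentially" "\<And>n. N n > 0"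
    and eK: "\<And>n. z0 + e n \<in> K" and ge: "(\<lambda>n. g (z0 + e n)) \<longlonglongrightarrow> g z0"
    and ZY: "\<And>n. Z n \<in> K" "\<And>n. Y n \<in> K"
    and mx: "\<And>n z y. z \<in> K \<Longrightarrow> y \<in> K \<Longrightarrow> f z - g y - (N n)\<^sup>2 / 2 * (norm (z - y + e n))\<^sup>2 \<le>
        f (Z n) - g (Y n) - (N n)\<^sup>2 / 2 * (norm (Z n - Y n + e n))\<^sup>2"
  shows "\<exists>s. strict_mono s \<and> (\<lambda>n. Z (s n)) \<longlonglongrightarrow> z0 \<and> (\<lambda>n. Y (s n)) \<longlonglongrightarrow> z0 \<and>
     (\<lambda>n. N (s n) * norm (Z (s n) - Y (s n) + e (s n))) \<longlonglongrightarrow> 0"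
proof -
  define M where "M = f z0 - g z0"
  define V where "V = (\<lambda>n. f z0 - g (z0 + e n))"
  have V: "V \<longlonglongrightarrow> M" unfolding V_def M_def by (intro tendsto_intros ge)
  define d where "d = (\<lambda>n. Z n - Y n + e n)"
  define pen where "pen = (\<lambda>n. (N n)\<^sup>2 / 2 * (norm (d n))\<^sup>2)"
  have pen0: "pen n \<ge> 0" for n by (simp add: pen_def)
  have penV: "pen n \<le> f (Z n) - g (Y n) - V n" for n
    using mx[OF z0 eK, of n n] by (simp add: pen_def d_def V_def)
  have Kne: "K \<noteq> {}" using z0 by blast
  have g': "usc_on K (\<lambda>z. - g z)" using g by (rule usc_on_minus_if_lsc_on)
  obtain F where F: "\<And>z. z \<in> K \<Longrightarrow> f z \<le> F" using usc_attains_max[OF K Kne f] by blast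
  obtain G where G: "\<And>z. z \<in> K \<Longrightarrow> - g z \<le> G" using usc_attains_max[OF K Kne g'] by blast
  have invN: "(\<lambda>n. inverse (N n)) \<longlonglongrightarrow> 0" using N(1) by (rule tendsto_inverse_0_at_top)
  have dsq: "(norm (d n))\<^sup>2 \<le> 2 * (F + G - V n) * (inverse (N n))\<^sup>2" for n
  proof -
    have "(N n)\<^sup>2 / 2 * (norm (d n))\<^sup>2 \<le> F + G - V n"
      using penV[of n] F[OF ZY(1)[of n]] G[OF ZY(2)[of n]] by (simp add: pen_def)
    then show ?thesis using N(2)[of n] by (simp add: field_simps)
  qed
  have up: "(\<lambda>n. 2 * (F + G - V n) * (inverse (N n))\<^sup>2) \<longlonglongrightarrow> 2 * (F + G - M) * 0\<^sup>2"
    by (intro tendsto_intros V invN)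
  have "(\<lambda>n. (norm (d n))\<^sup>2) \<longlonglongrightarrow> 0"
  proof (rule tendsto_sandwich[OF _ _ tendsto_const])
    show "eventually (\<lambda>n. (norm (d n))\<^sup>2 \<le> 2 * (F + G - V n) * (inverse (N n))\<^sup>2) sequentially"
      by (intro always_eventually allI dsq)
    show "(\<lambda>n. 2 * (F + G - V n) * (inverse (N n))\<^sup>2) \<longlonglongrightarrow> 0" using up by (simp only: power_zero_numeral mult_zero_right)
  qed simp
  from tendsto_real_sqrt[OF this] have d0: "d \<longlonglongrightarrow> 0" by (simp add: tendsto_norm_zero_iff)
  have "seq_compact (K \<times> K)" using K by (simp only: compact_eq_seq_compact_metric[symmetric] compact_Times)
  moreover have "\<forall>n. (Z n, Y n) \<in> K \<times> K" using ZY by auto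
  ultimately obtain ab s where ab: "ab \<in> K \<times> K" and s: "strict_mono (s :: nat \<Rightarrow> nat)"
    and lim: "((\<lambda>n. (Z n, Y n)) \<circ> s) \<longlonglongrightarrow> ab"
    by (rule seq_compactE)
  define a where "a = fst ab"
  have aK: "a \<in> K" using ab by (auto simp: a_def)
  have Zs: "(\<lambda>n. Z (s n)) \<longlonglongrightarrow> a" using tendsto_fst[OF lim] by (simp add: o_def a_def)
  note sub = LIMSEQ_subseq_LIMSEQ[OF _ s, unfolded o_def]
  have "(\<lambda>n. Z (s n) + e (s n) - d (s n)) \<longlonglongrightarrow> a + 0 - 0" by (intro tendsto_intros Zs sub e d0)
  then have Ys: "(\<lambda>n. Y (s n)) \<longlonglongrightarrow> a" by (simp add: d_def)
  have ev: "eventually (\<lambda>n. pen (s n) < f a - g a - M + 3 * \<theta>) sequentially" if \<theta>: "\<theta> > 0" for \<theta>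
  proof -
    have "eventually (\<lambda>n. f (Z (s n)) < f a + \<theta>) sequentially"
      by (rule usc_on_sequentially[OF f aK _ ZY(1) Zs]) (use \<theta> in simp)
    moreover have "eventually (\<lambda>n. - g (Y (s n)) < - g a + \<theta>) sequentially"
      by (rule usc_on_sequentially[OF g' aK _ ZY(2) Ys]) (use \<theta> in simp)
    moreover have "eventually (\<lambda>n. M - \<theta> < V (s n)) sequentially"
      by (rule order_tendstoD(1)[OF sub[OF V]]) (use \<theta> in simp)
    ultimately show ?thesis
    proof eventually_elim
      case (elim n) then show ?case using penV[of "s n"] by linarith
    qed
  qed
  have "M \<le> f a - g a"
  proof (rule field_le_epsilon)
    fix \<theta> :: real assume "\<theta> > 0"
    then have "eventually (\<lambda>n. pen (s n) < f a - g a - M + 3 * (\<theta> / 3)) sequentially" by (intro ev) simp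
    then obtain n where "pen (s n) < f a - g a - M + 3 * (\<theta> / 3)" by (auto dest: eventually_happens)
    then show "M \<le> f a - g a + \<theta>" using pen0[of "s n"] by simp
  qed
  then have a: "a = z0" using strict[OF aK] by (force simp: M_def)
  have pl: "(\<lambda>n. pen (s n)) \<longlonglongrightarrow> 0"
  proof (rule tendstoI)
    fix \<theta> :: real assume "\<theta> > 0"
    then have "eventually (\<lambda>n. pen (s n) < f a - g a - M + 3 * (\<theta> / 3)) sequentially" by (intro ev) simp
    then show "eventually (\<lambda>n. dist (pen (s n)) 0 < \<theta>) sequentially"
      by eventually_elim (use pen0 in \<open>auto simp: a M_def\<close>)
  qed
  have "(\<lambda>n. sqrt (2 * pen (s n))) \<longlonglongrightarrow> sqrt (2 * 0)" by (intro tendsto_intros pl)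
  moreover have "sqrt (2 * pen n) = N n * norm (d n)" for n
    using N(2)[of n] by (simp add: pen_def real_sqrt_mult)
  ultimately show ?thesis using s Zs Ys unfolding a d_def by (intro exI[of _ s]) simp
qed

text \<open>The hypothesis gives a radius for each \<open>\<psi>\<close> separately. If no uniform
  \<open>r\<close> and \<open>\<nu>\<close> existed, violating shifts \<open>v k\<close> at scales
  \<open>E k\<close>, with \<open>|v k| \<le> E k / (k + 1)\<close>, could be assembled into a
  single \<open>\<psi>\<close> of order \<open>o(\<epsilon>)\<close>.\<close>

lemma nontangential_uniform:
  fixes l :: "real \<Rightarrow> 'a::real_normed_vector"
  assumes nt: "\<forall>\<psi>. ((\<lambda>\<epsilon>. norm (\<psi> \<epsilon>) / \<epsilon>) \<longlongrightarrow> 0) (at_right 0) \<longrightarrow>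
          (\<exists>r>0. \<forall>y\<in>A. \<forall>\<epsilon>\<in>{0<..<r}. y + l \<epsilon> + \<psi> \<epsilon> \<in> U)"
  shows "\<exists>r>0. \<exists>\<nu>>0. \<forall>y\<in>A. \<forall>\<epsilon>. \<forall>v. 0 < \<epsilon> \<longrightarrow> \<epsilon> < r \<longrightarrow> norm v \<le> \<nu> * \<epsilon> \<longrightarrow> y + l \<epsilon> + v \<in> U"
proof (rule ccontr)
  assume neg: "\<not> ?thesis"
  have "\<forall>k::nat. \<exists>p. fst p \<in> A \<and> 0 < fst (snd p) \<and> fst (snd p) < inverse (real (Suc k)) \<and>
      norm (snd (snd p)) \<le> inverse (real (Suc k)) * fst (snd p) \<and> fst p + l (fst (snd p)) + snd (snd p) \<notin> U"
  proof
    fix k :: nat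
    have "inverse (real (Suc k)) > 0" by simp
    with neg have "\<not> (\<forall>y\<in>A. \<forall>\<epsilon>. \<forall>v. 0 < \<epsilon> \<longrightarrow> \<epsilon> < inverse (real (Suc k)) \<longrightarrow> norm v \<le> inverse (real (Suc k)) * \<epsilon> \<longrightarrow> y + l \<epsilon> + v \<in> U)"
      by blast
    then obtain y \<epsilon> v where "y \<in> A" "0 < \<epsilon>" "\<epsilon> < inverse (real (Suc k))" "norm v \<le> inverse (real (Suc k)) * \<epsilon>" "y + l \<epsilon> + v \<notin> U"
      by blast
    then show "\<exists>p. fst p \<in> A \<and> 0 < fst (snd p) \<and> fst (snd p) < inverse (real (Suc k)) \<and>
      norm (snd (snd p)) \<le> inverse (real (Suc k)) * fst (snd p) \<and> fst p + l (fst (snd p)) + snd (snd p) \<notin> U"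
      by (intro exI[of _ "(y, \<epsilon>, v)"]) simp
  qed
  from choice[OF this] obtain p where p: "\<forall>k::nat. fst (p k) \<in> A \<and> 0 < fst (snd (p k)) \<and> fst (snd (p k)) < inverse (real (Suc k)) \<and>
      norm (snd (snd (p k))) \<le> inverse (real (Suc k)) * fst (snd (p k)) \<and> fst (p k) + l (fst (snd (p k))) + snd (snd (p k)) \<notin> U" ..
  define y where "y = (\<lambda>k. fst (p k))"
  define E where "E = (\<lambda>k. fst (snd (p k)))"
  define v where "v = (\<lambda>k. snd (snd (p k)))"
  have P: "y k \<in> A" "0 < E k" "E k < inverse (real (Suc k))" "norm (v k) \<le> inverse (real (Suc k)) * E k" "y k + l (E k) + v k \<notin> U" for k
    using p unfolding y_def E_def v_def by blast+
  \<comment> \<open>Several indices may share a scale; \<open>\<psi>\<close> uses one chosen index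
    per scale, and the contradiction is drawn at that index.\<close>
  define idx where "idx = (\<lambda>\<epsilon>. SOME k. E k = \<epsilon>)"
  have idx: "E (idx (E k)) = E k" for k unfolding idx_def by (rule someI[of _ k]) simp
  define \<psi> where "\<psi> = (\<lambda>\<epsilon>. if E (idx \<epsilon>) = \<epsilon> then v (idx \<epsilon>) else 0)"
  have "((\<lambda>\<epsilon>. norm (\<psi> \<epsilon>) / \<epsilon>) \<longlongrightarrow> 0) (at_right 0)"
  proof (rule tendstoI)
    fix \<omega> :: real assume "\<omega> > 0"
    then obtain m where m: "inverse (real (Suc m)) < \<omega>" using reals_Archimedean by blast
    \<comment> \<open>Below the smallest of the first \<open>m + 1\<close> scales only indices above
      \<open>m\<close> occur.\<close>
    define \<delta> where "\<delta> = Min (E ` {..m})"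
    have \<delta>: "\<delta> > 0" unfolding \<delta>_def using P(2) by (subst Min_gr_iff) auto
    have "dist (norm (\<psi> \<epsilon>) / \<epsilon>) 0 < \<omega>" if \<epsilon>: "0 < \<epsilon>" "\<epsilon> < \<delta>" for \<epsilon>
    proof (cases "E (idx \<epsilon>) = \<epsilon>")
      case True
      have "idx \<epsilon> > m"
      proof (rule ccontr)
        assume "\<not> ?thesis"
        then have "\<delta> \<le> E (idx \<epsilon>)" unfolding \<delta>_def by (intro Min_le) auto
        then show False using True \<epsilon> by simp
      qed
      then have "inverse (real (Suc (idx \<epsilon>))) \<le> inverse (real (Suc m))" by (intro le_imp_inverse_le) auto
      moreover have "norm (v (idx \<epsilon>)) \<le> inverse (real (Suc (idx \<epsilon>))) * \<epsilon>" using P(4)[of "idx \<epsilon>"] True by simp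
      ultimately have "norm (v (idx \<epsilon>)) \<le> inverse (real (Suc m)) * \<epsilon>"
        using \<epsilon> mult_right_mono[of "inverse (real (Suc (idx \<epsilon>)))" "inverse (real (Suc m))" \<epsilon>] by linarith
      then have "norm (v (idx \<epsilon>)) / \<epsilon> \<le> inverse (real (Suc m))" using \<epsilon> by (simp only: pos_divide_le_eq)
      then show ?thesis using m True \<epsilon> by (simp add: \<psi>_def del: of_nat_Suc)
    qed (use \<open>\<omega> > 0\<close> in \<open>simp add: \<psi>_def\<close>)
    then show "eventually (\<lambda>\<epsilon>. dist (norm (\<psi> \<epsilon>) / \<epsilon>) 0 < \<omega>) (at_right 0)"
      unfolding eventually_at_right_field using \<delta> by blast
  qed
  then obtain r where r: "r > 0" "\<And>y \<epsilon>. y \<in> A \<Longrightarrow> \<epsilon> \<in> {0<..<r} \<Longrightarrow> y + l \<epsilon> + \<psi> \<epsilon> \<in> U"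
    using nt by blast
  obtain k where k: "inverse (real (Suc k)) < r" using reals_Archimedean[OF r(1)] by blast
  define i where "i = idx (E k)"
  have Ei: "E i = E k" unfolding i_def by (rule idx)
  have "y i + l (E i) + \<psi> (E i) \<in> U" by (rule r(2)[OF P(1)]) (use P(2,3)[of k] k Ei in auto)
  moreover have "\<psi> (E i) = v i" unfolding \<psi>_def Ei i_def[symmetric] by simp
  ultimately show False using P(5)[of i] by simp
qed

text \<open>Prepares class R for doubling: shifts \<open>e n\<close> and integers \<open>N n\<close>
  such that \<open>N |l|\<close> stays below \<open>\<theta>\<close>, and a shift perturbed by
  \<open>v\<close> with \<open>N |v|\<close> small still leads into \<open>U\<close>. At an interior
  point the shift is 0; at a boundary point \<open>N n\<close> is of the order of the inverse of the
  parameter.\<close>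

lemma class_R_approach:
  fixes w2 :: "real \<Rightarrow> real^'n \<Rightarrow> real"
  assumes U: "open U" and R: "class_R T U w2" and t0: "0 \<le> t0" "t0 < T" and x0: "x0 \<in> closure U" and \<theta>: "\<theta> > 0"
  shows "\<exists>(e :: nat \<Rightarrow> real \<times> (real^'n)) (N :: nat \<Rightarrow> nat) V \<nu>. (\<forall>n. n < N n) \<and> e \<longlonglongrightarrow> 0 \<and>
    (\<forall>n. 0 \<le> fst (e n) \<and> t0 + fst (e n) < T \<and> x0 + snd (e n) \<in> closure U \<and> norm (e n) \<le> 1) \<and>
    (\<lambda>n. w2 (t0 + fst (e n)) (x0 + snd (e n))) \<longlonglongrightarrow> w2 t0 x0 \<and>
    (\<forall>n. real (N n) * norm (snd (e n)) \<le> \<theta>) \<and> open V \<and> x0 \<in> V \<and> \<nu> > 0 \<and>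
    (\<forall>n. \<forall>y\<in>closure U \<inter> V. \<forall>v. real (N n) * norm v \<le> \<nu> \<longrightarrow> y + snd (e n) + v \<in> U)"
proof (cases "x0 \<in> U")
  case True
  then obtain s where s: "s > 0" "ball x0 s \<subseteq> U" using U openE by blast
  have "y + v \<in> U" if "y \<in> ball x0 (s/2)" "real (Suc n) * norm v \<le> s / 4" for y v n
  proof -
    have "norm v \<le> real (Suc n) * norm v" by (simp add: algebra_simps)
    then have "norm v < s / 2" using that(2) s(1) by linarith
    then have "dist x0 (y + v) < s" using that(1) norm_triangle_ineq4[of "x0 - y" v] by (simp add: dist_norm diff_diff_eq)
    then show ?thesis using s(2) by auto
  qed
  then show ?thesis using t0 x0 \<theta> s(1)
    by (intro exI[of _ "\<lambda>n. 0"] exI[of _ Suc] exI[of _ "ball x0 (s/2)"] exI[of _ "s/4"]) (auto simp del: of_nat_Suc)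
next
  case False
  then have fr: "x0 \<in> frontier U" using x0 U by (simp add: frontier_def interior_open)
  obtain B l lam where B: "open B" "x0 \<in> B"
    and lb: "Liminf (at_right 0) (\<lambda>\<epsilon>. ereal (norm (l \<epsilon>) / \<epsilon>)) < \<infinity>"
    and nt: "\<forall>\<psi>. ((\<lambda>\<epsilon>. norm (\<psi> \<epsilon>) / \<epsilon>) \<longlongrightarrow> 0) (at_right 0) \<longrightarrow>
          (\<exists>r>0. \<forall>y\<in>closure U \<inter> B. \<forall>\<epsilon>\<in>{0<..<r}. y + l \<epsilon> + \<psi> \<epsilon> \<in> U)"
    and lam: "\<forall>\<epsilon>>0. lam \<epsilon> \<ge> (0::real)" "(lam \<longlongrightarrow> 0) (at_right 0)"
    and w2: "((\<lambda>\<epsilon>. w2 (t0 + lam \<epsilon>) (x0 + l \<epsilon>)) \<longlongrightarrow> w2 t0 x0) (at_right 0)"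
    using R[unfolded class_R_def, rule_format, of t0 x0] t0 fr by auto
  obtain r \<nu> where r: "r > 0" "\<nu> > 0"
    and U': "\<And>y \<epsilon> v. y \<in> closure U \<inter> B \<Longrightarrow> 0 < \<epsilon> \<Longrightarrow> \<epsilon> < r \<Longrightarrow> norm v \<le> \<nu> * \<epsilon> \<Longrightarrow> y + l \<epsilon> + v \<in> U"
    using nontangential_uniform[OF nt] by blast
  obtain C0 :: nat where C0: "Liminf (at_right 0) (\<lambda>\<epsilon>. ereal (norm (l \<epsilon>) / \<epsilon>)) < ereal (real C0)"
    using lb less_PInf_Ex_of_nat by auto
  define C where "C = real C0 + 1"
  have C: "C > 0" by (simp add: C_def)
  \<comment> \<open>A finite liminf controls \<open>|l(\<epsilon>)|\<close> by
    \<open>C \<epsilon>\<close> only along some parameters tending to 0; these are the ones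
    selected.\<close>
  have freq: "frequently (\<lambda>\<epsilon>. norm (l \<epsilon>) / \<epsilon> < C) (at_right 0)"
  proof (rule ccontr)
    assume "\<not> ?thesis"
    then have "eventually (\<lambda>\<epsilon>. ereal C \<le> ereal (norm (l \<epsilon>) / \<epsilon>)) (at_right 0)" by (simp add: not_frequently not_less)
    then have "ereal C \<le> Liminf (at_right 0) (\<lambda>\<epsilon>. ereal (norm (l \<epsilon>) / \<epsilon>))" by (rule Liminf_bounded)
    also note C0
    finally show False by (simp add: C_def)
  qed
  define c where "c = \<theta> / C"
  have c: "c > 0" using \<theta> C by (simp add: c_def)
  \<comment> \<open>\<open>\<epsilon> < c / (n + 2)\<close> makes \<open>c / \<epsilon>\<close>
    exceed \<open>n + 2\<close>, so that its floor is above \<open>n\<close> and at least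
    \<open>c / (2 \<epsilon>)\<close>. The bounds \<open>1 / (2 C)\<close> and \<open>1/2\<close>
    keep the shift in the unit ball.\<close>
  have "\<forall>n::nat. \<exists>\<epsilon>. 0 < \<epsilon> \<and> \<epsilon> < r \<and> \<epsilon> < 1 / (2 * C) \<and> \<epsilon> < c / (real n + 2) \<and> norm (l \<epsilon>) / \<epsilon> < C \<and> lam \<epsilon> < min (T - t0) (1/2)"
  proof
    fix n :: nat
    define b where "b = min r (min (1 / (2 * C)) (c / (real n + 2)))"
    have b: "b > 0" using r C c by (simp add: b_def)
    have "eventually (\<lambda>\<epsilon>. 0 < \<epsilon> \<and> \<epsilon> < b) (at_right 0)"
      unfolding eventually_at_right_field using b by blast
    moreover have "eventually (\<lambda>\<epsilon>. lam \<epsilon> < min (T - t0) (1/2)) (at_right 0)"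
      by (rule order_tendstoD(2)[OF lam(2)]) (use t0 in simp)
    ultimately have "eventually (\<lambda>\<epsilon>. (0 < \<epsilon> \<and> \<epsilon> < b) \<and> lam \<epsilon> < min (T - t0) (1/2)) (at_right 0)" by (rule eventually_conj)
    from frequently_ex[OF frequently_eventually_frequently[OF freq this]]
    show "\<exists>\<epsilon>. 0 < \<epsilon> \<and> \<epsilon> < r \<and> \<epsilon> < 1 / (2 * C) \<and> \<epsilon> < c / (real n + 2) \<and> norm (l \<epsilon>) / \<epsilon> < C \<and> lam \<epsilon> < min (T - t0) (1/2)"
      unfolding b_def by auto
  qed
  from choice[OF this] obtain E where E: "\<forall>n. 0 < E n \<and> E n < r \<and> E n < 1 / (2 * C) \<and> E n < c / (real n + 2) \<and> norm (l (E n)) / E n < C \<and> lam (E n) < min (T - t0) (1/2)" ..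
  have E0: "E n > 0" "E n < r" "E n < 1 / (2 * C)" "E n < c / (real n + 2)" "lam (E n) < T - t0" "lam (E n) < 1/2" for n
    using E by auto
  have lE: "norm (l (E n)) \<le> C * E n" for n using E E0(1)[of n] by (simp add: divide_less_eq less_imp_le)
  have Elim: "E \<longlonglongrightarrow> 0"
  proof (rule tendsto_sandwich[OF _ _ tendsto_const])
    show "eventually (\<lambda>n. 0 \<le> E n) sequentially" using E0(1) by (simp add: less_imp_le)
    have "c / (real n + 2) \<le> c * inverse (real (Suc n))" for n using c by (simp add: field_simps)
    then have "E n \<le> c * inverse (real (Suc n))" for n using E0(4)[of n] by (meson less_imp_le order_trans)
    then show "eventually (\<lambda>n. E n \<le> c * inverse (real (Suc n))) sequentially" by simp
    show "(\<lambda>n. c * inverse (real (Suc n))) \<longlonglongrightarrow> 0"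
      using tendsto_mult[OF tendsto_const LIMSEQ_inverse_real_of_nat, of c] by simp
  qed
  then have Efl: "filterlim E (at_right 0) sequentially"
    unfolding filterlim_at using E0(1)[THEN less_imp_neq, THEN not_sym] E0(1) by (auto intro!: always_eventually)
  have llim: "(\<lambda>n. l (E n)) \<longlonglongrightarrow> 0"
  proof (rule Lim_null_comparison[OF always_eventually[OF allI[OF lE]]])
    show "(\<lambda>n. C * E n) \<longlonglongrightarrow> 0" using tendsto_mult[OF tendsto_const Elim, of C] by simp
  qed
  have lamlim: "(\<lambda>n. lam (E n)) \<longlonglongrightarrow> 0" by (rule filterlim_compose[OF lam(2) Efl])
  define e where "e = (\<lambda>n. (lam (E n), l (E n)))"
  \<comment> \<open>The structural assumption wants a natural number; \<open>c = \<theta> / C\<close> makes \<open>N |l|\<close> as small as required.\<close>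
  define N where "N = (\<lambda>n. nat \<lfloor>c / E n\<rfloor>)"
  have cE: "real n + 2 < c / E n" for n using E0(1,4)[of n] by (simp add: field_simps)
  have Nb: "real (N n) \<le> c / E n" "c / E n - 1 < real (N n)" for n
  proof -
    have "0 \<le> \<lfloor>c / E n\<rfloor>" using cE[of n] by simp
    then have "real (N n) = of_int \<lfloor>c / E n\<rfloor>" by (simp add: N_def)
    then show "real (N n) \<le> c / E n" "c / E n - 1 < real (N n)" by linarith+
  qed
  show ?thesis
  \<comment> \<open>The factor 1/2 in the last witness comes from
    \<open>N n \<ge> c / (2 E n)\<close>: then \<open>N |v| \<le> \<nu> c / 2\<close> implies
    \<open>|v| \<le> \<nu> E n\<close>.\<close>
  proof (intro exI[of _ e] exI[of _ N] exI[of _ B] exI[of _ "\<nu> * c / 2"] conjI allI ballI impI B)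
    show "n < N n" for n
    proof -
      have "real n < real (N n)" using cE[of n] Nb(2)[of n] by linarith
      then show ?thesis by simp
    qed
    show "e \<longlonglongrightarrow> 0" unfolding e_def zero_prod_def by (intro tendsto_Pair lamlim llim)
    show "0 \<le> fst (e n)" for n using lam(1) E0(1) by (simp add: e_def)
    show "t0 + fst (e n) < T" for n using E0(5)[of n] by (simp add: e_def)
    have "x0 + l (E n) + 0 \<in> U" for n by (rule U') (use x0 B E0 r in \<open>auto simp: less_imp_le\<close>)
    then show "x0 + snd (e n) \<in> closure U" for n using closure_subset[of U] by (auto simp: e_def)
    show "norm (e n) \<le> 1" for n
    proof -
      have "C * E n < 1/2" using E0(3)[of n] C by (simp add: field_simps)
      moreover have "\<bar>lam (E n)\<bar> < 1/2" using E0(6)[of n] lam(1) E0(1)[of n] by auto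
      moreover have "norm (e n) \<le> \<bar>lam (E n)\<bar> + norm (l (E n))"
        unfolding e_def using norm_Pair_le[of "lam (E n)" "l (E n)"] by simp
      ultimately show ?thesis using lE[of n] by linarith
    qed
    show "(\<lambda>n. w2 (t0 + fst (e n)) (x0 + snd (e n))) \<longlonglongrightarrow> w2 t0 x0"
      unfolding e_def fst_conv snd_conv by (rule filterlim_compose[OF w2 Efl])
    show "real (N n) * norm (snd (e n)) \<le> \<theta>" for n
    proof -
      have "real (N n) * norm (l (E n)) \<le> c / E n * (C * E n)"
        using Nb(1)[of n] lE[of n] c E0(1)[of n] by (intro mult_mono) auto
      also have "\<dots> = \<theta>" using E0(1)[of n] C by (simp add: c_def)
      finally show ?thesis by (simp add: e_def)
    qed
    show "\<nu> * c / 2 > 0" using r c by simp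
    fix n and y v :: "real^'n" assume y: "y \<in> closure U \<inter> B" and v: "real (N n) * norm v \<le> \<nu> * c / 2"
    have "c / (2 * E n) \<le> real (N n)"
    proof -
      have "c / (2 * E n) = c / E n / 2" by simp
      then show ?thesis using cE[of n] Nb(2)[of n] by linarith
    qed
    then have "c / (2 * E n) * norm v \<le> real (N n) * norm v" by (rule mult_right_mono) simp
    then have "c / (2 * E n) * norm v \<le> \<nu> * c / 2" using v by linarith
    then have "c / (2 * E n) * norm v * (2 * E n) \<le> \<nu> * c / 2 * (2 * E n)" using E0(1)[of n] by (intro mult_right_mono) auto
    then have "c * norm v \<le> c * (\<nu> * E n)" using E0(1)[of n] by (simp add: mult_ac)
    then have "norm v \<le> \<nu> * E n" using c by simp
    then show "y + snd (e n) + v \<in> U" using U'[OF y E0(1,2)] by (simp add: e_def)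
  qed
qed


section \<open>Growth bounds and the penalised maximum\<close>

lemma power_le_one_plus_square_power:
  fixes a :: real
  assumes "0 \<le> a" "k \<le> m"
  shows "1 + a ^ k \<le> 2 * (1 + a\<^sup>2) ^ m"
proof -
  have b: "1 \<le> 1 + a\<^sup>2" "a \<le> 1 + a\<^sup>2"
    using zero_le_power2[of "a - 1"] zero_le_power2[of a] assms(1) by (simp_all add: power2_diff)
  have "a ^ k \<le> (1 + a\<^sup>2) ^ k" using assms b(2) by (intro power_mono) auto
  also have "\<dots> \<le> (1 + a\<^sup>2) ^ m" using b(1) assms by (intro power_increasing) auto
  finally show ?thesis using one_le_power[OF b(1), of m] by linarith
qed

lemma poly_growth_bound:
  assumes "poly_growth T U w1" "poly_growth T U w2"
  shows "\<exists>C m. C \<ge> 0 \<and> (\<forall>t\<in>{0..T}. \<forall>x\<in>closure U. w1 t x - w2 t x \<le> C * (1 + (norm x)\<^sup>2) ^ m)"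
proof -
  obtain C1 k1 where 1: "\<And>t x. t \<in> {0..T} \<Longrightarrow> x \<in> closure U \<Longrightarrow> \<bar>w1 t x\<bar> \<le> C1 * (1 + norm x ^ k1)"
    using assms(1) unfolding poly_growth_def by blast
  obtain C2 k2 where 2: "\<And>t x. t \<in> {0..T} \<Longrightarrow> x \<in> closure U \<Longrightarrow> \<bar>w2 t x\<bar> \<le> C2 * (1 + norm x ^ k2)"
    using assms(2) unfolding poly_growth_def by blast
  define m where "m = max k1 k2"
  have "w1 t x - w2 t x \<le> (2 * \<bar>C1\<bar> + 2 * \<bar>C2\<bar>) * (1 + (norm x)\<^sup>2) ^ m" if tx: "t \<in> {0..T}" "x \<in> closure U" for t x
  proof -
    have b: "C * (1 + norm x ^ k) \<le> 2 * \<bar>C\<bar> * (1 + (norm x)\<^sup>2) ^ m" if "k \<le> m" for C k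
    proof -
      have "C * (1 + norm x ^ k) \<le> \<bar>C\<bar> * (1 + norm x ^ k)" by (intro mult_right_mono) auto
      also have "\<dots> \<le> \<bar>C\<bar> * (2 * (1 + (norm x)\<^sup>2) ^ m)"
        using that by (intro mult_left_mono power_le_one_plus_square_power) auto
      finally show ?thesis by simp
    qed
    have "k1 \<le> m" "k2 \<le> m" by (simp_all add: m_def)
    then show ?thesis using 1[OF tx] 2[OF tx] b[of k1 C1] b[of k2 C2] by (simp add: distrib_right)
  qed
  then show ?thesis by (intro exI[of _ "2 * \<bar>C1\<bar> + 2 * \<bar>C2\<bar>"] exI[of _ m]) auto
qed

lemma penalty_ge_power: "\<kappa> \<ge> 0 \<Longrightarrow> fst z \<le> T \<Longrightarrow> (1 + (norm (snd z))\<^sup>2) ^ m \<le> penalty T \<kappa> m z"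
proof -
  assume "\<kappa> \<ge> 0" "fst z \<le> T"
  then have "1 \<le> exp (\<kappa> * (T - fst z))" by simp
  moreover have "0 \<le> (1 + (norm (snd z))\<^sup>2) ^ m" by (intro zero_le_power) (simp add: add_nonneg_nonneg)
  ultimately show ?thesis unfolding penalty_def using mult_right_mono by fastforce
qed

lemma continuous_on_penalty: "continuous_on S (penalty T \<kappa> m)"
  unfolding penalty_def by (intro continuous_intros)

text \<open>The penalty has one power of \<open>1 + |x|\<^sup>2\<close> more than the growth bound,
  so the penalised difference is nonpositive outside a ball while it is positive at
  \<open>zs\<close>; a maximum over a compact set is therefore global.\<close>

lemma penalized_difference_attains_max:
  fixes w1 w2 :: "real \<Rightarrow> real^'n \<Rightarrow> real" and U :: "(real^'n) set"
  assumes w1: "usc_on ({0..T} \<times> closure U) (\<lambda>z. w1 (fst z) (snd z))"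
    and w2: "lsc_on ({0..T} \<times> closure U) (\<lambda>z. w2 (fst z) (snd z))"
    and C: "C \<ge> 0" "\<And>t x. t \<in> {0..T} \<Longrightarrow> x \<in> closure U \<Longrightarrow> w1 t x - w2 t x \<le> C * (1 + (norm x)\<^sup>2) ^ m"
    and \<delta>: "\<delta> > 0" and \<kappa>: "\<kappa> \<ge> 0"
    and zs: "zs \<in> {0..T} \<times> closure U"
      "0 < w1 (fst zs) (snd zs) - w2 (fst zs) (snd zs) - \<delta> * penalty T \<kappa> (Suc m) zs"
  shows "\<exists>z0 \<in> {0..T} \<times> closure U.
     0 < w1 (fst z0) (snd z0) - w2 (fst z0) (snd z0) - \<delta> * penalty T \<kappa> (Suc m) z0 \<and>
     (\<forall>z\<in>{0..T} \<times> closure U. w1 (fst z) (snd z) - w2 (fst z) (snd z) - \<delta> * penalty T \<kappa> (Suc m) z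
        \<le> w1 (fst z0) (snd z0) - w2 (fst z0) (snd z0) - \<delta> * penalty T \<kappa> (Suc m) z0)"
proof -
  define \<Phi> where "\<Phi> = (\<lambda>z. w1 (fst z) (snd z) - w2 (fst z) (snd z) - \<delta> * penalty T \<kappa> (Suc m) z)"
  define D where "D = {0..T} \<times> closure U"
  \<comment> \<open>\<open>|x| > C / \<delta> + 1\<close> gives \<open>|x| \<ge> 1\<close> and hence
    \<open>\<delta> (1 + |x|\<^sup>2) \<ge> C\<close>; the second entry keeps \<open>zs\<close>
    inside the ball.\<close>
  define R where "R = max (C / \<delta> + 1) (norm (snd zs))"
  define K where "K = {0..T} \<times> (closure U \<inter> cball 0 R)"
  have KD: "K \<subseteq> D" by (auto simp: K_def D_def)
  have "compact K" unfolding K_def by (intro compact_Times compact_Icc closed_Int_compact closed_closure compact_cball)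
  moreover have zK: "zs \<in> K" using zs(1) by (auto simp: K_def R_def)
  moreover have "usc_on D (\<lambda>z. (w1 (fst z) (snd z) + - w2 (fst z) (snd z)) + (- (\<delta> * penalty T \<kappa> (Suc m) z)))"
    by (intro usc_on_add_continuous usc_on_add continuous_intros continuous_on_penalty)
       (use w1 usc_on_minus_if_lsc_on[OF w2] in \<open>simp_all add: D_def\<close>)
  then have "usc_on K \<Phi>" using usc_on_subset[OF _ KD] by (simp add: \<Phi>_def)
  ultimately obtain z0 where z0: "z0 \<in> K" "\<And>z. z \<in> K \<Longrightarrow> \<Phi> z \<le> \<Phi> z0" using usc_attains_max[of K \<Phi>] by blast
  have pos: "0 < \<Phi> z0" using z0(2)[OF zK] zs(2) by (simp add: \<Phi>_def)
  have "\<Phi> z \<le> \<Phi> z0" if z: "z \<in> D" for z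
  proof (cases "z \<in> K")
    case False
    define s where "s = 1 + (norm (snd z))\<^sup>2"
    have tz: "fst z \<in> {0..T}" "snd z \<in> closure U" using z by (auto simp: D_def)
    then have "R < norm (snd z)" using False by (cases z) (auto simp: K_def)
    then have n: "C / \<delta> + 1 < norm (snd z)" by (simp add: R_def)
    have s0: "s > 0" by (simp add: s_def add_pos_nonneg)
    have "0 \<le> C / \<delta>" using C \<delta> by simp
    then have "1 \<le> norm (snd z)" using n by linarith
    then have "norm (snd z) \<le> (norm (snd z))\<^sup>2" by (intro self_le_power) auto
    then have "C / \<delta> \<le> s" using n by (simp add: s_def)
    then have "C \<le> \<delta> * s" using \<delta> by (simp add: field_simps)
    then have "C * s ^ m \<le> \<delta> * s * s ^ m" using s0 by (intro mult_right_mono) auto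
    also have "\<dots> = \<delta> * s ^ Suc m" by simp
    also have "\<dots> \<le> \<delta> * penalty T \<kappa> (Suc m) z"
      unfolding s_def using \<delta> \<kappa> tz by (intro mult_left_mono penalty_ge_power) auto
    finally have "\<Phi> z \<le> 0" using C(2)[OF tz] by (simp add: \<Phi>_def s_def)
    then show ?thesis using pos by simp
  qed (rule z0(2))
  then show ?thesis using pos z0(1) KD unfolding \<Phi>_def D_def by blast
qed

text \<open>The choice of \<open>\<kappa>\<close>: the term \<open>\<kappa> f0\<close> produced by the time derivative of the penalty absorbs
  what the structural assumption yields for its space derivatives.\<close>

lemma comparison_arithmetic:
  fixes x x0 :: "real^'n" and d e :: "real \<times> (real^'n)"
  assumes gap: "\<rho> * W - (fst a1 + fst a2) \<le>
    \<alpha> * (norm (x - y) * (1 + norm (snd a2) + n\<^sup>2 * norm (x - y))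
         + (1 + norm x) * norm (snd a1 + snd a2) + (1 + (norm x)\<^sup>2) * (\<bar>c\<bar> * cD))"
    and a1: "a1 = n\<^sup>2 *\<^sub>R d + (\<delta> * f0) *\<^sub>R (- \<kappa>, (2 * m / s0) *\<^sub>R x) + (2 * \<epsilon>) *\<^sub>R ((t, x) - (t0, x0))"
    and a2: "a2 = - (n\<^sup>2 *\<^sub>R d)" and c: "c = 2 * (\<delta> * f0 * (m + 18 * m\<^sup>2) / s0 + \<epsilon>)"
    and s0: "s0 = 1 + (norm x)\<^sup>2" and \<kappa>: "\<kappa> = \<alpha> * (4 * m + 2 * cD * (m + 18 * m\<^sup>2))"
    and pos: "\<alpha> > 0" "\<delta> > 0" "f0 > 0" "\<epsilon> > 0" "m \<ge> 0" "cD \<ge> 0" "n > 0"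
    and d: "snd d = x - y + snd e" "n * norm (snd e) \<le> \<theta>" "n * norm d \<le> \<beta>" "\<theta> \<ge> 0"
  shows "\<rho> * W \<le> 2 * \<epsilon> * \<bar>t - t0\<bar> + \<alpha> * (norm (x - y) + (\<beta> + \<theta>) * (2 * \<beta> + \<theta>))
     + 2 * \<alpha> * \<epsilon> * ((1 + norm x) * norm (x - x0)) + 2 * \<alpha> * \<epsilon> * cD * (1 + (norm x)\<^sup>2)"
proof -
  have s0p: "s0 > 0" by (simp add: s0 add_pos_nonneg)
  have nsd: "n * norm (snd d) \<le> \<beta>"
  proof -
    have "norm (snd d) \<le> norm d" using norm_snd_le[of "snd d" "fst d"] by simp
    then have "n * norm (snd d) \<le> n * norm d" using pos by (intro mult_left_mono) auto
    then show ?thesis using d(3) by linarith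
  qed
  have nsd0: "0 \<le> n * norm (snd d)" using pos by simp
  have nxy: "n * norm (x - y) \<le> \<beta> + \<theta>"
  proof -
    have "norm (x - y) \<le> norm (snd d) + norm (snd e)"
      using norm_triangle_ineq4[of "snd d" "snd e"] by (simp add: d(1))
    then have "n * norm (x - y) \<le> n * (norm (snd d) + norm (snd e))" using pos by (intro mult_left_mono) auto
    then show ?thesis using nsd d(2) by (simp add: distrib_left)
  qed
  \<comment> \<open>The coupling part. When \<open>|x - y|\<close> and \<open>\<beta>\<close> tend
    to 0, \<open>\<theta>\<^sup>2\<close> remains of it.\<close>
  have T1: "norm (x - y) * (1 + norm (snd a2) + n\<^sup>2 * norm (x - y)) \<le> norm (x - y) + (\<beta> + \<theta>) * (2 * \<beta> + \<theta>)"
  proof -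
    have "norm (x - y) * (1 + norm (snd a2) + n\<^sup>2 * norm (x - y)) =
      norm (x - y) + (n * norm (x - y)) * (n * norm (snd d) + n * norm (x - y))"
      using pos by (simp add: a2 power2_eq_square algebra_simps)
    also have "(n * norm (x - y)) * (n * norm (snd d) + n * norm (x - y)) \<le> (\<beta> + \<theta>) * (\<beta> + (\<beta> + \<theta>))"
    proof -
      have "0 \<le> \<beta>" using nsd nsd0 by linarith
      moreover have "0 \<le> n * norm (x - y)" using pos by simp
      ultimately show ?thesis using nsd nxy nsd0 d(4) by (intro mult_mono add_mono) linarith+
    qed
    finally show ?thesis by (simp add: algebra_simps)
  qed
  have T2: "(1 + norm x) * norm (snd a1 + snd a2) \<le> \<delta> * f0 * (4 * m) + 2 * \<epsilon> * ((1 + norm x) * norm (x - x0))"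
  proof -
    have "snd a1 + snd a2 = (\<delta> * f0 * (2 * m / s0)) *\<^sub>R x + (2 * \<epsilon>) *\<^sub>R (x - x0)" by (simp add: a1 a2)
    then have "norm (snd a1 + snd a2) \<le> \<delta> * f0 * (2 * m / s0) * norm x + 2 * \<epsilon> * norm (x - x0)"
      using norm_triangle_ineq[of "(\<delta> * f0 * (2 * m / s0)) *\<^sub>R x" "(2 * \<epsilon>) *\<^sub>R (x - x0)"] pos s0p by simp
    then have "(1 + norm x) * norm (snd a1 + snd a2) \<le> (1 + norm x) * (\<delta> * f0 * (2 * m / s0) * norm x + 2 * \<epsilon> * norm (x - x0))"
      by (intro mult_left_mono) auto
    also have "\<dots> = \<delta> * f0 * (2 * m) * ((1 + norm x) * norm x / s0) + 2 * \<epsilon> * ((1 + norm x) * norm (x - x0))"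
      by (simp add: algebra_simps)
    \<comment> \<open>This 2 turns the factor \<open>2 m\<close> of the penalty's gradient into the
      summand \<open>4 m\<close> of \<open>\<kappa>\<close>.\<close>
    also have "(1 + norm x) * norm x / s0 \<le> 2"
      using s0p sum_squares_bound[of "norm x" 1] zero_le_power2[of "norm x"]
      by (simp add: divide_le_eq s0 distrib_right power2_eq_square) 
    then have "\<delta> * f0 * (2 * m) * ((1 + norm x) * norm x / s0) \<le> \<delta> * f0 * (2 * m) * 2" using pos by (intro mult_left_mono) auto
    finally show ?thesis by simp
  qed
  have T3: "(1 + (norm x)\<^sup>2) * (\<bar>c\<bar> * cD) = \<delta> * f0 * (2 * cD * (m + 18 * m\<^sup>2)) + 2 * \<epsilon> * cD * (1 + (norm x)\<^sup>2)"
  proof -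
    have "c \<ge> 0" unfolding c using pos s0p by simp
    then have "(1 + (norm x)\<^sup>2) * (\<bar>c\<bar> * cD) = 2 * cD * (s0 * (\<delta> * f0 * (m + 18 * m\<^sup>2) / s0)) + 2 * \<epsilon> * cD * s0"
      by (simp add: c s0[symmetric] algebra_simps)
    also have "s0 * (\<delta> * f0 * (m + 18 * m\<^sup>2) / s0) = \<delta> * f0 * (m + 18 * m\<^sup>2)" using s0p by simp
    finally show ?thesis by (simp add: s0 mult_ac)
  qed
  have "\<alpha> * (norm (x - y) * (1 + norm (snd a2) + n\<^sup>2 * norm (x - y))
         + (1 + norm x) * norm (snd a1 + snd a2) + (1 + (norm x)\<^sup>2) * (\<bar>c\<bar> * cD)) \<le>
    \<alpha> * ((norm (x - y) + (\<beta> + \<theta>) * (2 * \<beta> + \<theta>)) + (\<delta> * f0 * (4 * m) + 2 * \<epsilon> * ((1 + norm x) * norm (x - x0)))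
         + (\<delta> * f0 * (2 * cD * (m + 18 * m\<^sup>2)) + 2 * \<epsilon> * cD * (1 + (norm x)\<^sup>2)))"
    using T1 T2 T3 pos by (intro mult_left_mono add_mono) auto
  also have "\<dots> = \<alpha> * (norm (x - y) + (\<beta> + \<theta>) * (2 * \<beta> + \<theta>)) + \<delta> * f0 * \<kappa>
     + 2 * \<alpha> * \<epsilon> * ((1 + norm x) * norm (x - x0)) + 2 * \<alpha> * \<epsilon> * cD * (1 + (norm x)\<^sup>2)"
    unfolding \<kappa> by (simp only: distrib_left) (simp add: mult_ac)
  finally have "\<rho> * W - (fst a1 + fst a2) \<le> \<dots>" using gap by linarith
  \<comment> \<open>The time slopes of the coupling cancel. That of the penalty contributes
    \<open>- \<delta> f0 \<kappa>\<close>, which cancels the term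
    \<open>\<delta> f0 \<kappa>\<close> produced above by its space derivatives.\<close>
  moreover have "fst a1 + fst a2 = - (\<delta> * f0 * \<kappa>) + 2 * \<epsilon> * (t - t0)" by (simp add: a1 a2)
  moreover have "2 * \<epsilon> * (t - t0) \<le> 2 * \<epsilon> * \<bar>t - t0\<bar>" using pos by (intro mult_left_mono) auto
  ultimately show ?thesis by linarith
qed


section \<open>The comparison argument\<close>

theorem mainTheorem17:
  fixes U :: "(real^'n) set" and \<rho> T :: real
    and H :: "real^'n \<Rightarrow> real^'n \<Rightarrow> real^'n^'n \<Rightarrow> real"
    and w1 w2 :: "real \<Rightarrow> real^'n \<Rightarrow> real"
  assumes "open U" and "\<rho> > 0"
    and "continuous_on UNIV (\<lambda>(x, p, X). H x p X)"
    and "\<And>x p X Y. sym_mat X \<Longrightarrow> sym_mat Y \<Longrightarrow> mat_le X Y \<Longrightarrow> H x p Y \<le> H x p X"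
    and "assumption_E U H"
    and "usc_on ({0..T} \<times> closure U) (\<lambda>(t, x). w1 t x)"
    and "visc_sub \<rho> H w1 ({0..<T} \<times> closure U)"
    and "lsc_on ({0..T} \<times> closure U) (\<lambda>(t, x). w2 t x)"
    and "visc_super \<rho> H w2 ({0..<T} \<times> U)"
    and "poly_growth T U w1" and "poly_growth T U w2"
    and "class_R T U w2"
    and "\<forall>x\<in>closure U. w1 T x \<le> w2 T x"
  shows "\<forall>t\<in>{0..T}. \<forall>x\<in>closure U. w1 t x \<le> w2 t x"
proof (rule ccontr)
  assume "\<not> ?thesis"
  then obtain ts xs where zs: "ts \<in> {0..T}" "xs \<in> closure U" "w2 ts xs < w1 ts xs" by (auto simp: not_le)
  define W1 where "W1 = (\<lambda>z. w1 (fst z) (snd z))"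
  define W2 where "W2 = (\<lambda>z. w2 (fst z) (snd z))"
  define D where "D = {0..T} \<times> closure U"
  have usc: "usc_on D W1" using assms(6) by (simp add: D_def W1_def case_prod_beta')
  have lsc: "lsc_on D W2" using assms(8) by (simp add: D_def W2_def case_prod_beta')
  obtain \<alpha> where \<alpha>: "\<alpha> > 0" and E0: "\<forall>x\<in>closure U. \<forall>y\<in>closure U. norm (x - y) \<le> 1 \<longrightarrow>
     (\<forall>p q Q (n::nat) Xf Yf. sym_mat Q \<longrightarrow> n \<ge> 1 \<longrightarrow>
        (\<forall>\<eta>>0. sym_mat (Xf \<eta>) \<and> sym_mat (Yf \<eta>) \<and>
           mat_le (blk_diag (Xf \<eta>) (Yf \<eta>))
                  (A_mat n Q + \<eta> *\<^sub>R (A_mat n Q ** A_mat n Q))) \<longrightarrow>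
        Liminf (at_right 0) (\<lambda>\<eta>. ereal (H y q (Yf \<eta>) - H x p (Xf \<eta>)))
          \<le> ereal (\<alpha> * (norm (x - y) * (1 + norm q + real n ^ 2 * norm (x - y))
                        + (1 + norm x) * norm (p - q) + (1 + norm x ^ 2) * norm Q)))"
    using assms(5) unfolding assumption_E_def by blast
  have E: "Liminf (at_right 0) (\<lambda>\<eta>. ereal (H y q (Yf \<eta>) - H x p (Xf \<eta>)))
          \<le> ereal (\<alpha> * (norm (x - y) * (1 + norm q + real n ^ 2 * norm (x - y))
                        + (1 + norm x) * norm (p - q) + (1 + norm x ^ 2) * norm Q))"
    if "x \<in> closure U" "y \<in> closure U" "norm (x - y) \<le> 1" "sym_mat Q" "n \<ge> 1"
      "\<forall>\<eta>>0. sym_mat (Xf \<eta>) \<and> sym_mat (Yf \<eta>) \<and>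
           mat_le (blk_diag (Xf \<eta>) (Yf \<eta>)) (A_mat n Q + \<eta> *\<^sub>R (A_mat n Q ** A_mat n Q))"
    for x y p q Q and n :: nat and Xf Yf
    by (rule E0[THEN bspec, OF that(1), THEN bspec, OF that(2), THEN mp, OF that(3), THEN spec[of _ p],
        THEN spec[of _ q], THEN spec[of _ Q], THEN spec[of _ n], THEN spec[of _ Xf], THEN spec[of _ Yf],
        THEN mp, OF that(4), THEN mp, OF that(5), THEN mp, OF that(6)])
  obtain C m0 where C: "C \<ge> 0" "\<And>t x. t \<in> {0..T} \<Longrightarrow> x \<in> closure U \<Longrightarrow> w1 t x - w2 t x \<le> C * (1 + (norm x)\<^sup>2) ^ m0"
    using poly_growth_bound[OF assms(10,11)] by blast
  define m where "m = Suc m0"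
  define cD where "cD = norm (corner :: real^('n + 'n)^('n + 'n))"
  define \<kappa> where "\<kappa> = \<alpha> * (4 * real m + 2 * cD * (real m + 18 * (real m)\<^sup>2))"
  have cD: "cD \<ge> 0" by (simp add: cD_def)
  have \<kappa>: "\<kappa> \<ge> 0" unfolding \<kappa>_def using \<alpha> cD by (intro mult_nonneg_nonneg add_nonneg_nonneg) auto
  define f :: "real \<times> (real^'n) \<Rightarrow> real" where "f = penalty T \<kappa> m"
  have fpos: "f z > 0" for z :: "real \<times> (real^'n)" unfolding f_def by (rule penalty_pos)
  \<comment> \<open>The penalty takes away half of the positive gap at
    \<open>(ts, xs)\<close>.\<close>
  define \<delta> where "\<delta> = (w1 ts xs - w2 ts xs) / (2 * f (ts, xs))"
  have \<delta>: "\<delta> > 0" using zs fpos[of "(ts, xs)"] by (simp add: \<delta>_def)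
  have "\<delta> * f (ts, xs) = (w1 ts xs - w2 ts xs) / 2" using fpos[of "(ts, xs)"] by (simp add: \<delta>_def)
  then have "0 < w1 (fst (ts, xs)) (snd (ts, xs)) - w2 (fst (ts, xs)) (snd (ts, xs)) - \<delta> * penalty T \<kappa> (Suc m0) (ts, xs)"
    using zs by (simp add: f_def m_def)
  then obtain z0 where z0: "z0 \<in> D" and M0: "0 < W1 z0 - W2 z0 - \<delta> * f z0"
    and zmax: "\<And>z. z \<in> D \<Longrightarrow> W1 z - W2 z - \<delta> * f z \<le> W1 z0 - W2 z0 - \<delta> * f z0"
    using penalized_difference_attains_max[of T U w1 w2 C m0 \<delta> \<kappa> "(ts, xs)"] usc lsc C \<delta> \<kappa> zs
    unfolding D_def W1_def W2_def f_def m_def by (metis (no_types, lifting) mem_Sigma_iff)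
  define M where "M = W1 z0 - W2 z0 - \<delta> * f z0"
  have M: "M > 0" using M0 by (simp add: M_def)
  obtain t0 x0 where zz: "z0 = (t0, x0)" by (cases z0)
  have t0: "0 \<le> t0" "t0 \<le> T" and x0: "x0 \<in> closure U" using z0 by (auto simp: D_def zz)
  have t0T: "t0 < T"
  proof (rule ccontr)
    assume "\<not> t0 < T"
    then have "t0 = T" using t0 by simp
    then have "W1 z0 \<le> W2 z0" using assms(13) x0 by (simp add: W1_def W2_def zz)
    moreover have "\<delta> * f z0 > 0" using \<delta> fpos by simp
    ultimately show False using M0 by simp
  qed
  \<comment> \<open>In the limit, \<open>\<alpha> \<theta>\<^sup>2\<close> and one term with
    \<open>\<epsilon>\<close> remain on the right. The choices of \<open>\<theta>\<close> and
    \<open>\<epsilon>\<close> make them at most \<open>\<rho> M / 4\<close> and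
    \<open>\<rho> M / 8\<close>, together less than \<open>\<rho> M\<close>.\<close>
  define \<theta> where "\<theta> = sqrt (\<rho> * M / (4 * \<alpha>))"
  have \<theta>: "\<theta> > 0" "\<alpha> * \<theta>\<^sup>2 = \<rho> * M / 4" using assms(2) M \<alpha> by (simp_all add: \<theta>_def)
  define \<epsilon> where "\<epsilon> = \<rho> * M / (16 * \<alpha> * (cD + 1) * (1 + (norm x0)\<^sup>2))"
  have x01: "1 + (norm x0)\<^sup>2 > 0" by (simp add: add_pos_nonneg)
  have \<epsilon>: "\<epsilon> > 0" unfolding \<epsilon>_def using assms(2) M \<alpha> cD x01 by (intro divide_pos_pos mult_pos_pos) auto
  have \<epsilon>': "2 * \<alpha> * \<epsilon> * cD * (1 + (norm x0)\<^sup>2) \<le> \<rho> * M / 8"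
  proof -
    have "16 * \<alpha> * (cD + 1) * (1 + (norm x0)\<^sup>2) \<noteq> 0" using \<alpha> cD x01 by simp
    then have "\<epsilon> * (16 * \<alpha> * (cD + 1) * (1 + (norm x0)\<^sup>2)) = \<rho> * M" unfolding \<epsilon>_def by (metis nonzero_eq_divide_eq)
    moreover have "2 * \<alpha> * \<epsilon> * cD * (1 + (norm x0)\<^sup>2) \<le> 2 * \<alpha> * \<epsilon> * (cD + 1) * (1 + (norm x0)\<^sup>2)"
      using \<alpha> \<epsilon> x01 by (intro mult_right_mono mult_left_mono) auto
    moreover have "\<epsilon> * (16 * \<alpha> * (cD + 1) * (1 + (norm x0)\<^sup>2)) = 8 * (2 * \<alpha> * \<epsilon> * (cD + 1) * (1 + (norm x0)\<^sup>2))"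
      by simp
    ultimately show ?thesis by linarith
  qed
  obtain e :: "nat \<Rightarrow> real \<times> (real^'n)" and N :: "nat \<Rightarrow> nat" and V \<nu> where
    approach: "(\<forall>n. n < N n) \<and> e \<longlonglongrightarrow> 0 \<and>
    (\<forall>n. 0 \<le> fst (e n) \<and> t0 + fst (e n) < T \<and> x0 + snd (e n) \<in> closure U \<and> norm (e n) \<le> 1) \<and>
    (\<lambda>n. w2 (t0 + fst (e n)) (x0 + snd (e n))) \<longlonglongrightarrow> w2 t0 x0 \<and>
    (\<forall>n. real (N n) * norm (snd (e n)) \<le> \<theta>) \<and> open V \<and> x0 \<in> V \<and> \<nu> > 0 \<and>
    (\<forall>n. \<forall>y\<in>closure U \<inter> V. \<forall>v. real (N n) * norm v \<le> \<nu> \<longrightarrow> y + snd (e n) + v \<in> U)"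
    using class_R_approach[OF assms(1,12) t0(1) t0T x0 \<theta>(1)] apply -
    apply (erule exE)+
    apply (erule that)
    done
  have N: "n < N n" for n using approach by simp
  have e: "0 \<le> fst (e n)" "t0 + fst (e n) < T" "x0 + snd (e n) \<in> closure U" "norm (e n) \<le> 1" for n
    using approach by simp_all
  have el: "e \<longlonglongrightarrow> 0" and we: "(\<lambda>n. w2 (t0 + fst (e n)) (x0 + snd (e n))) \<longlonglongrightarrow> w2 t0 x0"
    and Ne: "\<And>n. real (N n) * norm (snd (e n)) \<le> \<theta>" and V: "open V" "x0 \<in> V" and \<nu>: "\<nu> > 0"
    using approach by simp_all
  have nt: "y + snd (e n) + v \<in> U" if "y \<in> closure U \<inter> V" "real (N n) * norm v \<le> \<nu>" for n y v
    using approach that by (elim conjE) blast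
  have N1: "real (N n) > 0" "N n \<ge> 1" for n using N[of n] by simp_all
  have Nl: "filterlim (\<lambda>n. real (N n)) at_top sequentially"
    by (rule filterlim_at_top_mono[OF filterlim_real_sequentially])
       (use N in \<open>auto intro!: always_eventually less_imp_le\<close>)
  \<comment> \<open>The coupling is only quadratic and cannot control the growth of \<open>- w2\<close>, so the doubled
    function is maximised over a compact neighbourhood of \<open>z0\<close>.\<close>
  define K where "K = D \<inter> cball z0 1"
  have Dc: "closed D" unfolding D_def by (intro closed_Times) auto
  have Kc: "compact K" unfolding K_def using Dc by (intro closed_Int_compact compact_cball)
  have z0K: "z0 \<in> K" using z0 by (simp add: K_def)
  have eK: "z0 + e n \<in> K" for n
    using e(1)[of n] e(2)[of n] e(3)[of n] e(4)[of n] t0 by (cases "e n") (auto simp: K_def D_def zz dist_norm norm_Pair)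
  \<comment> \<open>The square with factor \<open>\<epsilon>\<close> makes \<open>z0\<close> the
    only maximiser of \<open>F - W2\<close> on \<open>K\<close>, as
    \<open>doubling_maximizers_converge\<close> requires.\<close>
  define F where "F = (\<lambda>z. W1 z - \<delta> * f z - \<epsilon> * (norm (z - z0))\<^sup>2)"
  have cf: "continuous_on S f" for S unfolding f_def by (rule continuous_on_penalty)
  have FK: "usc_on K F"
  proof -
    have "usc_on K (\<lambda>z. W1 z + (- (\<delta> * f z) - \<epsilon> * (norm (z - z0))\<^sup>2))"
      by (intro usc_on_add_continuous continuous_intros cf) (rule usc_on_subset[OF usc], auto simp: K_def)
    then show ?thesis by (simp add: F_def algebra_simps)
  qed
  have gK: "lsc_on K W2" using lsc unfolding lsc_on_def K_def by (meson IntD1 at_le filter_leD inf_le1)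
  have strict: "F z - W2 z < F z0 - W2 z0" if "z \<in> K" "z \<noteq> z0" for z
  proof -
    have "0 < \<epsilon> * (norm (z - z0))\<^sup>2" using \<epsilon> that(2) by simp
    then show ?thesis using zmax[of z] that(1) by (simp add: F_def K_def)
  qed
  have "\<forall>n. \<exists>p. p \<in> K \<times> K \<and> (\<forall>q\<in>K \<times> K. F (fst q) - W2 (snd q) - (real (N n))\<^sup>2 / 2 * (norm (fst q - snd q + e n))\<^sup>2
      \<le> F (fst p) - W2 (snd p) - (real (N n))\<^sup>2 / 2 * (norm (fst p - snd p + e n))\<^sup>2)"
  proof
    fix n
    have "usc_on (K \<times> K) (\<lambda>q. (F (fst q) + - W2 (snd q)) + - ((real (N n))\<^sup>2 / 2 * (norm (fst q - snd q + e n))\<^sup>2))"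
      by (intro usc_on_add_continuous usc_on_add usc_on_compose[OF FK] usc_on_compose[OF usc_on_minus_if_lsc_on[OF gK]] continuous_intros) auto
    then have "usc_on (K \<times> K) (\<lambda>q. F (fst q) - W2 (snd q) - (real (N n))\<^sup>2 / 2 * (norm (fst q - snd q + e n))\<^sup>2)" by simp
    moreover have "compact (K \<times> K)" "K \<times> K \<noteq> {}" using Kc z0K by (auto intro: compact_Times)
    ultimately show "\<exists>p. p \<in> K \<times> K \<and> (\<forall>q\<in>K \<times> K. F (fst q) - W2 (snd q) - (real (N n))\<^sup>2 / 2 * (norm (fst q - snd q + e n))\<^sup>2
      \<le> F (fst p) - W2 (snd p) - (real (N n))\<^sup>2 / 2 * (norm (fst p - snd p + e n))\<^sup>2)"
      using usc_attains_max by blast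
  qed
  from choice[OF this] obtain P where P: "\<forall>n. P n \<in> K \<times> K \<and> (\<forall>q\<in>K \<times> K. F (fst q) - W2 (snd q) - (real (N n))\<^sup>2 / 2 * (norm (fst q - snd q + e n))\<^sup>2
      \<le> F (fst (P n)) - W2 (snd (P n)) - (real (N n))\<^sup>2 / 2 * (norm (fst (P n) - snd (P n) + e n))\<^sup>2)" ..
  define Z where "Z = (\<lambda>n. fst (P n))"
  define Y where "Y = (\<lambda>n. snd (P n))"
  have ZY: "Z n \<in> K" "Y n \<in> K" for n using P by (auto simp: Z_def Y_def mem_Times_iff)
  have mx: "F z - W2 y - (real (N n))\<^sup>2 / 2 * (norm (z - y + e n))\<^sup>2 \<le>
        F (Z n) - W2 (Y n) - (real (N n))\<^sup>2 / 2 * (norm (Z n - Y n + e n))\<^sup>2" if "z \<in> K" "y \<in> K" for n z y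
  proof -
    have "(z, y) \<in> K \<times> K" using that by simp
    from P[THEN spec, THEN conjunct2, THEN bspec, OF this, of n] show ?thesis by (simp add: Z_def Y_def)
  qed
  have W2e: "(\<lambda>n. W2 (z0 + e n)) \<longlonglongrightarrow> W2 z0" using we by (simp add: W2_def zz)
  define d where "d = (\<lambda>n. Z n - Y n + e n)"
  obtain s where s: "strict_mono s" and Zs: "(\<lambda>n. Z (s n)) \<longlonglongrightarrow> z0" and Ys: "(\<lambda>n. Y (s n)) \<longlonglongrightarrow> z0"
    and ds: "(\<lambda>n. real (N (s n)) * norm (d (s n))) \<longlonglongrightarrow> 0"
    using doubling_maximizers_converge[OF Kc FK gK z0K strict el Nl N1(1) eK W2e ZY mx] unfolding d_def by blast
  \<comment> \<open>The right-hand side of \<open>comparison_arithmetic\<close> at the maximisers,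
    with \<open>N |d|\<close> in the role of \<open>\<beta>\<close>; it converges along the
    subsequence.\<close>
  define R where "R = (\<lambda>n. 2 * \<epsilon> * \<bar>fst (Z n) - t0\<bar>
     + \<alpha> * (norm (snd (Z n) - snd (Y n)) + (real (N n) * norm (d n) + \<theta>) * (2 * (real (N n) * norm (d n)) + \<theta>))
     + 2 * \<alpha> * \<epsilon> * ((1 + norm (snd (Z n))) * norm (snd (Z n) - x0)) + 2 * \<alpha> * \<epsilon> * cD * (1 + (norm (snd (Z n)))\<^sup>2))"
  have key: "\<rho> * (W1 (Z n) - W2 (Y n)) \<le> R n"
    if c1: "fst (Z n) < T" "fst (Y n) < T" and c2: "snd (Y n) \<in> U" and c3: "dist (Z n) z0 < 1/2" "dist (Y n) z0 < 1/2"
      and c4: "norm (snd (Z n) - snd (Y n)) \<le> 1" for n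
  proof -
    define z y where "z = Z n" and "y = Y n"
    define f0 where "f0 = f z"
    define s0 where "s0 = 1 + (norm (snd z))\<^sup>2"
    have s0: "s0 > 0" by (simp add: s0_def add_pos_nonneg)
    \<comment> \<open>Slopes and quadratic coefficients of the doubled test function at
      \<open>(z, y)\<close>. \<open>a1\<close> collects coupling, penalty and localising square,
      \<open>a2\<close> the coupling alone. \<open>b\<close> and \<open>c\<close> are twice the
      coefficients of the quadratic majorant, as forms enter with the factor 1/2.\<close>
    define a1 where "a1 = (real (N n))\<^sup>2 *\<^sub>R d n + (\<delta> * f0) *\<^sub>R (- \<kappa>, (2 * real m / s0) *\<^sub>R snd z) + (2 * \<epsilon>) *\<^sub>R (z - z0)"
    define a2 where "a2 = - ((real (N n))\<^sup>2 *\<^sub>R d n)"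
    define b where "b = 2 * (2 * \<delta> * f0 * \<kappa>\<^sup>2 + \<epsilon>)"
    define c where "c = 2 * (\<delta> * f0 * (real m + 18 * (real m)\<^sup>2) / s0 + \<epsilon>)"
    have zD: "z \<in> D" "y \<in> D" using ZY by (auto simp: K_def z_def y_def)
    obtain \<sigma> where \<sigma>: "\<sigma> > 0" "cball (snd y) \<sigma> \<subseteq> U"
      using open_contains_cball[THEN iffD1, OF assms(1)] c2 unfolding y_def by blast
    define r1 where "r1 = 1 / (1 + \<kappa> + 3 * real m)"
    have r1: "r1 > 0" using \<kappa> by (simp add: r1_def add_pos_nonneg)
    \<comment> \<open>Perturbations of this size stay before time \<open>T\<close>, inside the unit
      ball where \<open>(z, y)\<close> is maximal, within \<open>U\<close> for the second point, and
      in the range of the quadratic majorant.\<close>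
    define r0 where "r0 = min (min (1/2) r1) (min \<sigma> (min ((T - fst z) / 2) ((T - fst y) / 2)))"
    have r0: "r0 > 0" "r0 \<le> 1/2" "r0 \<le> r1" "r0 \<le> \<sigma>" "fst z + r0 < T" "fst y + r0 < T"
    proof -
      have zy: "fst z < T" "fst y < T" using c1 by (simp_all add: z_def y_def)
      show "r0 > 0" using r1 \<sigma> zy by (simp add: r0_def)
      show "r0 \<le> 1/2" "r0 \<le> r1" "r0 \<le> \<sigma>" unfolding r0_def by linarith+
      have "r0 \<le> (T - fst z) / 2" "r0 \<le> (T - fst y) / 2" unfolding r0_def by linarith+
      then show "fst z + r0 < T" "fst y + r0 < T" using zy by (simp_all add: field_simps)
    qed
    let ?S1 = "{0..<T} \<times> closure U" and ?S2 = "{0..<T} \<times> U"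
    have fb: "fst q < T" if "q \<in> cball p r0" "fst p + r0 < T" for p q :: "real \<times> (real^'n)"
    proof -
      have "\<bar>fst p - fst q\<bar> \<le> r0" using that(1) dist_fst_le[of p q] by (simp add: dist_real_def)
      then show ?thesis using that(2) by linarith
    qed
    have S1: "?S1 \<inter> cball z r0 = D \<inter> cball z r0"
    proof -
      have "a < T" "a \<le> T" if "dist z (a, b) \<le> r0" for a b using fb[of "(a, b)" z] r0(5) that by simp_all
      then show ?thesis by (auto simp: D_def)
    qed
    have S2: "?S2 \<inter> cball y r0 = D \<inter> cball y r0"
    proof -
      have "snd q \<in> U" if "q \<in> cball y r0" for q
        using that dist_snd_le[of y q] r0(4) \<sigma>(2) by (auto simp: subset_iff)
      then have "b \<in> U" if "dist y (a, b) \<le> r0" for a b using that by force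
      moreover have "a < T" "a \<le> T" if "dist y (a, b) \<le> r0" for a b using fb[of "(a, b)" y] r0(6) that by simp_all
      ultimately show ?thesis using closure_subset[of U] by (auto simp: D_def)
    qed
    have sub1: "?S1 \<subseteq> D" "?S2 \<subseteq> D" using closure_subset[of U] by (auto simp: D_def)
    have local_max: "W1 (z + k1) - W2 (y + k2) \<le> W1 z - W2 y + a1 \<bullet> k1 + a2 \<bullet> k2
        + ((real (N n))\<^sup>2 * (norm (k1 - k2))\<^sup>2 + b * (fst k1)\<^sup>2 + c * (norm (snd k1))\<^sup>2) / 2"
      if k: "norm k1 \<le> r0" "norm k2 \<le> r0" "z + k1 \<in> ?S1" "y + k2 \<in> ?S2" for k1 k2
    proof -
      have inK: "p + k \<in> K" if "dist p z0 < 1/2" "norm k \<le> r0" "p + k \<in> D" for p k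
      proof -
        have "norm (p + k - z0) \<le> norm (p - z0) + norm k" using norm_triangle_ineq[of "p - z0" k] by (simp add: algebra_simps)
        then have "dist z0 (p + k) \<le> 1" using that r0(2) by (simp add: dist_norm norm_minus_commute)
        then show ?thesis using that(3) by (simp add: K_def)
      qed
      have kD: "z + k1 \<in> D" "y + k2 \<in> D" by (rule subsetD[OF sub1(1) k(3)], rule subsetD[OF sub1(2) k(4)])
      have "z + k1 \<in> K" by (rule inK[OF _ k(1) kD(1)]) (use c3 in \<open>simp add: z_def\<close>)
      moreover have "y + k2 \<in> K" by (rule inK[OF _ k(2) kD(2)]) (use c3 in \<open>simp add: y_def\<close>)
      ultimately have inKK: "z + k1 \<in> K" "y + k2 \<in> K" .
      from mx[OF inKK, of n]
      have m1: "F (z + k1) - W2 (y + k2) - (real (N n))\<^sup>2 / 2 * (norm (z + k1 - (y + k2) + e n))\<^sup>2 \<le>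
        F z - W2 y - (real (N n))\<^sup>2 / 2 * (norm (d n))\<^sup>2" by (simp add: z_def y_def d_def)
      have dd: "z + k1 - (y + k2) + e n = d n + (k1 - k2)" by (simp add: d_def z_def y_def)
      have sq: "(norm (a + b))\<^sup>2 = (norm a)\<^sup>2 + 2 * (a \<bullet> b) + (norm b)\<^sup>2" for a b :: "real \<times> (real^'n)"
        by (simp add: power2_norm_eq_inner inner_add_left inner_add_right inner_commute)
      define A1 where "A1 = - \<kappa> * fst k1 + 2 * real m * (snd z \<bullet> snd k1) / s0"
      define hh where "hh = (norm (snd k1))\<^sup>2"
      define tt where "tt = (fst k1)\<^sup>2"
      define NN where "NN = (real (N n))\<^sup>2"
      have "f (z + k1) \<le> f0 * (1 + A1 + (real m + 18 * (real m)\<^sup>2) * hh / s0 + 2 * \<kappa>\<^sup>2 * tt)"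
        using penalty_upper_quadratic[OF \<kappa>, of k1 m T z] k(1) r0(3) unfolding f0_def f_def s0_def A1_def hh_def tt_def r1_def by simp
      then have "\<delta> * f (z + k1) \<le> \<delta> * (f0 * (1 + A1 + (real m + 18 * (real m)\<^sup>2) * hh / s0 + 2 * \<kappa>\<^sup>2 * tt))"
        using \<delta> by (intro mult_left_mono) auto
      also have "\<dots> = \<delta> * f0 + \<delta> * f0 * A1 + \<delta> * f0 * (real m + 18 * (real m)\<^sup>2) / s0 * hh + 2 * \<delta> * f0 * \<kappa>\<^sup>2 * tt"
        by (simp add: algebra_simps)
      finally have m2: "\<delta> * f (z + k1) \<le> \<delta> * f0 + \<delta> * f0 * A1 + \<delta> * f0 * (real m + 18 * (real m)\<^sup>2) / s0 * hh + 2 * \<delta> * f0 * \<kappa>\<^sup>2 * tt" .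
      have nk1: "(norm k1)\<^sup>2 = tt + hh" by (cases k1) (simp add: tt_def hh_def norm_Pair)
      have "z + k1 - z0 = (z - z0) + k1" by simp
      then have m3: "\<epsilon> * (norm (z + k1 - z0))\<^sup>2 = \<epsilon> * (norm (z - z0))\<^sup>2 + 2 * \<epsilon> * ((z - z0) \<bullet> k1) + \<epsilon> * tt + \<epsilon> * hh"
        by (simp only: sq nk1) (simp add: ring_distribs)
      have m4: "NN / 2 * (norm (z + k1 - (y + k2) + e n))\<^sup>2 = NN / 2 * (norm (d n))\<^sup>2 + NN * (d n \<bullet> k1) - NN * (d n \<bullet> k2) + NN / 2 * (norm (k1 - k2))\<^sup>2"
        unfolding dd sq by (simp add: inner_diff_right ring_distribs)
      have "(- \<kappa>, (2 * real m / s0) *\<^sub>R snd z) \<bullet> k1 = A1"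
        by (cases k1) (simp add: A1_def)
      then have "a1 \<bullet> k1 = NN * (d n \<bullet> k1) + \<delta> * f0 * A1 + 2 * \<epsilon> * ((z - z0) \<bullet> k1)"
        by (simp only: a1_def NN_def inner_add_left inner_scaleR_left)
      then have m5: "a1 \<bullet> k1 + a2 \<bullet> k2 = NN * (d n \<bullet> k1) + \<delta> * f0 * A1 + 2 * \<epsilon> * ((z - z0) \<bullet> k1) - NN * (d n \<bullet> k2)"
        by (simp add: a2_def NN_def)
      have m6: "(NN * (norm (k1 - k2))\<^sup>2 + b * tt + c * hh) / 2 = NN / 2 * (norm (k1 - k2))\<^sup>2 + 2 * \<delta> * f0 * \<kappa>\<^sup>2 * tt + \<epsilon> * tt
          + \<delta> * f0 * (real m + 18 * (real m)\<^sup>2) / s0 * hh + \<epsilon> * hh"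
        by (simp add: b_def c_def field_simps)
      show ?thesis
        using m1 m2 m3 m4 m5 m6 unfolding F_def f0_def[symmetric] NN_def[symmetric] hh_def[symmetric] tt_def[symmetric] by linarith
    qed
    have gap: "\<rho> * (W1 z - W2 y) - (fst a1 + fst a2) \<le>
      \<alpha> * (norm (snd z - snd y) * (1 + norm (snd a2) + (real (N n))\<^sup>2 * norm (snd z - snd y))
         + (1 + norm (snd z)) * norm (snd a1 + snd a2) + (1 + (norm (snd z))\<^sup>2) * (\<bar>c\<bar> * cD))"
      unfolding W1_def W2_def cD_def
    proof (rule viscosity_gap[OF E assms(7) assms(9) assms(2) assms(3)])
      show "z \<in> ?S1" "y \<in> ?S2" using zD c1 c2 by (auto simp: D_def z_def y_def mem_Times_iff)
      show "r0 > 0" by (rule r0)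
      show "compact (?S1 \<inter> cball z r0)" "compact (?S2 \<inter> cball y r0)"
        unfolding S1 S2 using Dc by (auto intro: closed_Int_compact)
      show "usc_on ?S1 (\<lambda>z. w1 (fst z) (snd z))" using usc_on_subset[OF usc sub1(1)] by (simp add: W1_def)
      show "lsc_on ?S2 (\<lambda>z. w2 (fst z) (snd z))"
        using lsc sub1(2) unfolding lsc_on_def W2_def by (meson at_le filter_leD subsetD)
      show "w1 (fst (z + k1)) (snd (z + k1)) - w2 (fst (y + k2)) (snd (y + k2)) \<le> w1 (fst z) (snd z) - w2 (fst y) (snd y)
          + a1 \<bullet> k1 + a2 \<bullet> k2 + ((real (N n))\<^sup>2 * (norm (k1 - k2))\<^sup>2 + b * (fst k1)\<^sup>2 + c * (norm (snd k1))\<^sup>2) / 2"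
        if "norm k1 \<le> r0" "norm k2 \<le> r0" "z + k1 \<in> ?S1" "y + k2 \<in> ?S2" for k1 k2
        using local_max[OF that] by (simp only: W1_def W2_def)
      show "snd z \<in> closure U" "snd y \<in> closure U" using zD by (auto simp: D_def mem_Times_iff)
      show "norm (snd z - snd y) \<le> 1" using c4 by (simp add: z_def y_def)
      show "N n \<ge> 1" by (rule N1)
    qed
    have "\<rho> * (W1 z - W2 y) \<le> 2 * \<epsilon> * \<bar>fst z - t0\<bar>
      + \<alpha> * (norm (snd z - snd y) + (real (N n) * norm (d n) + \<theta>) * (2 * (real (N n) * norm (d n)) + \<theta>))
      + 2 * \<alpha> * \<epsilon> * ((1 + norm (snd z)) * norm (snd z - x0)) + 2 * \<alpha> * \<epsilon> * cD * (1 + (norm (snd z))\<^sup>2)"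
    proof (rule comparison_arithmetic[OF gap])
      show "a1 = (real (N n))\<^sup>2 *\<^sub>R d n + (\<delta> * f0) *\<^sub>R (- \<kappa>, (2 * real m / s0) *\<^sub>R snd z) + (2 * \<epsilon>) *\<^sub>R ((fst z, snd z) - (t0, x0))"
        by (simp add: a1_def zz[symmetric] del: diff_Pair)
      show "real (N n) * norm (snd (e n)) \<le> \<theta>" by (rule Ne)
      show "snd (d n) = snd z - snd y + snd (e n)" by (simp add: d_def z_def y_def)
    qed (use \<alpha> \<delta> \<epsilon> cD \<theta> N1(1)[of n] fpos in \<open>simp_all add: a2_def c_def s0_def \<kappa>_def f0_def\<close>)
    then show ?thesis by (simp add: R_def z_def y_def)
  qed
  note sl = LIMSEQ_subseq_LIMSEQ[OF _ s, unfolded o_def]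
  \<comment> \<open>The values at the maximisers are bounded below by this competitor, whose value
    converges to that of \<open>z0\<close>; semicontinuity would bound them only from above.\<close>
  have lim0: "(\<lambda>n. \<rho> * (F z0 - W2 (z0 + e (s n)))) \<longlonglongrightarrow> \<rho> * (F z0 - W2 z0)"
    by (intro tendsto_intros sl[OF W2e])
  have limR: "(\<lambda>n. R (s n)) \<longlonglongrightarrow> 2 * \<epsilon> * \<bar>fst z0 - t0\<bar> + \<alpha> * (norm (snd z0 - snd z0) + (0 + \<theta>) * (2 * 0 + \<theta>))
     + 2 * \<alpha> * \<epsilon> * ((1 + norm (snd z0)) * norm (snd z0 - x0)) + 2 * \<alpha> * \<epsilon> * cD * (1 + (norm (snd z0))\<^sup>2)"
    unfolding R_def by (intro tendsto_intros Zs Ys ds)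
  have "eventually (\<lambda>n. \<rho> * (F z0 - W2 (z0 + e (s n))) \<le> R (s n)) sequentially"
  proof -
    have z0T: "fst z0 < T" and z0V: "snd z0 \<in> V" using t0T V by (simp_all add: zz)
    have "eventually (\<lambda>n. fst (Z (s n)) < T) sequentially" by (rule order_tendstoD(2)[OF tendsto_fst[OF Zs] z0T])
    moreover have "eventually (\<lambda>n. fst (Y (s n)) < T) sequentially" by (rule order_tendstoD(2)[OF tendsto_fst[OF Ys] z0T])
    moreover have "eventually (\<lambda>n. dist (Z (s n)) z0 < 1/2) sequentially" by (rule tendstoD[OF Zs]) simp
    moreover have "eventually (\<lambda>n. dist (Y (s n)) z0 < 1/2) sequentially" by (rule tendstoD[OF Ys]) simp
    moreover have "eventually (\<lambda>n. snd (Z (s n)) \<in> V) sequentially" by (rule topological_tendstoD[OF tendsto_snd[OF Zs] V(1) z0V])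
    moreover have "eventually (\<lambda>n. real (N (s n)) * norm (d (s n)) < \<nu>) sequentially" by (rule order_tendstoD(2)[OF ds \<nu>])
    ultimately show ?thesis
    proof eventually_elim
      case (elim n)
      let ?n = "s n"
      have nsd: "norm (snd (d ?n)) \<le> norm (d ?n)" using norm_snd_le[of "snd (d ?n)" "fst (d ?n)"] by simp
      \<comment> \<open>The space component of \<open>Y\<close> is that of \<open>Z\<close> plus the
        shift minus that of \<open>d\<close>. Since \<open>N |d|\<close> tends to 0, the last term
        is a perturbation that class R admits, and \<open>Y\<close> lands in the open set.\<close>
      have "real (N ?n) * norm (- snd (d ?n)) \<le> real (N ?n) * norm (d ?n)" using nsd by (simp add: mult_left_mono)
      then have "real (N ?n) * norm (- snd (d ?n)) \<le> \<nu>" using elim(6) by linarith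
      moreover have "snd (Z ?n) \<in> closure U \<inter> V" using ZY(1)[of ?n] elim(5) by (auto simp: K_def D_def mem_Times_iff)
      ultimately have "snd (Z ?n) + snd (e ?n) + - snd (d ?n) \<in> U" by (intro nt)
      then have yU: "snd (Y ?n) \<in> U" by (simp add: d_def)
      have "dist (snd (Z ?n)) (snd (Y ?n)) \<le> dist (Z ?n) (Y ?n)" by (rule dist_snd_le)
      also have "\<dots> \<le> dist (Z ?n) z0 + dist (Y ?n) z0" by (rule dist_triangle2)
      finally have n1: "norm (snd (Z ?n) - snd (Y ?n)) \<le> 1" using elim(3,4) by (simp add: dist_norm)
      have k: "\<rho> * (W1 (Z ?n) - W2 (Y ?n)) \<le> R ?n" by (rule key[OF elim(1,2) yU elim(3,4) n1])
      have "F z0 - W2 (z0 + e ?n) \<le> F (Z ?n) - W2 (Y ?n) - (real (N ?n))\<^sup>2 / 2 * (norm (Z ?n - Y ?n + e ?n))\<^sup>2"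
        using mx[OF z0K eK, of ?n ?n] by simp
      also have "\<dots> \<le> F (Z ?n) - W2 (Y ?n)" by simp
      also have "\<dots> \<le> W1 (Z ?n) - W2 (Y ?n)"
      proof -
        have "0 \<le> \<delta> * f (Z ?n)" "0 \<le> \<epsilon> * (norm (Z ?n - z0))\<^sup>2" using \<delta> \<epsilon> fpos[of "Z ?n"] by simp_all
        then show ?thesis by (simp add: F_def)
      qed
      finally have "\<rho> * (F z0 - W2 (z0 + e ?n)) \<le> \<rho> * (W1 (Z ?n) - W2 (Y ?n))" using assms(2) by (intro mult_left_mono) auto
      then show ?case using k by linarith
    qed
  qed
  from tendsto_le[OF sequentially_bot limR lim0 this]
  have fin: "\<rho> * (F z0 - W2 z0) \<le> \<alpha> * \<theta>\<^sup>2 + 2 * \<alpha> * \<epsilon> * cD * (1 + (norm x0)\<^sup>2)" by (simp add: zz power2_eq_square)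
  have FM: "F z0 - W2 z0 = M" by (simp add: F_def M_def)
  have "\<rho> * M \<le> \<rho> * M / 4 + \<rho> * M / 8" using fin \<theta>(2) \<epsilon>' unfolding FM by linarith
  moreover have "\<rho> * M > 0" using assms(2) M by simp
  ultimately show False by linarith
qed


end
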